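(* Let $\{(G_n,\mathbb P_n):n\in\mathbb N\}$ be a sequence of spin systems, where $\{G_n\}$ is an expander sequence of finite graphs with bounded degrees, converging in the Benjamini–Schramm sense to a limiting spin system $(G,\mathbb P)$ with $G$ transitive. If the $\mathsf{Aut}(G)$-invariant measure $\mathbb P$ is not $\mathsf{Aut}(G)$-ergodic, then there is random sparse reconstruction for $\{(G_n,\mathbb P_n):n\in\mathbb N\}$ (and sparse reconstruction with respect to $\Gamma_n=\mathsf{Aut}(G_n)$ in case every $G_n$ is transitive and $\mathbb P_n$ is $\mathsf{Aut}(G_n)$-invariant).
   Context: Graphs may be edge-labelled; $\mathsf{Aut}$ denotes the group of label-preserving automorphisms, and transitive means that this group acts transitively on vertices. A spin system $(G_n,\mathbb P_n)$ is a finite graph $G_n(V_n,E_n)$ with a probability measure $\mathbb P_n$ on $\{-1,1\}^{V_n}$; $(G,\mathbb P)$ is an infinite transitive graph $G(V,E)$ with an $\mathsf{Aut}(G)$-invariant measure $\mathbb P$ on $\{-1,1\}^V$. Benjamini–Schramm convergence $(G_n,\mathbb P_n)\to(G,\mathbb P)$: for every $R\in\mathbb N$ and every finite rooted vertex- and edge-labelled graph $B$, the probability (jointly over a uniformly random root $v\in V_n$ and the configuration sampled from $\mathbb P_n$, viewed as vertex labels) that the labelled $R$-ball around $v$ in $G_n$ is isomorphic to $B$ converges to the $\mathbb P$-probability that the labelled $R$-ball around a fixed root in $G$ is isomorphic to $B$. $\{G_n\}$ with $|V_n|\to\infty$ and uniformly bounded degrees is an expander sequence if there is $h>0$ with $\min\{|\partial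 W|/|W|: \emptyset\ne W\subseteq V_n, |W|\le|V_n|/2\}>h$ for all $n$, where $\partial W$ is the set of edges between $W$ and its complement. $\mathbb P$ is $\Gamma$-ergodic if every $\Gamma$-invariant event has $\mathbb P$-probability $0$ or $1$. Clue: $\mathsf{clue}(f\,|\,U):=\mathrm{Var}(\mathbb E[f\,|\,\mathcal F_U])/\mathrm{Var}(f)$, where $\mathcal F_U$ is generated by the spins in $U$ (clue $=0$ if $\mathrm{Var}(f)=0$). Random sparse reconstruction: there exist Boolean functions $f_n:\{-1,1\}^{V_n}\to\{-1,1\}$, random subsets $\mathcal U_n\subseteq V_n$ independent of the spins with $\max_{j\in V_n}\mathbb P[j\in\mathcal U_n]\to0$, and $c>0$ with $\mathbb E[\mathsf{clue}(f_n\,|\,\mathcal U_n)]>c$ for all $n$. Sparse reconstruction with respect to $\Gamma_n$ (acting transitively on $V_n$ and preserving $\mathbb P_n$): there exist $\Gamma_n$-invariant functions $f_n:\{-1,1\}^{V_n}\to\mathbb R$ and deterministic $U_n\subseteq V_n$ with $|U_n|/|V_n|\to0$ and $\liminf_n\mathsf{clue}(f_n\,|\,U_n)>0$.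
   Formalization: The bound E[clue(f_n|U_n)] > c is proved for all sufficiently large n rather than all n (it fails at any n where P_n is a point mass), and the limit graph G is assumed locally finite (otherwise, with infinitely many edge labels, convergence can hold vacuously). *)

theory Defs
  imports "HOL-Probability.Probability"
begin

section \<open>Edge-labelled graphs\<close>

text \<open>
  Edges are two-element sets of vertices (see \<open>wf_lgraph\<close>). The value of \<open>elabel\<close> outside
  \<open>edges\<close> is irrelevant; a graph without labels is the case of the label type \<open>unit\<close>.
\<close>

record ('v, 'l) lgraph =
  verts :: "'v set"
  edges :: "'v set set"
  elabel :: "'v set \<Rightarrow> 'l"

definition wf_lgraph :: "('v, 'l) lgraph \<Rightarrow> bool" where
  "wf_lgraph G \<longleftrightarrow>
     verts G \<noteq> {} \<and> (\<forall>e\<in>edges G. \<exists>u\<in>verts G. \<exists>v\<in>verts G. u \<noteq> v \<and> e = {u, v})"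

definition incident_edges :: "('v, 'l) lgraph \<Rightarrow> 'v \<Rightarrow> 'v set set" where
  "incident_edges G v = {e \<in> edges G. v \<in> e}"

definition locally_finite :: "('v, 'l) lgraph \<Rightarrow> bool" where
  "locally_finite G \<longleftrightarrow> (\<forall>v\<in>verts G. finite (incident_edges G v))"

definition graph_iso :: "('v \<Rightarrow> 'w) \<Rightarrow> ('v, 'l) lgraph \<Rightarrow> ('w, 'l) lgraph \<Rightarrow> bool" where
  "graph_iso \<phi> G H \<longleftrightarrow>
     bij_betw \<phi> (verts G) (verts H) \<and>
     (\<forall>u\<in>verts G. \<forall>v\<in>verts G. {u, v} \<in> edges G \<longleftrightarrow> {\<phi> u, \<phi> v} \<in> edges H) \<and>
     (\<forall>e\<in>edges G. elabel H (\<phi> ` e) = elabel G e)"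

text \<open>Automorphisms are normalised to be \<open>undefined\<close> outside the vertex set.\<close>

definition Aut :: "('v, 'l) lgraph \<Rightarrow> ('v \<Rightarrow> 'v) set" where
  "Aut G = {\<gamma> \<in> extensional (verts G). graph_iso \<gamma> G G}"

definition transitive_graph :: "('v, 'l) lgraph \<Rightarrow> bool" where
  "transitive_graph G \<longleftrightarrow> (\<forall>u\<in>verts G. \<forall>v\<in>verts G. \<exists>\<gamma>\<in>Aut G. \<gamma> u = v)"

definition gball_verts :: "('v, 'l) lgraph \<Rightarrow> nat \<Rightarrow> 'v \<Rightarrow> 'v set" where
  "gball_verts G R v =
     {w \<in> verts G. \<exists>k\<le>R. (v, w) \<in> {(x, y). {x, y} \<in> edges G} ^^ k}"

text \<open>The \<open>R\<close>-ball is the subgraph induced by the vertices at distance at most \<open>R\<close>.\<close>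

definition gball :: "('v, 'l) lgraph \<Rightarrow> nat \<Rightarrow> 'v \<Rightarrow> ('v, 'l) lgraph" where
  "gball G R v =
     \<lparr>verts = gball_verts G R v,
      edges = {e \<in> edges G. e \<subseteq> gball_verts G R v},
      elabel = elabel G\<rparr>"

definition edge_boundary :: "('v, 'l) lgraph \<Rightarrow> 'v set \<Rightarrow> 'v set set" where
  "edge_boundary G W = {e \<in> edges G. \<exists>u\<in>W. \<exists>v\<in>verts G - W. e = {u, v}}"

definition bounded_degrees :: "(nat \<Rightarrow> ('v, 'l) lgraph) \<Rightarrow> bool" where
  "bounded_degrees G \<longleftrightarrow>
     (\<exists>D. \<forall>n. \<forall>v\<in>verts (G n). finite (incident_edges (G n) v) \<and> card (incident_edges (G n) v) \<le> D)"

definition expander_sequence :: "(nat \<Rightarrow> ('v, 'l) lgraph) \<Rightarrow> bool" where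
  "expander_sequence G \<longleftrightarrow>
     (\<forall>n. finite (verts (G n))) \<and>
     filterlim (\<lambda>n. card (verts (G n))) at_top sequentially \<and>
     bounded_degrees G \<and>
     (\<exists>h>0. \<forall>n. \<forall>W. W \<noteq> {} \<and> W \<subseteq> verts (G n) \<and> real (card W) \<le> real (card (verts (G n))) / 2 \<longrightarrow>
        real (card (edge_boundary (G n) W)) / real (card W) > h)"


section \<open>Spin systems\<close>

definition spin_space :: "'v set \<Rightarrow> ('v \<Rightarrow> int) measure" where
  "spin_space V = (\<Pi>\<^sub>M v\<in>V. count_space {-1, 1})"

text \<open>
  The pullback of a configuration is the action of the inverse of \<open>\<gamma>\<close>. Invariance of
  functions, events and measures under a permutation is the same as under its inverse.
\<close>

definition spin_pull :: "'v set \<Rightarrow> ('v \<Rightarrow> 'v) \<Rightarrow> ('v \<Rightarrow> int) \<Rightarrow> ('v \<Rightarrow> int)" where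
  "spin_pull V \<gamma> \<omega> = (\<lambda>v\<in>V. \<omega> (\<gamma> v))"

definition invariant_measure :: "'v set \<Rightarrow> ('v \<Rightarrow> 'v) set \<Rightarrow> ('v \<Rightarrow> int) measure \<Rightarrow> bool" where
  "invariant_measure V \<Gamma> P \<longleftrightarrow> (\<forall>\<gamma>\<in>\<Gamma>. distr P (spin_space V) (spin_pull V \<gamma>) = P)"

definition invariant_fun ::
    "'v set \<Rightarrow> ('v \<Rightarrow> 'v) set \<Rightarrow> (('v \<Rightarrow> int) \<Rightarrow> real) \<Rightarrow> bool" where
  "invariant_fun V \<Gamma> f \<longleftrightarrow> (\<forall>\<gamma>\<in>\<Gamma>. \<forall>\<omega>\<in>space (spin_space V). f (spin_pull V \<gamma> \<omega>) = f \<omega>)"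

definition invariant_event :: "'v set \<Rightarrow> ('v \<Rightarrow> 'v) set \<Rightarrow> ('v \<Rightarrow> int) set \<Rightarrow> bool" where
  "invariant_event V \<Gamma> A \<longleftrightarrow>
     A \<in> sets (spin_space V) \<and>
     (\<forall>\<gamma>\<in>\<Gamma>. {\<omega> \<in> space (spin_space V). spin_pull V \<gamma> \<omega> \<in> A} = A)"

definition ergodic :: "'v set \<Rightarrow> ('v \<Rightarrow> 'v) set \<Rightarrow> ('v \<Rightarrow> int) measure \<Rightarrow> bool" where
  "ergodic V \<Gamma> P \<longleftrightarrow>
     (\<forall>A. invariant_event V \<Gamma> A \<longrightarrow> measure P A = 0 \<or> measure P A = 1)"

definition spin_measure :: "'v set \<Rightarrow> ('v \<Rightarrow> int) measure \<Rightarrow> bool" where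
  "spin_measure V P \<longleftrightarrow> prob_space P \<and> sets P = sets (spin_space V)"

definition finite_spin_system :: "('v, 'l) lgraph \<Rightarrow> ('v \<Rightarrow> int) measure \<Rightarrow> bool" where
  "finite_spin_system G P \<longleftrightarrow> wf_lgraph G \<and> finite (verts G) \<and> spin_measure (verts G) P"

text \<open>
  Local finiteness is the usual convention for limits in the sense of Benjamini and Schramm:
  it says that the balls are finite graphs, so that they can be tested against finite ones.
\<close>

definition limit_spin_system :: "('v, 'l) lgraph \<Rightarrow> ('v \<Rightarrow> int) measure \<Rightarrow> bool" where
  "limit_spin_system G P \<longleftrightarrow>
     wf_lgraph G \<and> infinite (verts G) \<and> locally_finite G \<and> transitive_graph G \<and>
     spin_measure (verts G) P \<and> invariant_measure (verts G) (Aut G) P"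


section \<open>Benjamini-Schramm convergence\<close>

definition rooted_iso ::
    "('v, 'l) lgraph \<Rightarrow> 'v \<Rightarrow> ('v \<Rightarrow> int) \<Rightarrow> ('w, 'l) lgraph \<Rightarrow> 'w \<Rightarrow> ('w \<Rightarrow> int) \<Rightarrow> bool" where
  "rooted_iso G r \<sigma> H s \<tau> \<longleftrightarrow>
     (\<exists>\<phi>. graph_iso \<phi> G H \<and> \<phi> r = s \<and> (\<forall>v\<in>verts G. \<tau> (\<phi> v) = \<sigma> v))"

text \<open>
  The test graphs \<open>B\<close> have natural numbers as vertices: up to isomorphism these are all finite
  graphs. The vertex \<open>\<rho>\<close> is the fixed root of the limiting graph.
\<close>

definition BS_converges ::
    "(nat \<Rightarrow> ('v, 'l) lgraph) \<Rightarrow> (nat \<Rightarrow> ('v \<Rightarrow> int) measure) \<Rightarrow>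
     ('w, 'l) lgraph \<Rightarrow> ('w \<Rightarrow> int) measure \<Rightarrow> 'w \<Rightarrow> bool" where
  "BS_converges Gn Pn G P \<rho> \<longleftrightarrow>
     (\<forall>R. \<forall>(B :: (nat, 'l) lgraph) b \<tau>.
        wf_lgraph B \<and> finite (verts B) \<and> b \<in> verts B \<and> \<tau> \<in> verts B \<rightarrow> {-1, 1} \<longrightarrow>
        (\<lambda>n. measure (uniform_count_measure (verts (Gn n)) \<Otimes>\<^sub>M Pn n)
               {(v, \<omega>). v \<in> verts (Gn n) \<and> \<omega> \<in> space (Pn n) \<and>
                        rooted_iso (gball (Gn n) R v) v \<omega> B b \<tau>})
        \<longlonglongrightarrow> measure P {\<omega> \<in> space P. rooted_iso (gball G R \<rho>) \<rho> \<omega> B b \<tau>})"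


section \<open>Clue and sparse reconstruction\<close>

definition spin_algebra :: "('v \<Rightarrow> int) measure \<Rightarrow> 'v set \<Rightarrow> ('v \<Rightarrow> int) measure" where
  "spin_algebra P U = vimage_algebra (space P) (\<lambda>\<omega>. restrict \<omega> U) (spin_space U)"

definition clue :: "('v \<Rightarrow> int) measure \<Rightarrow> (('v \<Rightarrow> int) \<Rightarrow> real) \<Rightarrow> 'v set \<Rightarrow> real" where
  "clue P f U =
     (if prob_space.variance P f = 0 then 0
      else prob_space.variance P (real_cond_exp P (spin_algebra P U) f) / prob_space.variance P f)"

text \<open>
  A random subset independent of the spins enters only through its law, here a \<open>pmf\<close>. The lower
  bound on the expected clue is asked for all large \<open>n\<close>: like the other conditions it is
  asymptotic, and finitely many initial measures may be point masses, for which every clue is 0.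
\<close>

definition random_sparse_reconstruction ::
    "(nat \<Rightarrow> ('v, 'l) lgraph) \<Rightarrow> (nat \<Rightarrow> ('v \<Rightarrow> int) measure) \<Rightarrow> bool" where
  "random_sparse_reconstruction G P \<longleftrightarrow>
     (\<exists>(f :: nat \<Rightarrow> ('v \<Rightarrow> int) \<Rightarrow> real) (U :: nat \<Rightarrow> 'v set pmf) c.
        (\<forall>n. f n \<in> space (P n) \<rightarrow> {-1, 1}) \<and>
        (\<forall>n. set_pmf (U n) \<subseteq> Pow (verts (G n))) \<and>
        (\<lambda>n. MAX j\<in>verts (G n). measure_pmf.prob (U n) {W. j \<in> W}) \<longlonglongrightarrow> 0 \<and>
        c > 0 \<and>
        (\<forall>\<^sub>F n in sequentially. measure_pmf.expectation (U n) (clue (P n) (f n)) > c))"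

definition sparse_reconstruction ::
    "(nat \<Rightarrow> ('v, 'l) lgraph) \<Rightarrow> (nat \<Rightarrow> ('v \<Rightarrow> int) measure) \<Rightarrow> (nat \<Rightarrow> ('v \<Rightarrow> 'v) set) \<Rightarrow> bool" where
  "sparse_reconstruction G P \<Gamma> \<longleftrightarrow>
     (\<exists>(f :: nat \<Rightarrow> ('v \<Rightarrow> int) \<Rightarrow> real) (U :: nat \<Rightarrow> 'v set).
        (\<forall>n. invariant_fun (verts (G n)) (\<Gamma> n) (f n)) \<and>
        (\<forall>n. U n \<subseteq> verts (G n)) \<and>
        (\<lambda>n. real (card (U n)) / real (card (verts (G n)))) \<longlonglongrightarrow> 0 \<and>
        liminf (\<lambda>n. ereal (clue (P n) (f n) (U n))) > 0)"

end

theory Submission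
  imports Defs
begin

text \<open>
  A nontrivial invariant event \<open>A\<close> is approximated by an event seen by the spins in a ball around
  the root, and the approximation can be chosen as a function of the isomorphism type of the
  labelled ball, so it can be evaluated at every vertex of \<open>G\<^sub>n\<close>. As \<open>A\<close> is invariant,
  neighbouring vertices of \<open>G\<close> rarely disagree about it; hence in \<open>G\<^sub>n\<close> the set of vertices that
  detect \<open>A\<close> has a small edge boundary, and by expansion it contains almost all or almost none of
  the vertices. The majority of the local verdicts is therefore a nondegenerate Boolean function
  which the ball around a uniformly random vertex predicts with small error.

  The limit is not assumed to be connected, while only the component of the root is visible in
  \<open>G\<^sub>n\<close>. If no component carries a nontrivial invariant event, then an invariant event is
  independent of the spins on one component after the other, so it is independent of itself.
\<close>

section \<open>Isomorphisms, balls and induced subgraphs\<close>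

text \<open>Two obstacles shape the proof. An isomorphism between balls of \<open>G\<close> need not
  come from an automorphism, so invariance of the event alone does not make a verdict on a ball a
  function of its isomorphism type. The remedy is to take the Bayes rule on a ball of radius
  \<open>r\<close>, which is canonical and hence invariant under automorphisms fixing the root, and
  to read it through isomorphisms of a larger ball of radius \<open>R\<close>. By compactness these
  act on the small ball like automorphisms, provided that \<open>G\<close> is connected. In the
  disconnected case independence comes from automorphisms that move a single component, but the
  event found on a component is a level set of a density. It is invariant only up to null sets, so
  the connected case is proved for such events. Constants: with \<open>p\<close> the probability of
  the event and \<open>s = p * (1 - p)\<close>, the local errors are tuned so that a random vertex
  contradicts the majority with probability at most \<open>s / 8\<close>, while the majority has
  variance at least \<open>3 * s\<close>. The average clue is then at least 1 - (s/2)/(3s) =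
  5/6.\<close>

abbreviation adj :: "('v, 'l) lgraph \<Rightarrow> ('v \<times> 'v) set" where
  "adj G \<equiv> {(x, y). {x, y} \<in> edges G}"

text \<open>The label function is kept untouched, as in \<open>gball\<close>; balls of an induced
  subgraph can then be equal to balls of \<open>G\<close>, not merely isomorphic.\<close>

definition induced :: "('v, 'l) lgraph \<Rightarrow> 'v set \<Rightarrow> ('v, 'l) lgraph" where
  "induced G S = \<lparr>verts = S, edges = {e \<in> edges G. e \<subseteq> S}, elabel = elabel G\<rparr>"

lemma induced_simps [simp]:
  "verts (induced G S) = S"
  "edges (induced G S) = {e \<in> edges G. e \<subseteq> S}"
  "elabel (induced G S) = elabel G"
  by (simp_all add: induced_def)

lemma gball_induced: "gball G R v = induced G (gball_verts G R v)"
  by (simp add: gball_def induced_def)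

lemma verts_gball [simp]: "verts (gball G R v) = gball_verts G R v"
  by (simp add: gball_induced)

lemma wf_edgeD:
  assumes "wf_lgraph G" "{x, y} \<in> edges G"
  shows "x \<in> verts G" "y \<in> verts G" "x \<noteq> y"
  using assms unfolding wf_lgraph_def by (force simp: doubleton_eq_iff)+

lemma wf_edge_cases:
  assumes "wf_lgraph G" "e \<in> edges G"
  obtains x y where "e = {x, y}" "x \<in> verts G" "y \<in> verts G" "x \<noteq> y"
  using assms unfolding wf_lgraph_def by blast

lemma wf_induced: "wf_lgraph G \<Longrightarrow> S \<noteq> {} \<Longrightarrow> wf_lgraph (induced G S)"
  unfolding wf_lgraph_def by fastforce

lemma gball_verts_subset: "gball_verts G R v \<subseteq> verts G"
  by (auto simp: gball_verts_def)

lemma gball_verts_centre: "v \<in> verts G \<Longrightarrow> v \<in> gball_verts G R v"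
  by (auto simp: gball_verts_def intro!: exI[of _ 0])

lemma gball_verts_mono: "R \<le> R' \<Longrightarrow> gball_verts G R v \<subseteq> gball_verts G R' v"
  unfolding gball_verts_def using le_trans by blast

lemma wf_gball: "wf_lgraph G \<Longrightarrow> v \<in> verts G \<Longrightarrow> wf_lgraph (gball G R v)"
  unfolding gball_induced by (rule wf_induced) (auto dest: gball_verts_centre)

lemma gball_verts_0: "v \<in> verts G \<Longrightarrow> gball_verts G 0 v = {v}"
  by (auto simp: gball_verts_def)

lemma adj_relpow_sym: "(v, w) \<in> adj G ^^ k \<Longrightarrow> (w, v) \<in> adj G ^^ k"
proof (induction k arbitrary: w)
  case (Suc k)
  then obtain y where "(v, y) \<in> adj G ^^ k" "(y, w) \<in> adj G" by auto
  then have "(w, y) \<in> adj G" "(y, v) \<in> adj G ^^ k" using Suc.IH by (auto simp: insert_commute)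
  then show ?case by (rule relpow_Suc_I2)
qed auto

lemma gball_verts_sym:
  "v \<in> verts G \<Longrightarrow> w \<in> gball_verts G R v \<Longrightarrow> v \<in> gball_verts G R w"
  by (auto simp: gball_verts_def dest: adj_relpow_sym)

lemma gball_verts_trans:
  assumes "w \<in> gball_verts G k v" shows "gball_verts G R w \<subseteq> gball_verts G (k + R) v"
proof
  fix x assume "x \<in> gball_verts G R w"
  then obtain i j where "i \<le> k" "j \<le> R" "(v, w) \<in> adj G ^^ i" "(w, x) \<in> adj G ^^ j" "x \<in> verts G"
    using assms by (auto simp: gball_verts_def)
  then show "x \<in> gball_verts G (k + R) v"
    by (auto simp: gball_verts_def relpow_add intro!: exI[of _ "i + j"])
qed

lemma gball_verts_adj:
  assumes "wf_lgraph G" "{v, w} \<in> edges G" shows "w \<in> gball_verts G 1 v"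
  using assms wf_edgeD[OF assms] by (auto simp: gball_verts_def intro!: exI[of _ 1])

text \<open>A path of length at most \<open>R\<close> from \<open>w\<close> stays inside the
  \<open>R\<close>-ball, hence inside \<open>S\<close>, so no such path is lost in the induced
  subgraph.\<close>

lemma gball_verts_of_induced:
  assumes wf: "wf_lgraph G" and w: "w \<in> verts G"
    and S: "gball_verts G R w \<subseteq> S" "S \<subseteq> verts G"
  shows "gball_verts (induced G S) R w = gball_verts G R w"
proof
  have mono: "(w, x) \<in> adj (induced G S) ^^ k \<Longrightarrow> (w, x) \<in> adj G ^^ k" for k x
    by (induction k arbitrary: x) auto
  show "gball_verts (induced G S) R w \<subseteq> gball_verts G R w"
    using S mono by (auto simp: gball_verts_def)
  have "(w, x) \<in> adj (induced G S) ^^ k" if "(w, x) \<in> adj G ^^ k" "k \<le> R" for k x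
    using that
  proof (induction k arbitrary: x)
    case (Suc k)
    then obtain y where y: "(w, y) \<in> adj G ^^ k" "{y, x} \<in> edges G" by auto
    have "x \<in> gball_verts G R w" unfolding gball_verts_def mem_Collect_eq
      using Suc.prems wf_edgeD(2)[OF wf y(2)] by blast
    moreover have "y \<in> gball_verts G R w" unfolding gball_verts_def mem_Collect_eq
      using Suc_leD[OF Suc.prems(2)] y(1) wf_edgeD(1)[OF wf y(2)] by blast
    ultimately
    have "(y, x) \<in> adj (induced G S)" using y S by auto
    moreover have "(w, y) \<in> adj (induced G S) ^^ k" using Suc y by auto
    ultimately show ?case by auto
  qed auto
  then show "gball_verts G R w \<subseteq> gball_verts (induced G S) R w"
    using S unfolding gball_verts_def[of "induced G S"] by (auto simp: gball_verts_def)
qed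

lemma gball_of_induced:
  assumes "wf_lgraph G" "w \<in> verts G" "gball_verts G R w \<subseteq> S" "S \<subseteq> verts G"
  shows "gball (induced G S) R w = gball G R w"
  unfolding gball_induced gball_verts_of_induced[OF assms]
  using assms(3) by (auto simp: induced_def)

lemma gball_of_gball:
  assumes "wf_lgraph G" "w \<in> gball_verts G k v"
  shows "gball (gball G (k + R) v) R w = gball G R w"
  unfolding gball_induced[of G "k + R"]
  by (intro gball_of_induced gball_verts_trans assms gball_verts_subset
      subsetD[OF gball_verts_subset assms(2)])

lemma graph_isoD:
  assumes "graph_iso \<phi> G H"
  shows "inj_on \<phi> (verts G)" "\<phi> ` verts G = verts H"
    "\<And>u v. u \<in> verts G \<Longrightarrow> v \<in> verts G \<Longrightarrow> {\<phi> u, \<phi> v} \<in> edges H \<longleftrightarrow> {u, v} \<in> edges G"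
    "\<And>e. e \<in> edges G \<Longrightarrow> elabel H (\<phi> ` e) = elabel G e"
  using assms by (auto simp: graph_iso_def bij_betw_def)

lemma graph_iso_id: "graph_iso (\<lambda>x. x) G G"
  by (auto simp: graph_iso_def bij_betw_def)

lemma graph_iso_edge:
  assumes "wf_lgraph G" "graph_iso \<phi> G H" "e \<in> edges G" shows "\<phi> ` e \<in> edges H"
proof -
  obtain x y where "e = {x, y}" "x \<in> verts G" "y \<in> verts G" using assms(1,3) by (rule wf_edge_cases)
  then show ?thesis using graph_isoD(3)[OF assms(2)] assms(3) by simp
qed

text \<open>Lets a map be normalised to \<open>undefined\<close> off the vertex set, as
  \<open>Aut\<close> demands. Well-formedness keeps the edges, whose images enter the label
  condition, inside the vertex set.\<close>

lemma graph_iso_cong: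
  assumes "wf_lgraph G" "graph_iso \<phi> G H" "\<And>x. x \<in> verts G \<Longrightarrow> \<psi> x = \<phi> x"
  shows "graph_iso \<psi> G H"
proof -
  have "\<psi> ` e = \<phi> ` e" if "e \<in> edges G" for e
    using assms(1,3) that by (elim wf_edge_cases) auto
  then show ?thesis
    using assms(2,3) bij_betw_cong[of "verts G" \<psi> \<phi> "verts H"] unfolding graph_iso_def by auto
qed

lemma graph_iso_comp:
  assumes "wf_lgraph G" "graph_iso \<phi> G H" "graph_iso \<psi> H K"
  shows "graph_iso (\<psi> \<circ> \<phi>) G K"
proof -
  have "\<phi> x \<in> verts H" if "x \<in> verts G" for x using graph_isoD(2)[OF assms(2)] that by auto
  then show ?thesis
    using assms(2,3) graph_iso_edge[OF assms(1,2)]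
    unfolding graph_iso_def image_comp[symmetric] by (auto intro: bij_betw_trans)
qed

lemma graph_iso_inv:
  assumes "wf_lgraph G" "wf_lgraph H" "graph_iso \<phi> G H"
  shows "graph_iso (the_inv_into (verts G) \<phi>) H G"
proof -
  note iso = graph_isoD[OF assms(3)]
  let ?\<psi> = "the_inv_into (verts G) \<phi>"
  have bij: "bij_betw ?\<psi> (verts H) (verts G)"
    using assms(3) by (auto simp: graph_iso_def intro: bij_betw_the_inv_into)
  have \<psi>: "?\<psi> (\<phi> u) = u" if "u \<in> verts G" for u using that iso(1) by (simp add: the_inv_into_f_f)
  have E: "{?\<psi> x, ?\<psi> y} \<in> edges G \<longleftrightarrow> {x, y} \<in> edges H" if "x \<in> verts H" "y \<in> verts H" for x y
  proof -
    from that obtain u v where "u \<in> verts G" "v \<in> verts G" "x = \<phi> u" "y = \<phi> v"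
      using iso(2) by blast
    then show ?thesis using iso(3) \<psi> by simp
  qed
  have "elabel G (?\<psi> ` e) = elabel H e" if "e \<in> edges H" for e
  proof -
    from assms(2) that obtain x y where e: "e = {x, y}" "x \<in> verts H" "y \<in> verts H"
      by (rule wf_edge_cases)
    then obtain u v where uv: "u \<in> verts G" "v \<in> verts G" "x = \<phi> u" "y = \<phi> v"
      using iso(2) by blast
    then have "{u, v} \<in> edges G" using iso(3) that e by auto
    then have "elabel H (\<phi> ` {u, v}) = elabel G {u, v}" by (rule iso(4))
    then show ?thesis using e uv \<psi> by simp
  qed
  with bij E show ?thesis unfolding graph_iso_def by auto
qed

lemma graph_iso_induced:
  assumes "graph_iso \<phi> G H" "S \<subseteq> verts G"
  shows "graph_iso \<phi> (induced G S) (induced H (\<phi> ` S))"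
proof -
  note iso = graph_isoD[OF assms(1)]
  have "bij_betw \<phi> S (\<phi> ` S)" using iso(1) assms(2) by (auto simp: bij_betw_def intro: inj_on_subset)
  then show ?thesis
    using iso(3,4) assms(2) unfolding graph_iso_def by (auto simp: subset_iff)
qed

lemma gball_verts_iso_subset:
  assumes "wf_lgraph G" "graph_iso \<phi> G H" "v \<in> verts G"
  shows "\<phi> ` gball_verts G R v \<subseteq> gball_verts H R (\<phi> v)"
proof -
  have "(\<phi> v, \<phi> w) \<in> adj H ^^ k" if "(v, w) \<in> adj G ^^ k" for k w
    using that
  proof (induction k arbitrary: w)
    case (Suc k)
    then obtain y where y: "(v, y) \<in> adj G ^^ k" "{y, w} \<in> edges G" by auto
    have "(\<phi> y, \<phi> w) \<in> adj H" using graph_iso_edge[OF assms(1,2) y(2)] by simp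
    with Suc.IH[OF y(1)] show ?case by auto
  qed auto
  then show ?thesis using graph_isoD(2)[OF assms(2)] by (auto simp: gball_verts_def)
qed

lemma gball_verts_iso:
  assumes "wf_lgraph G" "wf_lgraph H" "graph_iso \<phi> G H" "v \<in> verts G"
  shows "\<phi> ` gball_verts G R v = gball_verts H R (\<phi> v)"
proof
  let ?\<psi> = "the_inv_into (verts G) \<phi>"
  note iso = graph_isoD[OF assms(3)]
  have "?\<psi> ` gball_verts H R (\<phi> v) \<subseteq> gball_verts G R (?\<psi> (\<phi> v))"
    using assms(4) iso(2) by (intro gball_verts_iso_subset graph_iso_inv assms(1-3)) auto
  also have "?\<psi> (\<phi> v) = v" using assms(4) iso(1) by (simp add: the_inv_into_f_f)
  finally have "\<phi> ` ?\<psi> ` gball_verts H R (\<phi> v) \<subseteq> \<phi> ` gball_verts G R v" by (rule image_mono)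
  moreover have "\<phi> (?\<psi> y) = y" if "y \<in> gball_verts H R (\<phi> v)" for y
    using that gball_verts_subset[of H R "\<phi> v"] iso(1,2) by (intro f_the_inv_into_f) auto
  ultimately show "gball_verts H R (\<phi> v) \<subseteq> \<phi> ` gball_verts G R v"
    by (simp add: image_image)
qed (rule gball_verts_iso_subset[OF assms(1,3,4)])

lemma graph_iso_gball:
  assumes "wf_lgraph G" "wf_lgraph H" "graph_iso \<phi> G H" "v \<in> verts G"
  shows "graph_iso \<phi> (gball G R v) (gball H R (\<phi> v))"
  unfolding gball_induced gball_verts_iso[OF assms, symmetric]
  by (rule graph_iso_induced[OF assms(3) gball_verts_subset])

text \<open>The \<open>k\<close>-ball around the centre and the \<open>R\<close>-balls around its
  vertices can all be computed inside the ball of radius \<open>k + R\<close>, so a rooted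
  isomorphism of the large balls restricts to all of them.\<close>

lemma graph_iso_gball_gball:
  assumes "wf_lgraph G" "wf_lgraph H" "v \<in> verts G" "\<phi> v \<in> verts H"
    and "graph_iso \<phi> (gball G (k + R) v) (gball H (k + R) (\<phi> v))" "w \<in> gball_verts G k v"
  shows "graph_iso \<phi> (gball G R w) (gball H R (\<phi> w))" "\<phi> w \<in> gball_verts H k (\<phi> v)"
proof -
  have sub: "gball_verts G k v \<subseteq> gball_verts G (k + R) v" by (rule gball_verts_mono) simp
  have "gball_verts (gball G (k + R) v) k v = gball_verts G k v"
    "gball_verts (gball H (k + R) (\<phi> v)) k (\<phi> v) = gball_verts H k (\<phi> v)"
    unfolding gball_induced
    by (intro gball_verts_of_induced gball_verts_mono gball_verts_subset assms; simp)+
  moreover have "\<phi> ` gball_verts (gball G (k + R) v) k v = gball_verts (gball H (k + R) (\<phi> v)) k (\<phi> v)"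
    by (rule gball_verts_iso[OF wf_gball wf_gball]) (use assms in \<open>auto intro: gball_verts_centre\<close>)
  ultimately show k: "\<phi> w \<in> gball_verts H k (\<phi> v)" using assms(6) by blast
  have "graph_iso \<phi> (gball (gball G (k + R) v) R w) (gball (gball H (k + R) (\<phi> v)) R (\<phi> w))"
    by (rule graph_iso_gball[OF wf_gball wf_gball]) (use assms sub in auto)
  then show "graph_iso \<phi> (gball G R w) (gball H R (\<phi> w))"
    using gball_of_gball[OF assms(1,6)] gball_of_gball[OF assms(2) k] by simp
qed

lemma rooted_iso_sym:
  assumes "wf_lgraph G" "wf_lgraph H" "r \<in> verts G" "rooted_iso G r \<sigma> H s \<tau>"
  shows "rooted_iso H s \<tau> G r \<sigma>"
proof -
  from assms(4) obtain \<phi> where \<phi>: "graph_iso \<phi> G H" "\<phi> r = s" "\<forall>v\<in>verts G. \<tau> (\<phi> v) = \<sigma> v"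
    by (auto simp: rooted_iso_def)
  note iso = graph_isoD[OF \<phi>(1)]
  show ?thesis unfolding rooted_iso_def
    using \<phi>(2,3) iso(1) assms(3) graph_iso_inv[OF assms(1,2) \<phi>(1)]
    by (auto intro!: exI[of _ "the_inv_into (verts G) \<phi>"] simp: the_inv_into_f_f simp flip: iso(2))
qed

lemma rooted_iso_trans:
  assumes "wf_lgraph G" "rooted_iso G r \<sigma> H s \<tau>" "rooted_iso H s \<tau> K t \<upsilon>"
  shows "rooted_iso G r \<sigma> K t \<upsilon>"
proof -
  from assms(2) obtain \<phi> where \<phi>: "graph_iso \<phi> G H" "\<phi> r = s" "\<forall>v\<in>verts G. \<tau> (\<phi> v) = \<sigma> v"
    by (auto simp: rooted_iso_def)
  from assms(3) obtain \<psi> where \<psi>: "graph_iso \<psi> H K" "\<psi> s = t" "\<forall>v\<in>verts H. \<upsilon> (\<psi> v) = \<tau> v"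
    by (auto simp: rooted_iso_def)
  show ?thesis unfolding rooted_iso_def
    using \<phi>(2,3) \<psi>(2,3) graph_iso_comp[OF assms(1) \<phi>(1) \<psi>(1)]
    by (auto intro!: exI[of _ "\<psi> \<circ> \<phi>"] simp flip: graph_isoD(2)[OF \<phi>(1)])
qed

section \<open>Finiteness and growth of balls\<close>

lemma card_adjacent_le:
  assumes "finite (incident_edges G x)"
  shows "finite {w. {x, w} \<in> edges G}" "card {w. {x, w} \<in> edges G} \<le> card (incident_edges G x)"
proof -
  have inj: "inj_on (\<lambda>w. {x, w}) {w. {x, w} \<in> edges G}" by (auto simp: inj_on_def doubleton_eq_iff)
  have sub: "(\<lambda>w. {x, w}) ` {w. {x, w} \<in> edges G} \<subseteq> incident_edges G x"
    by (auto simp: incident_edges_def)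
  show "finite {w. {x, w} \<in> edges G}" by (rule inj_on_finite[OF inj sub assms])
  show "card {w. {x, w} \<in> edges G} \<le> card (incident_edges G x)"
    by (rule card_inj_on_le[OF inj sub assms])
qed

lemma gball_verts_Suc_subset:
  "gball_verts G (Suc R) v \<subseteq> gball_verts G R v \<union> (\<Union>x\<in>gball_verts G R v. {w. {x, w} \<in> edges G})"
  if "wf_lgraph G"
proof
  fix w assume "w \<in> gball_verts G (Suc R) v"
  then obtain k where k: "k \<le> Suc R" "(v, w) \<in> adj G ^^ k" and w: "w \<in> verts G"
    by (auto simp: gball_verts_def)
  show "w \<in> gball_verts G R v \<union> (\<Union>x\<in>gball_verts G R v. {w. {x, w} \<in> edges G})"
  proof (cases "k \<le> R")
    case True then show ?thesis using k w by (auto simp: gball_verts_def)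
  next
    case False
    then have "k = Suc R" using k by simp
    then obtain y where y: "(v, y) \<in> adj G ^^ R" "{y, w} \<in> edges G" using k by auto
    then have "y \<in> gball_verts G R v" using wf_edgeD[OF that y(2)] by (auto simp: gball_verts_def)
    with y show ?thesis by blast
  qed
qed

lemma finite_gball_verts:
  assumes "wf_lgraph G" "locally_finite G" "v \<in> verts G"
  shows "finite (gball_verts G R v)"
proof (induction R)
  case 0 then show ?case using assms by (simp add: gball_verts_0)
next
  case (Suc R)
  have "finite {w. {x, w} \<in> edges G}" if "x \<in> gball_verts G R v" for x
    using assms that gball_verts_subset[of G R v] card_adjacent_le(1)[of G x]
    by (auto simp: locally_finite_def)
  with Suc have "finite (gball_verts G R v \<union> (\<Union>x\<in>gball_verts G R v. {w. {x, w} \<in> edges G}))"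
    by blast
  then show ?case by (rule finite_subset[OF gball_verts_Suc_subset[OF assms(1)]])
qed

text \<open>The bound is crude; what matters later is that it depends on \<open>D\<close> and
  \<open>R\<close> only, hence is uniform along a sequence of bounded degree.\<close>

lemma card_gball_verts_le:
  assumes wf: "wf_lgraph G" and v: "v \<in> verts G"
    and deg: "\<And>x. x \<in> verts G \<Longrightarrow> finite (incident_edges G x) \<and> card (incident_edges G x) \<le> D"
  shows "card (gball_verts G R v) \<le> (D + 1) ^ R"
proof (induction R)
  case 0 then show ?case using v by (simp add: gball_verts_0)
next
  case (Suc R)
  let ?B = "gball_verts G R v" and ?N = "\<lambda>x. {w. {x, w} \<in> edges G}"
  have fin: "finite ?B" using assms by (intro finite_gball_verts) (auto simp: locally_finite_def)
  have N: "finite (?N x)" "card (?N x) \<le> D" if "x \<in> ?B" for x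
    using that deg[of x] card_adjacent_le[of G x] gball_verts_subset[of G R v] by force+
  have "card (gball_verts G (Suc R) v) \<le> card (?B \<union> (\<Union>x\<in>?B. ?N x))"
    using N fin by (intro card_mono gball_verts_Suc_subset[OF wf]) auto
  also have "\<dots> \<le> card ?B + card (\<Union>x\<in>?B. ?N x)" by (rule card_Un_le)
  also have "card (\<Union>x\<in>?B. ?N x) \<le> (\<Sum>x\<in>?B. card (?N x))" by (rule card_UN_le[OF fin])
  also have "\<dots> \<le> card ?B * D" using sum_bounded_above[of ?B "\<lambda>x. card (?N x)" D] N by simp
  also have "card ?B + card ?B * D = (D + 1) * card ?B" by simp
  also have "\<dots> \<le> (D + 1) * (D + 1) ^ R" using Suc by (rule mult_le_mono2)
  finally show ?case by simp
qed

section \<open>Spin measures and cylinder events\<close>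

lemma space_spin_space [simp]: "space (spin_space V) = V \<rightarrow>\<^sub>E {-1, 1}"
  by (simp add: spin_space_def space_PiM)

lemma spin_measure_space:
  assumes "spin_measure V P"
  shows "space P = V \<rightarrow>\<^sub>E {-1, 1}" "sets P = sets (spin_space V)" "prob_space P"
  using assms sets_eq_imp_space_eq[of P "spin_space V"] by (auto simp: spin_measure_def)

lemma finite_spins: "finite F \<Longrightarrow> finite (F \<rightarrow>\<^sub>E {-1, 1::int})"
  by (rule finite_PiE) auto

text \<open>Every singleton is a product of singletons, and there are finitely many of them.
  Measurability is thus an issue only for the infinite limit.\<close>

lemma sets_spin_space_finite:
  assumes "finite V" shows "sets (spin_space V) = Pow (V \<rightarrow>\<^sub>E {-1, 1})"
proof
  show "sets (spin_space V) \<subseteq> Pow (V \<rightarrow>\<^sub>E {-1, 1})"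
    using sets.space_closed[of "spin_space V"] by simp
  show "Pow (V \<rightarrow>\<^sub>E {-1, 1}) \<subseteq> sets (spin_space V)"
  proof
    fix S assume S: "S \<in> Pow (V \<rightarrow>\<^sub>E {-1, 1::int})"
    have "{\<sigma>} \<in> sets (spin_space V)" if "\<sigma> \<in> V \<rightarrow>\<^sub>E {-1, 1}" for \<sigma>
    proof -
      have "(\<Pi>\<^sub>E v\<in>V. {\<sigma> v}) \<in> sets (spin_space V)"
        unfolding spin_space_def using assms that by (intro sets_PiM_I_finite) auto
      also have "(\<Pi>\<^sub>E v\<in>V. {\<sigma> v}) = {\<sigma>}"
        using that by (auto simp: PiE_singleton PiE_iff)
      finally show ?thesis .
    qed
    moreover have "finite S" using S finite_spins[OF assms] finite_subset by auto
    ultimately have "(\<Union>\<sigma>\<in>S. {\<sigma>}) \<in> sets (spin_space V)"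
      using S by (intro sets.finite_UN) auto
    then show "S \<in> sets (spin_space V)" by simp
  qed
qed

lemma measurable_spin_restrict:
  assumes "F \<subseteq> V" shows "(\<lambda>\<omega>. restrict \<omega> F) \<in> spin_space V \<rightarrow>\<^sub>M spin_space F"
  unfolding spin_space_def using assms by (rule measurable_restrict_subset)

lemma measurable_spin_pull:
  assumes "\<gamma> \<in> V \<rightarrow> V" shows "spin_pull V \<gamma> \<in> spin_space V \<rightarrow>\<^sub>M spin_space V"
  unfolding spin_space_def spin_pull_def
  using assms by (intro measurable_restrict measurable_component_singleton) auto

lemma measurable_spin_pull_measure:
  assumes "spin_measure V P" "\<gamma> \<in> V \<rightarrow> V" shows "spin_pull V \<gamma> \<in> P \<rightarrow>\<^sub>M spin_space V"
  using measurable_spin_pull[OF assms(2)] spin_measure_space(2)[OF assms(1)] measurable_cong_sets by blast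

lemma measure_spin_pull:
  assumes "spin_measure V P" "\<gamma> \<in> V \<rightarrow> V" "distr P (spin_space V) (spin_pull V \<gamma>) = P" "X \<in> sets P"
  shows "measure P (spin_pull V \<gamma> -` X \<inter> space P) = measure P X"
  using measure_distr[OF measurable_spin_pull_measure[OF assms(1,2)], of X] assms(3,4)
    spin_measure_space(2)[OF assms(1)] by simp

text \<open>Phrased as saturation under agreement on \<open>F\<close>, which makes monotonicity in
  \<open>F\<close> and Boolean operations immediate; measurability is derived separately for finite
  \<open>F\<close>.\<close>

definition cylinder_event :: "'v set \<Rightarrow> 'v set \<Rightarrow> ('v \<Rightarrow> int) set \<Rightarrow> bool" where
  "cylinder_event V F S \<longleftrightarrow> S \<subseteq> V \<rightarrow>\<^sub>E {-1, 1} \<and>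
     (\<forall>\<omega>\<in>S. \<forall>\<omega>'\<in>V \<rightarrow>\<^sub>E {-1, 1}. (\<forall>x\<in>F. \<omega> x = \<omega>' x) \<longrightarrow> \<omega>' \<in> S)"

lemma cylinder_event_mono: "cylinder_event V F S \<Longrightarrow> F \<subseteq> F' \<Longrightarrow> cylinder_event V F' S"
  unfolding cylinder_event_def by blast

lemma cylinder_event_UN:
  "(\<And>i. i \<in> I \<Longrightarrow> cylinder_event V F (S i)) \<Longrightarrow> cylinder_event V F (\<Union>i\<in>I. S i)"
  unfolding cylinder_event_def by (simp add: UN_subset_iff) blast

text \<open>Such an event is the preimage of its own image under restriction to \<open>F\<close>,
  and every set of configurations on a finite \<open>F\<close> is measurable.\<close>

lemma cylinder_event_sets:
  assumes "finite F" "F \<subseteq> V" "cylinder_event V F S"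
  shows "S \<in> sets (spin_space V)"
proof -
  have "restrict \<omega> F \<in> F \<rightarrow>\<^sub>E {-1, 1}" if "\<omega> \<in> S" for \<omega>
  proof -
    have "\<omega> \<in> V \<rightarrow>\<^sub>E {-1, 1}" using assms(3) that by (auto simp: cylinder_event_def)
    then show ?thesis using assms(2) by (auto simp: PiE_iff subset_iff)
  qed
  then have "(\<lambda>\<omega>. restrict \<omega> F) ` S \<in> sets (spin_space F)"
    unfolding sets_spin_space_finite[OF assms(1)] by blast
  from measurable_sets[OF measurable_spin_restrict[OF assms(2)] this]
  have "(\<lambda>\<omega>. restrict \<omega> F) -` (\<lambda>\<omega>. restrict \<omega> F) ` S \<inter> (V \<rightarrow>\<^sub>E {-1, 1}) \<in> sets (spin_space V)"
    by simp
  also have "(\<lambda>\<omega>. restrict \<omega> F) -` (\<lambda>\<omega>. restrict \<omega> F) ` S \<inter> (V \<rightarrow>\<^sub>E {-1, 1}) = S"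
  proof (intro equalityI subsetI)
    fix \<omega> assume "\<omega> \<in> (\<lambda>\<omega>. restrict \<omega> F) -` (\<lambda>\<omega>. restrict \<omega> F) ` S \<inter> (V \<rightarrow>\<^sub>E {-1, 1})"
    then obtain \<omega>' where "\<omega>' \<in> S" "restrict \<omega> F = restrict \<omega>' F" "\<omega> \<in> V \<rightarrow>\<^sub>E {-1, 1}" by auto
    then show "\<omega> \<in> S" using assms(3) unfolding cylinder_event_def by (metis restrict_apply')
  qed (use assms(3) in \<open>auto simp: cylinder_event_def\<close>)
  finally show ?thesis .
qed

text \<open>Single-spin events generate the sigma-algebra, and the events that can be approximated
  are closed under complements and countable unions.\<close>

lemma cylinder_approximation:
  assumes P: "spin_measure V P" and A: "A \<in> sets P" and "e > 0"
  shows "\<exists>F S. finite F \<and> F \<subseteq> V \<and> cylinder_event V F S \<and> measure P (sym_diff A S) < e"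
proof -
  note sp = spin_measure_space[OF P]
  interpret prob_space P by (rule sp)
  let ?\<Omega> = "V \<rightarrow>\<^sub>E {-1, 1::int}"
  let ?G = "{{f \<in> ?\<Omega>. f i \<in> S} | i S. i \<in> V \<and> S \<subseteq> {-1, 1}}"
  have sets: "S \<in> sets P" if "finite F" "F \<subseteq> V" "cylinder_event V F S" for F S
    using cylinder_event_sets[OF that] sp by simp
  have sets_eq: "sets P = sigma_sets ?\<Omega> ?G"
    unfolding sp(2) unfolding spin_space_def sets_PiM_single by simp
  have "A \<in> sigma_sets ?\<Omega> ?G" using A sets_eq by simp
  then show ?thesis using \<open>e > 0\<close>
  proof (induction A arbitrary: e)
    case (Basic a)
    then obtain i S where a: "a = {f \<in> ?\<Omega>. f i \<in> S}" "i \<in> V" by auto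
    then have "cylinder_event V {i} a" by (auto simp: cylinder_event_def)
    then show ?case using a Basic by (intro exI[of _ "{i}"] exI[of _ a]) auto
  next
    case Empty
    show ?case using Empty by (intro exI[of _ "{}"]) (auto simp: cylinder_event_def)
  next
    case (Compl a)
    then obtain F S where FS: "finite F" "F \<subseteq> V" "cylinder_event V F S" "measure P (sym_diff a S) < e"
      by blast
    have "a \<subseteq> ?\<Omega>" "S \<subseteq> ?\<Omega>"
      using Compl(1) FS(3) sets_eq sets.sets_into_space[of a P] sp(1) by (auto simp: cylinder_event_def)
    then have "sym_diff (?\<Omega> - a) (?\<Omega> - S) = sym_diff a S" by blast
    moreover have "cylinder_event V F (?\<Omega> - S)"
      unfolding cylinder_event_def
    proof (intro conjI ballI impI)
      fix \<omega> \<omega>' assume "\<omega> \<in> ?\<Omega> - S" "\<omega>' \<in> ?\<Omega>" "\<forall>x\<in>F. \<omega> x = \<omega>' x"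
      moreover from this have "\<omega> \<in> S" if "\<omega>' \<in> S"
        using FS(3) that unfolding cylinder_event_def by (metis Diff_iff)
      ultimately show "\<omega>' \<in> ?\<Omega> - S" by auto
    qed auto
    ultimately show ?case using FS by metis
  next
    case (Union a)
    have a: "a i \<in> sets P" for i using Union(1) sets_eq by simp
    let ?U = "\<Union>i. a i"
    \<comment> \<open>Half of the error is spent on cutting the union off at a finite
      \<open>n\<close>.\<close>
    have "(\<lambda>n. measure P (\<Union>i<n. a i)) \<longlonglongrightarrow> measure P (\<Union>n. \<Union>i<n. a i)"
      using a by (intro finite_Lim_measure_incseq incseq_SucI) (auto simp: less_Suc_eq)
    also have "(\<Union>n. \<Union>i<n. a i) = ?U" by auto
    finally have "\<forall>\<^sub>F n in sequentially. dist (measure P (\<Union>i<n. a i)) (measure P ?U) < e / 2"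
      using \<open>e > 0\<close> by (intro tendstoD) auto
    then obtain n where "dist (measure P (\<Union>i<n. a i)) (measure P ?U) < e / 2"
      by (auto simp: eventually_sequentially)
    moreover have "measure P (?U - (\<Union>i<n. a i)) = measure P ?U - measure P (\<Union>i<n. a i)"
      using a by (intro finite_measure_Diff) auto
    ultimately have 1: "measure P (?U - (\<Union>i<n. a i)) < e / 2"
      unfolding dist_real_def by linarith
    \<comment> \<open>The other half is shared among the \<open>n\<close> remaining events;
      \<open>n + 1\<close> in the denominator covers the case \<open>n = 0\<close>.\<close>
    have "\<forall>i. \<exists>F S. finite F \<and> F \<subseteq> V \<and> cylinder_event V F S \<and> measure P (sym_diff (a i) S) < e / (2 * (real n + 1))"
      using Union(2) \<open>e > 0\<close> by simp
    then have "\<exists>F S. \<forall>i. finite (F i) \<and> F i \<subseteq> V \<and> cylinder_event V (F i) (S i) \<and>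
        measure P (sym_diff (a i) (S i)) < e / (2 * (real n + 1))"
      unfolding choice_iff .
    then obtain F S where *: "\<forall>i. finite (F i) \<and> F i \<subseteq> V \<and> cylinder_event V (F i) (S i) \<and>
        measure P (sym_diff (a i) (S i)) < e / (2 * (real n + 1))"
      by (elim exE)
    have FS: "finite (F i)" "F i \<subseteq> V" "cylinder_event V (F i) (S i)"
      "measure P (sym_diff (a i) (S i)) < e / (2 * (real n + 1))" for i
      using spec[OF *, of i] by - (elim conjE, assumption)+
    have S: "S i \<in> sets P" for i by (rule sets[OF FS(1-3)])
    let ?S = "\<Union>i<n. S i"
    have "measure P (\<Union>i<n. sym_diff (a i) (S i)) \<le> (\<Sum>i<n. measure P (sym_diff (a i) (S i)))"
      using a S by (intro measure_UNION_le) auto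
    also have "\<dots> \<le> (\<Sum>i<n. e / (2 * (real n + 1)))" using FS(4) by (intro sum_mono less_imp_le)
    also have "\<dots> \<le> e / 2" using \<open>e > 0\<close> by (simp add: field_simps)
    finally have 2: "measure P (\<Union>i<n. sym_diff (a i) (S i)) \<le> e / 2" .
    have "measure P (sym_diff ?U ?S) \<le> measure P ((?U - (\<Union>i<n. a i)) \<union> (\<Union>i<n. sym_diff (a i) (S i)))"
    proof (rule finite_measure_mono)
      show "sym_diff ?U ?S \<subseteq> (?U - (\<Union>i<n. a i)) \<union> (\<Union>i<n. sym_diff (a i) (S i))"
      proof
        fix x assume x: "x \<in> sym_diff ?U ?S"
        then show "x \<in> (?U - (\<Union>i<n. a i)) \<union> (\<Union>i<n. sym_diff (a i) (S i))"
        proof (cases "x \<in> (\<Union>i<n. a i)")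
          case True
          then obtain i where i: "i < n" "x \<in> a i" by auto
          with x have "x \<notin> S i" by auto
          with i show ?thesis by auto
        next
          case False
          with x show ?thesis by auto
        qed
      qed
      show "(?U - (\<Union>i<n. a i)) \<union> (\<Union>i<n. sym_diff (a i) (S i)) \<in> sets P"
        using a S by (intro sets.Un sets.Diff sets.countable_UN sets.finite_UN) auto
    qed
    also have "\<dots> \<le> measure P (?U - (\<Union>i<n. a i)) + measure P (\<Union>i<n. sym_diff (a i) (S i))"
      using a S by (intro measure_Un_le sets.Un sets.Diff sets.countable_UN sets.finite_UN) auto
    also have "\<dots> < e / 2 + e / 2" by (rule add_less_le_mono[OF 1 2])
    also have "\<dots> = e" by simp
    finally have "measure P (sym_diff ?U ?S) < e" .
    moreover have "cylinder_event V (\<Union>i<n. F i) ?S"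
    proof -
      have "cylinder_event V (\<Union>i<n. F i) (S j)" if "j < n" for j
        using that by (intro cylinder_event_mono[OF FS(3)]) auto
      then show ?thesis by (intro cylinder_event_UN) simp
    qed
    moreover have "finite (\<Union>i<n. F i)" "(\<Union>i<n. F i) \<subseteq> V" using FS(1,2) by auto
    ultimately show ?case by (intro exI conjI)
  qed
qed

section \<open>Optimal guesses from finitely many spins\<close>

definition spin_atom :: "('v \<Rightarrow> int) measure \<Rightarrow> 'v set \<Rightarrow> ('v \<Rightarrow> int) \<Rightarrow> ('v \<Rightarrow> int) set" where
  "spin_atom P F \<sigma> = {\<omega> \<in> space P. restrict \<omega> F = \<sigma>}"

text \<open>The Bayes rule for guessing \<open>A\<close> from the spins on \<open>F\<close>. It is
  determined by \<open>P\<close>, \<open>A\<close> and \<open>F\<close> alone, so it inherits their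
  symmetries, which an arbitrary approximating cylinder event need not do. Ties and null atoms go
  against \<open>A\<close>.\<close>

definition bayes_set :: "('v \<Rightarrow> int) measure \<Rightarrow> ('v \<Rightarrow> int) set \<Rightarrow> 'v set \<Rightarrow> ('v \<Rightarrow> int) set" where
  "bayes_set P A F = {\<sigma> \<in> F \<rightarrow>\<^sub>E {-1, 1}. measure P (A \<inter> spin_atom P F \<sigma>) > measure P (spin_atom P F \<sigma>) / 2}"

lemma cylinder_event_restrict:
  "cylinder_event V F {\<omega> \<in> V \<rightarrow>\<^sub>E {-1, 1}. restrict \<omega> F \<in> T}"
  unfolding cylinder_event_def
proof (intro conjI ballI impI CollectI)
  fix \<omega> \<omega>' :: "'a \<Rightarrow> int"
  assume "\<omega> \<in> {\<omega> \<in> V \<rightarrow>\<^sub>E {-1, 1}. restrict \<omega> F \<in> T}" "\<forall>x\<in>F. \<omega> x = \<omega>' x"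
  moreover from this have "restrict \<omega>' F = restrict \<omega> F" by (intro ext) (auto simp: restrict_def)
  ultimately show "restrict \<omega>' F \<in> T" by simp
qed auto

lemma cylinder_event_atom: "spin_measure V P \<Longrightarrow> cylinder_event V F (spin_atom P F \<sigma>)"
  using cylinder_event_restrict[of V F "{\<sigma>}"] by (simp add: spin_atom_def spin_measure_space)

lemma measure_sum_atoms:
  assumes P: "spin_measure V P" and F: "finite F" "F \<subseteq> V" and X: "X \<in> sets P"
  shows "measure P X = (\<Sum>\<sigma>\<in>F \<rightarrow>\<^sub>E {-1, 1}. measure P (X \<inter> spin_atom P F \<sigma>))"
proof -
  note sp = spin_measure_space[OF P]
  interpret prob_space P by (rule sp)
  have "restrict \<omega> F \<in> F \<rightarrow>\<^sub>E {-1, 1}" if "\<omega> \<in> space P" for \<omega>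
    using that F sp(1) by (auto simp: PiE_iff subset_iff)
  then have "X = (\<Union>\<sigma>\<in>F \<rightarrow>\<^sub>E {-1, 1}. X \<inter> spin_atom P F \<sigma>)"
    using sets.sets_into_space[OF X] by (auto simp: spin_atom_def)
  moreover have "spin_atom P F \<sigma> \<in> sets P" for \<sigma>
    using cylinder_event_sets[OF F cylinder_event_atom[OF P]] sp(2) by simp
  ultimately show ?thesis using X finite_spins[OF F(1)]
    by (subst finite_measure_finite_Union[symmetric]) (auto simp: disjoint_family_on_def spin_atom_def)
qed

text \<open>A cylinder event over \<open>F\<close> contains or misses each atom, so on that atom its
  error is the mass outside \<open>A\<close> or the mass inside \<open>A\<close>. The Bayes rule
  takes the smaller one on every atom.\<close>

lemma bayes_set_optimal:
  assumes P: "spin_measure V P" and F: "finite F" "F \<subseteq> V" and A: "A \<in> sets P"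
    and S: "cylinder_event V F S"
  shows "measure P (sym_diff A {\<omega> \<in> space P. restrict \<omega> F \<in> bayes_set P A F}) \<le> measure P (sym_diff A S)"
proof -
  note sp = spin_measure_space[OF P]
  interpret prob_space P by (rule sp)
  let ?B = "{\<omega> \<in> space P. restrict \<omega> F \<in> bayes_set P A F}"
  have sets: "S \<in> sets P" "?B \<in> sets P" "\<And>\<sigma>. spin_atom P F \<sigma> \<in> sets P"
    using cylinder_event_sets[OF F] S cylinder_event_restrict[of V F "bayes_set P A F"]
      cylinder_event_atom[OF P] sp by auto
  have "measure P (sym_diff A ?B \<inter> spin_atom P F \<sigma>) \<le> measure P (sym_diff A S \<inter> spin_atom P F \<sigma>)"
    if \<sigma>: "\<sigma> \<in> F \<rightarrow>\<^sub>E {-1, 1}" for \<sigma>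
  proof -
    let ?at = "spin_atom P F \<sigma>"
    have "measure P (?at - A) = measure P ?at - measure P (?at \<inter> A)"
      using A sets by (intro finite_measure_Diff')
    then have d: "measure P (?at - A) = measure P ?at - measure P (A \<inter> ?at)" by (simp add: Int_commute)
    have "sym_diff A ?B \<inter> ?at = (if \<sigma> \<in> bayes_set P A F then ?at - A else A \<inter> ?at)"
      using sets.sets_into_space[OF A] by (auto simp: spin_atom_def)
    then have B: "measure P (sym_diff A ?B \<inter> ?at) = min (measure P (?at - A)) (measure P (A \<inter> ?at))"
      using d \<sigma> by (auto simp: bayes_set_def)
    have "\<omega>' \<in> S" if "\<omega> \<in> ?at" "\<omega>' \<in> ?at" "\<omega> \<in> S" for \<omega> \<omega>'
      using S that sp(1) unfolding cylinder_event_def spin_atom_def mem_Collect_eq by (metis restrict_apply')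
    then have "?at \<subseteq> S \<or> ?at \<inter> S = {}" by blast
    then have "sym_diff A S \<inter> ?at = ?at - A \<or> sym_diff A S \<inter> ?at = A \<inter> ?at" by blast
    then show ?thesis using B by auto
  qed
  then show ?thesis
    using A sets by (subst (1 2) measure_sum_atoms[OF P F]) (auto intro: sum_mono)
qed

text \<open>Pulling back along \<open>\<gamma>\<close> turns the atom of the moved configuration
  into the atom of \<open>\<sigma>\<close>; it preserves \<open>P\<close> and changes
  \<open>A\<close> by a null set only, so both sides of the defining inequality are
  unaffected.\<close>

lemma bayes_set_invariant:
  assumes P: "spin_measure V P" and F: "finite F" "F \<subseteq> V" and A: "A \<in> sets P"
    and \<gamma>: "\<gamma> \<in> V \<rightarrow> V" "\<gamma> ` F = F" and inv: "distr P (spin_space V) (spin_pull V \<gamma>) = P"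
    and A0: "measure P (sym_diff A (spin_pull V \<gamma> -` A \<inter> space P)) = 0"
    and \<sigma>: "\<sigma> \<in> bayes_set P A F"
  shows "(\<lambda>x\<in>F. \<sigma> (\<gamma> x)) \<in> bayes_set P A F"
proof -
  note sp = spin_measure_space[OF P]
  interpret prob_space P by (rule sp)
  let ?\<tau> = "\<lambda>x\<in>F. \<sigma> (\<gamma> x)" and ?p = "\<lambda>X. spin_pull V \<gamma> -` X \<inter> space P"
  note meas = measurable_spin_pull_measure[OF P \<gamma>(1)] and pull = measure_spin_pull[OF P \<gamma>(1) inv]
  have psets: "?p X \<in> sets P" if "X \<in> sets P" for X
    using measurable_sets[OF meas] that sp(2) by simp
  have at: "spin_atom P F \<sigma> \<in> sets P" for \<sigma>
    using cylinder_event_sets[OF F cylinder_event_atom[OF P]] sp(2) by simp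
  have \<sigma>F: "\<sigma> \<in> F \<rightarrow>\<^sub>E {-1, 1}" using \<sigma> by (simp add: bayes_set_def)
  have pat: "?p (spin_atom P F ?\<tau>) = spin_atom P F \<sigma>"
  proof -
    have "restrict (spin_pull V \<gamma> \<omega>) F = ?\<tau> \<longleftrightarrow> restrict \<omega> F = \<sigma>" if \<omega>: "\<omega> \<in> space P" for \<omega>
    proof -
      have "restrict (spin_pull V \<gamma> \<omega>) F = ?\<tau> \<longleftrightarrow> (\<forall>x\<in>F. \<omega> (\<gamma> x) = \<sigma> (\<gamma> x))"
        using F(2) by (auto simp: fun_eq_iff spin_pull_def restrict_def)
      also have "\<dots> \<longleftrightarrow> (\<forall>x\<in>\<gamma> ` F. \<omega> x = \<sigma> x)" by blast
      also have "\<dots> \<longleftrightarrow> restrict \<omega> F = \<sigma>"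
        using \<sigma>F \<gamma>(2) by (auto simp: fun_eq_iff restrict_def PiE_iff extensional_def)
      finally show ?thesis .
    qed
    moreover have "spin_pull V \<gamma> \<omega> \<in> space P" if "\<omega> \<in> space P" for \<omega>
      using measurable_space[OF meas that] sp(1) by simp
    ultimately show ?thesis unfolding spin_atom_def by auto
  qed
  have 1: "measure P (spin_atom P F ?\<tau>) = measure P (spin_atom P F \<sigma>)"
    using pull[OF at, of ?\<tau>] pat by simp
  have "measure P (A \<inter> spin_atom P F ?\<tau>) = measure P (?p (A \<inter> spin_atom P F ?\<tau>))"
    using A at by (intro pull[symmetric]) auto
  also have "?p (A \<inter> spin_atom P F ?\<tau>) = ?p A \<inter> spin_atom P F \<sigma>" using pat by blast
  also have "measure P \<dots> \<ge> measure P (A \<inter> spin_atom P F \<sigma>)"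
  proof -
    have "measure P (A \<inter> spin_atom P F \<sigma>) \<le> measure P ((?p A \<inter> spin_atom P F \<sigma>) \<union> sym_diff A (?p A))"
      using A at psets by (intro finite_measure_mono) auto
    also have "\<dots> \<le> measure P (?p A \<inter> spin_atom P F \<sigma>) + measure P (sym_diff A (?p A))"
      using A at psets by (intro measure_Un_le) auto
    finally show ?thesis using A0 by simp
  qed
  finally have "measure P (A \<inter> spin_atom P F ?\<tau>) \<ge> measure P (A \<inter> spin_atom P F \<sigma>)" .
  moreover have "?\<tau> \<in> F \<rightarrow>\<^sub>E {-1, 1}" using \<sigma>F \<gamma>(2) by (auto simp: PiE_iff)
  ultimately show ?thesis using 1 \<sigma> by (simp add: bayes_set_def)
qed

section \<open>Extending automorphisms of large balls\<close>

text \<open>A diagonal argument: on each finite \<open>B k\<close> only finitely many restrictions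
  are possible, so infinitely many of the maps that agree so far also agree on the next set.\<close>

lemma infinite_agreement:
  fixes \<phi> :: "nat \<Rightarrow> 'a \<Rightarrow> 'b"
  assumes fin: "\<And>k. finite (B k)" "\<And>k. finite (C k)" and mono: "\<And>k l. k \<le> l \<Longrightarrow> B k \<subseteq> B l"
    and into: "\<And>k R. k \<le> R \<Longrightarrow> \<phi> R ` B k \<subseteq> C k"
  shows "\<exists>\<gamma>. \<forall>k. infinite {R. \<forall>x\<in>B k. \<phi> R x = \<gamma> x}"
proof -
  let ?N = "\<lambda>g k. {R. \<forall>x\<in>B k. \<phi> R x = g x}"
  have pigeon: "\<exists>R0\<in>M. infinite {R \<in> M. \<forall>x\<in>B k. \<phi> R x = \<phi> R0 x}" if "infinite M" for M k
  proof -
    let ?f = "\<lambda>R. restrict (\<phi> R) (B k)"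
    \<comment> \<open>Indices below \<open>k\<close> are discarded because \<open>into\<close>
      controls \<open>\<phi> R\<close> on \<open>B k\<close> only when
      \<open>k \<le> R\<close>.\<close>
    have "infinite (M - {..<k})" using that by simp
    moreover have "finite (?f ` (M - {..<k}))"
    proof (rule finite_subset)
      show "?f ` (M - {..<k}) \<subseteq> B k \<rightarrow>\<^sub>E C k" using into[of k] by (auto simp: image_subset_iff)
      show "finite (B k \<rightarrow>\<^sub>E C k)" using fin by (intro finite_PiE) auto
    qed
    ultimately obtain R0 where R0: "R0 \<in> M - {..<k}" "infinite {R \<in> M - {..<k}. ?f R = ?f R0}"
      using pigeonhole_infinite[of "M - {..<k}" ?f] by blast
    have "{R \<in> M - {..<k}. ?f R = ?f R0} \<subseteq> {R \<in> M. \<forall>x\<in>B k. \<phi> R x = \<phi> R0 x}"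
      by (auto simp: fun_eq_iff restrict_def split: if_splits)
    with R0 show ?thesis using finite_subset by (metis (lifting) DiffD1)
  qed
  \<comment> \<open>The map chosen at stage \<open>n\<close> represents infinitely many
    \<open>\<phi> R\<close> on \<open>B n\<close>, and later choices do not alter it there, so the
    choices can be glued.\<close>
  have "\<exists>f. \<forall>n. infinite (?N (f n) n) \<and> (\<forall>x\<in>B n. f (Suc n) x = f n x)"
  proof (rule dependent_nat_choice)
    show "\<exists>g. infinite (?N g 0)" using pigeon[of UNIV 0] by auto
  next
    fix g n assume "infinite (?N g n)"
    then obtain R0 where R0: "R0 \<in> ?N g n" "infinite {R \<in> ?N g n. \<forall>x\<in>B (Suc n). \<phi> R x = \<phi> R0 x}"
      using pigeon[of "?N g n" "Suc n"] by blast
    then have "infinite (?N (\<phi> R0) (Suc n))" using infinite_super by (smt (verit) Collect_mono)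
    with R0 show "\<exists>g'. infinite (?N g' (Suc n)) \<and> (\<forall>x\<in>B n. g' x = g x)" by auto
  qed
  then obtain f where f: "\<And>n. infinite (?N (f n) n)" "\<And>n x. x \<in> B n \<Longrightarrow> f (Suc n) x = f n x" by blast
  have stable: "f l x = f k x" if "k \<le> l" "x \<in> B k" for k l x
    using that
  proof (induction l rule: dec_induct)
    case (step l)
    then show ?case using f(2)[of x l] mono[of k l] by auto
  qed simp
  define \<gamma> where "\<gamma> x = f (LEAST k. x \<in> B k) x" for x
  have "\<gamma> x = f k x" if "x \<in> B k" for k x
    unfolding \<gamma>_def using that by (intro stable[symmetric]) (auto intro: Least_le LeastI)
  then have eq: "?N \<gamma> k = ?N (f k) k" for k by auto
  have "infinite (?N \<gamma> k)" for k unfolding eq by (rule f(1))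
  then show ?thesis by blast
qed

definition component :: "('v, 'l) lgraph \<Rightarrow> 'v \<Rightarrow> 'v set" where
  "component G v = (\<Union>R. gball_verts G R v)"

text \<open>Compactness: if rooted automorphisms of arbitrarily large balls were bad on the
  \<open>r\<close>-ball, a limit of them would be an automorphism of \<open>G\<close>, since the
  balls exhaust \<open>G\<close>. It agrees with one of the bad maps on the \<open>r\<close>-ball, a
  contradiction.\<close>

lemma ball_automorphisms_extend:
  assumes wf: "wf_lgraph G" and lf: "locally_finite G" and \<rho>: "\<rho> \<in> verts G"
    and conn: "component G \<rho> = verts G"
  shows "\<exists>R\<ge>r. \<forall>\<phi>. graph_iso \<phi> (gball G R \<rho>) (gball G R \<rho>) \<and> \<phi> \<rho> = \<rho> \<longrightarrow>
    (\<exists>\<gamma>\<in>Aut G. \<gamma> \<rho> = \<rho> \<and> (\<forall>x\<in>gball_verts G r \<rho>. \<gamma> x = \<phi> x))"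
proof (rule ccontr)
  assume contr: "\<not> ?thesis"
  let ?B = "\<lambda>k. gball_verts G k \<rho>"
  have "\<forall>R. \<exists>\<phi>. graph_iso \<phi> (gball G (r + R) \<rho>) (gball G (r + R) \<rho>) \<and> \<phi> \<rho> = \<rho> \<and>
    \<not> (\<exists>\<gamma>\<in>Aut G. \<gamma> \<rho> = \<rho> \<and> (\<forall>x\<in>?B r. \<gamma> x = \<phi> x))"
    using contr by (meson le_add1)
  then obtain \<phi> where \<phi>: "\<And>R. graph_iso (\<phi> R) (gball G (r + R) \<rho>) (gball G (r + R) \<rho>)"
    "\<And>R. \<phi> R \<rho> = \<rho>" "\<And>R. \<not> (\<exists>\<gamma>\<in>Aut G. \<gamma> \<rho> = \<rho> \<and> (\<forall>x\<in>?B r. \<gamma> x = \<phi> R x))"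
    by metis
  have iso: "graph_iso (\<phi> R) (gball G k \<rho>) (gball G k \<rho>)" if "k \<le> R" for k R
  proof -
    \<comment> \<open>The lemma on nested balls is used with the centre itself as \<open>w\<close>,
      so it suffices to split the radius \<open>r + R\<close> as \<open>j + k\<close>.\<close>
    define j where "j = r + R - k"
    have j: "r + R = j + k" using that by (simp add: j_def)
    have "graph_iso (\<phi> R) (gball G (j + k) \<rho>) (gball G (j + k) (\<phi> R \<rho>))" using \<phi>(1,2)[of R] j by simp
    then have "graph_iso (\<phi> R) (gball G k \<rho>) (gball G k (\<phi> R \<rho>))"
      by (rule graph_iso_gball_gball(1)[OF wf wf \<rho>, rotated]) (use \<rho> \<phi>(2) in \<open>auto intro: gball_verts_centre\<close>)
    then show ?thesis using \<phi>(2) by simp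
  qed
  have "\<exists>\<gamma>. \<forall>k. infinite {R. \<forall>x\<in>?B k. \<phi> R x = \<gamma> x}"
  proof (rule infinite_agreement)
    show "\<phi> R ` ?B k \<subseteq> ?B k" if "k \<le> R" for k R using graph_isoD(2)[OF iso[OF that]] by simp
  qed (auto intro: finite_gball_verts[OF wf lf \<rho>] subsetD[OF gball_verts_mono])
  then obtain \<gamma> where \<gamma>: "\<And>k. infinite {R. \<forall>x\<in>?B k. \<phi> R x = \<gamma> x}" by blast
  have \<gamma>_iso: "graph_iso \<gamma> (gball G k \<rho>) (gball G k \<rho>)" for k
  proof -
    obtain R where "k \<le> R" "\<forall>x\<in>?B k. \<phi> R x = \<gamma> x"
      using \<gamma>[of k] unfolding infinite_nat_iff_unbounded_le by blast
    then show ?thesis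
      by (intro graph_iso_cong[OF wf_gball[OF wf \<rho>] iso]) auto
  qed
  have inB: "\<exists>k. x \<in> ?B k \<and> y \<in> ?B k" if xy: "x \<in> verts G" "y \<in> verts G" for x y
  proof -
    obtain k l where "x \<in> ?B k" "y \<in> ?B l" using xy conn unfolding component_def by blast
    then show ?thesis using gball_verts_mono[of k "max k l" G \<rho>] gball_verts_mono[of l "max k l" G \<rho>]
      by (auto intro!: exI[of _ "max k l"])
  qed
  have "inj_on \<gamma> (verts G)"
  proof (rule inj_onI)
    fix x y assume xy: "x \<in> verts G" "y \<in> verts G" "\<gamma> x = \<gamma> y"
    then obtain k where "x \<in> ?B k" "y \<in> ?B k" using inB by blast
    then show "x = y" using graph_isoD(1)[OF \<gamma>_iso[of k]] xy(3) by (auto dest: inj_onD)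
  qed
  moreover have "\<gamma> ` verts G = verts G"
  proof -
    have "\<gamma> ` ?B k = ?B k" for k using graph_isoD(2)[OF \<gamma>_iso[of k]] by simp
    then show ?thesis unfolding conn[symmetric] component_def by (simp add: image_UN)
  qed
  moreover have "{\<gamma> u, \<gamma> v} \<in> edges G \<longleftrightarrow> {u, v} \<in> edges G" if uv: "u \<in> verts G" "v \<in> verts G" for u v
  proof -
    obtain k where k: "u \<in> ?B k" "v \<in> ?B k" using inB uv by blast
    then have "\<gamma> u \<in> ?B k" "\<gamma> v \<in> ?B k" using graph_isoD(2)[OF \<gamma>_iso[of k]] by auto
    with k show ?thesis using graph_isoD(3)[OF \<gamma>_iso[of k], of u v] by (simp add: gball_induced)
  qed
  moreover have "elabel G (\<gamma> ` e) = elabel G e" if e: "e \<in> edges G" for e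
  proof -
    obtain x y where xy: "e = {x, y}" "x \<in> verts G" "y \<in> verts G" using wf e by (rule wf_edge_cases)
    then obtain k where "x \<in> ?B k" "y \<in> ?B k" using inB by blast
    then show ?thesis using graph_isoD(4)[OF \<gamma>_iso[of k], of e] e xy by (simp add: gball_induced)
  qed
  ultimately have G: "graph_iso \<gamma> G G" by (auto simp: graph_iso_def bij_betw_def)
  let ?\<gamma> = "restrict \<gamma> (verts G)"
  have "graph_iso ?\<gamma> G G" by (rule graph_iso_cong[OF wf G]) simp
  then have Aut: "?\<gamma> \<in> Aut G" by (simp add: Aut_def)
  obtain R where R: "\<forall>x\<in>?B r. \<phi> R x = \<gamma> x" using \<gamma>[of r] not_finite_existsD by blast
  have "\<forall>x\<in>?B r. ?\<gamma> x = \<phi> R x" using R gball_verts_subset[of G r \<rho>] by auto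
  moreover from this have "?\<gamma> \<rho> = \<rho>" using gball_verts_centre[OF \<rho>] \<phi>(2) by simp
  ultimately show False using \<phi>(3)[of R] Aut by blast
qed

section \<open>A local detector of the invariant event\<close>

text \<open>
  \<open>T\<close> is a set of configurations on \<open>F\<close>, a subset of the \<open>R\<close>-ball around \<open>\<rho>\<close> in \<open>G\<close>. It is read off
  in \<open>H\<close> through an isomorphism of the whole \<open>R\<close>-balls, because isomorphisms of smaller balls
  need not come from automorphisms of \<open>G\<close>.
\<close>

definition detect ::
    "('w, 'l) lgraph \<Rightarrow> 'w \<Rightarrow> nat \<Rightarrow> 'w set \<Rightarrow> ('w \<Rightarrow> int) set \<Rightarrow> ('v, 'l) lgraph \<Rightarrow> 'v \<Rightarrow> ('v \<Rightarrow> int) \<Rightarrow> bool" where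
  "detect G \<rho> R F T H v \<omega> \<longleftrightarrow>
     (\<exists>\<phi>. graph_iso \<phi> (gball G R \<rho>) (gball H R v) \<and> \<phi> \<rho> = v \<and> (\<lambda>x\<in>F. \<omega> (\<phi> x)) \<in> T)"

text \<open>Membership in the inner vertex boundary of the set of detecting vertices. It is
  determined by the ball of radius \<open>1 + R\<close>, because the verdicts of the neighbours
  enter.\<close>

definition detect_boundary ::
    "('w, 'l) lgraph \<Rightarrow> 'w \<Rightarrow> nat \<Rightarrow> 'w set \<Rightarrow> ('w \<Rightarrow> int) set \<Rightarrow> ('v, 'l) lgraph \<Rightarrow> 'v \<Rightarrow> ('v \<Rightarrow> int) \<Rightarrow> bool" where
  "detect_boundary G \<rho> R F T H v \<omega> \<longleftrightarrow>
     detect G \<rho> R F T H v \<omega> \<and> (\<exists>w. {v, w} \<in> edges H \<and> \<not> detect G \<rho> R F T H w \<omega>)"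

context
  fixes G :: "('w, 'l) lgraph" and \<rho> R F
  assumes wfG: "wf_lgraph G" and \<rho>: "\<rho> \<in> verts G" and F: "F \<subseteq> gball_verts G R \<rho>"
begin

lemma detect_transfer:
  assumes "rooted_iso (gball H R v) v \<omega> (gball H' R v') v' \<omega>'" "detect G \<rho> R F T H v \<omega>"
  shows "detect G \<rho> R F T H' v' \<omega>'"
proof -
  from assms(1) obtain \<psi> where \<psi>: "graph_iso \<psi> (gball H R v) (gball H' R v')" "\<psi> v = v'"
    "\<And>x. x \<in> gball_verts H R v \<Longrightarrow> \<omega>' (\<psi> x) = \<omega> x" by (auto simp: rooted_iso_def)
  from assms(2) obtain \<phi> where \<phi>: "graph_iso \<phi> (gball G R \<rho>) (gball H R v)" "\<phi> \<rho> = v"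
    "(\<lambda>x\<in>F. \<omega> (\<phi> x)) \<in> T" by (auto simp: detect_def)
  have "\<phi> x \<in> gball_verts H R v" if "x \<in> F" for x
    using graph_isoD(2)[OF \<phi>(1)] F that by auto
  then have "(\<lambda>x\<in>F. \<omega>' ((\<psi> \<circ> \<phi>) x)) = (\<lambda>x\<in>F. \<omega> (\<phi> x))"
    using \<psi>(3) by (auto simp: fun_eq_iff)
  then show ?thesis unfolding detect_def
    using graph_iso_comp[OF wf_gball[OF wfG \<rho>] \<phi>(1) \<psi>(1)] \<psi>(2) \<phi>(2,3)
    by (intro exI[of _ "\<psi> \<circ> \<phi>"]) simp
qed

text \<open>The existential quantifier over isomorphisms in \<open>detect\<close> absorbs
  composition with the given isomorphism or its inverse, so the verdict depends on the isomorphism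
  type only.\<close>

lemma detect_cong:
  assumes "wf_lgraph H" "wf_lgraph H'" "v \<in> verts H" "v' \<in> verts H'"
    and "rooted_iso (gball H R v) v \<omega> (gball H' R v') v' \<omega>'"
  shows "detect G \<rho> R F T H v \<omega> \<longleftrightarrow> detect G \<rho> R F T H' v' \<omega>'"
proof -
  have "rooted_iso (gball H' R v') v' \<omega>' (gball H R v) v \<omega>"
    by (rule rooted_iso_sym[OF wf_gball[OF assms(1,3)] wf_gball[OF assms(2,4)] _ assms(5)])
      (simp add: gball_verts_centre[OF assms(3)])
  from detect_transfer[OF this] detect_transfer[OF assms(5)] show ?thesis by blast
qed

text \<open>An isomorphism of the larger balls restricts to the \<open>R\<close>-balls around the
  centre and around each neighbour, so it preserves all the verdicts involved.\<close>

lemma detect_boundary_transfer: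
  assumes H: "wf_lgraph H" "wf_lgraph H'" "v \<in> verts H" "v' \<in> verts H'"
    and iso: "rooted_iso (gball H (1 + R) v) v \<omega> (gball H' (1 + R) v') v' \<omega>'"
    and D: "detect_boundary G \<rho> R F T H v \<omega>"
  shows "detect_boundary G \<rho> R F T H' v' \<omega>'"
proof -
  from iso obtain \<psi> where \<psi>: "graph_iso \<psi> (gball H (1 + R) v) (gball H' (1 + R) v')" "\<psi> v = v'"
    "\<And>x. x \<in> gball_verts H (1 + R) v \<Longrightarrow> \<omega>' (\<psi> x) = \<omega> x" by (auto simp: rooted_iso_def)
  have w: "detect G \<rho> R F T H w \<omega> \<longleftrightarrow> detect G \<rho> R F T H' (\<psi> w) \<omega>'" if w: "w \<in> gball_verts H 1 v" for w
  proof (rule detect_cong[OF H(1,2)])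
    note gg = graph_iso_gball_gball[OF H(1,2,3) _ _ w, of \<psi> R]
    show "w \<in> verts H" using w gball_verts_subset[of H 1 v] by auto
    show "\<psi> w \<in> verts H'" using gg(2) \<psi>(1,2) H(4) gball_verts_subset[of H' 1 v'] by auto
    have "graph_iso \<psi> (gball H R w) (gball H' R (\<psi> w))" using gg(1) \<psi>(1,2) H(4) by simp
    then show "rooted_iso (gball H R w) w \<omega> (gball H' R (\<psi> w)) (\<psi> w) \<omega>'"
      unfolding rooted_iso_def using \<psi>(3) gball_verts_trans[OF w, of R] by auto
  qed
  from D obtain w where vw: "{v, w} \<in> edges H" "\<not> detect G \<rho> R F T H w \<omega>" "detect G \<rho> R F T H v \<omega>"
    by (auto simp: detect_boundary_def)
  have w1: "w \<in> gball_verts H 1 v" by (rule gball_verts_adj[OF H(1) vw(1)])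
  then have "w \<in> gball_verts H (1 + R) v" using gball_verts_mono[of 1 "1 + R" H v] by auto
  then have "{v, w} \<in> edges (gball H (1 + R) v)"
    using vw(1) gball_verts_centre[OF H(3)] by (simp add: gball_induced)
  then have "\<psi> ` {v, w} \<in> edges (gball H' (1 + R) v')"
    by (rule graph_iso_edge[OF wf_gball[OF H(1,3)] \<psi>(1)])
  then have "{v', \<psi> w} \<in> edges H'" using \<psi>(2) by (simp add: gball_induced)
  moreover have "detect G \<rho> R F T H' v' \<omega>'" "\<not> detect G \<rho> R F T H' (\<psi> w) \<omega>'"
    using w[OF w1] w[OF gball_verts_centre[OF H(3)]] vw \<psi>(2) by auto
  ultimately show ?thesis by (auto simp: detect_boundary_def)
qed

lemma detect_boundary_cong:
  assumes "wf_lgraph H" "wf_lgraph H'" "v \<in> verts H" "v' \<in> verts H'"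
    and "rooted_iso (gball H (1 + R) v) v \<omega> (gball H' (1 + R) v') v' \<omega>'"
  shows "detect_boundary G \<rho> R F T H v \<omega> \<longleftrightarrow> detect_boundary G \<rho> R F T H' v' \<omega>'"
proof -
  have "rooted_iso (gball H' (1 + R) v') v' \<omega>' (gball H (1 + R) v) v \<omega>"
    by (rule rooted_iso_sym[OF wf_gball[OF assms(1,3)] wf_gball[OF assms(2,4)] _ assms(5)])
      (simp add: gball_verts_centre[OF assms(3)])
  then show ?thesis
    using detect_boundary_transfer[OF assms] detect_boundary_transfer[OF assms(2,1,4,3)] by blast
qed

end

section \<open>Local events under Benjamini-Schramm convergence\<close>

text \<open>The test graphs of \<open>BS_converges\<close> live on the naturals; a ball of the limit
  must be relabelled before it can serve as one.\<close>

lemma ex_nat_model: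
  fixes H :: "('w, 'l) lgraph"
  assumes wf: "wf_lgraph H" and fin: "finite (verts H)"
  shows "\<exists>(B :: (nat, 'l) lgraph) f. wf_lgraph B \<and> finite (verts B) \<and> graph_iso f H B"
proof -
  obtain f :: "'w \<Rightarrow> nat" where inj: "inj_on f (verts H)"
    using finite_imp_inj_to_nat_seg[OF fin] by blast
  define B :: "(nat, 'l) lgraph" where
    "B = \<lparr>verts = f ` verts H, edges = (`) f ` edges H,
          elabel = \<lambda>e. elabel H (the_inv_into (verts H) f ` e)\<rparr>"
  have sub: "e \<subseteq> verts H" if "e \<in> edges H" for e using wf_edge_cases[OF wf that] by blast
  have "wf_lgraph B"
    unfolding wf_lgraph_def
  proof (intro conjI ballI)
    show "verts B \<noteq> {}" using wf by (simp add: B_def wf_lgraph_def)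
    fix e assume "e \<in> edges B"
    then obtain e' where e': "e' \<in> edges H" "e = f ` e'" by (auto simp: B_def)
    obtain u v where uv: "e' = {u, v}" "u \<in> verts H" "v \<in> verts H" "u \<noteq> v"
      using wf e'(1) by (rule wf_edge_cases)
    then have "f u \<noteq> f v" using inj by (auto dest: inj_onD)
    with uv e' show "\<exists>u\<in>verts B. \<exists>v\<in>verts B. u \<noteq> v \<and> e = {u, v}" by (auto simp: B_def)
  qed
  moreover have "finite (verts B)" using fin by (simp add: B_def)
  moreover have "graph_iso f H B"
    unfolding graph_iso_def
  proof (intro conjI ballI)
    show "bij_betw f (verts H) (verts B)" using inj by (simp add: bij_betw_def B_def)
  next
    fix u v assume uv: "u \<in> verts H" "v \<in> verts H"
    have "{u, v} \<in> edges H" if "{f u, f v} = f ` e" "e \<in> edges H" for e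
    proof -
      have "f ` {u, v} = f ` e" using that by simp
      then have "{u, v} = e" using inj_on_image_eq_iff[OF inj _ sub[OF that(2)], of "{u, v}"] uv by simp
      with that show ?thesis by simp
    qed
    moreover have "{f u, f v} \<in> (`) f ` edges H" if "{u, v} \<in> edges H"
      using that by (auto intro!: image_eqI[of _ _ "{u, v}"])
    ultimately show "({u, v} \<in> edges H) = ({f u, f v} \<in> edges B)" by (auto simp: B_def)
  next
    fix e assume "e \<in> edges H"
    then have "the_inv_into (verts H) f ` f ` e = e"
      using sub inj by (force simp: image_image the_inv_into_f_f subset_iff)
    then show "elabel B (f ` e) = elabel H e" by (simp add: B_def)
  qed
  ultimately show ?thesis by blast
qed

text \<open>By \<open>measure_uniform_pair\<close> this is the probability for a uniformly random
  root that occurs in \<open>BS_converges\<close>; the finite sum is easier to manipulate than the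
  product measure.\<close>

definition vertex_average ::
    "('v, 'l) lgraph \<Rightarrow> ('v \<Rightarrow> int) measure \<Rightarrow> ('v \<Rightarrow> ('v \<Rightarrow> int) \<Rightarrow> bool) \<Rightarrow> real" where
  "vertex_average G P Q = (\<Sum>v\<in>verts G. measure P {\<omega> \<in> space P. Q v \<omega>}) / card (verts G)"

lemma measure_uniform_pair:
  assumes V: "finite V" "V \<noteq> {}" and P: "prob_space P"
    and Q: "\<And>v. v \<in> V \<Longrightarrow> {\<omega> \<in> space P. Q v \<omega>} \<in> sets P"
  shows "measure (uniform_count_measure V \<Otimes>\<^sub>M P) {(v, \<omega>). v \<in> V \<and> \<omega> \<in> space P \<and> Q v \<omega>}
    = (\<Sum>v\<in>V. measure P {\<omega> \<in> space P. Q v \<omega>}) / card V"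
proof -
  interpret U: prob_space "uniform_count_measure V" using V by (rule prob_space_uniform_count_measure)
  interpret P: prob_space P by (rule P)
  interpret UP: pair_prob_space "uniform_count_measure V" P ..
  let ?X = "\<lambda>v. {v} \<times> {\<omega> \<in> space P. Q v \<omega>}"
  have V_sets: "{v} \<in> sets (uniform_count_measure V)" if "v \<in> V" for v
    using that by (simp add: sets_uniform_count_measure)
  have X: "?X v \<in> sets (uniform_count_measure V \<Otimes>\<^sub>M P)" if "v \<in> V" for v
    using V_sets[OF that] Q[OF that] by (rule pair_measureI)
  have "{(v, \<omega>). v \<in> V \<and> \<omega> \<in> space P \<and> Q v \<omega>} = (\<Union>v\<in>V. ?X v)" by auto
  also have "measure (uniform_count_measure V \<Otimes>\<^sub>M P) \<dots> = (\<Sum>v\<in>V. measure (uniform_count_measure V \<Otimes>\<^sub>M P) (?X v))"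
    using V X by (intro UP.P.finite_measure_finite_Union) (auto simp: disjoint_family_on_def)
  also have "\<dots> = (\<Sum>v\<in>V. 1 / card V * measure P {\<omega> \<in> space P. Q v \<omega>})"
  proof (rule sum.cong[OF refl])
    fix v assume v: "v \<in> V"
    show "measure (uniform_count_measure V \<Otimes>\<^sub>M P) (?X v) = 1 / card V * measure P {\<omega> \<in> space P. Q v \<omega>}"
      unfolding measure_def P.emeasure_pair_measure_Times[OF V_sets[OF v] Q[OF v]] enn2real_mult
      unfolding measure_def[symmetric] using V v by (simp add: measure_uniform_count_measure)
  qed
  finally show ?thesis by (simp add: sum_divide_distrib)
qed

text \<open>The events \<open>I \<omega> \<sigma>\<close> overlap, since isomorphic configurations
  \<open>\<sigma>\<close> define the same event. An outcome that lies in one of them lies in exactly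
  \<open>C \<sigma>\<close> of them, so the weight \<open>1 / C \<sigma>\<close> makes it count
  once.\<close>

lemma measure_weighted_classes:
  assumes M: "prob_space M" and fin: "finite \<Sigma>"
    and meas: "\<And>\<sigma>. \<sigma> \<in> \<Sigma> \<Longrightarrow> {\<omega> \<in> space M. I \<omega> \<sigma>} \<in> sets M"
    and C: "\<And>\<omega> \<sigma>. \<omega> \<in> space M \<Longrightarrow> \<sigma> \<in> \<Sigma> \<Longrightarrow> I \<omega> \<sigma> \<Longrightarrow> C \<sigma> = card {\<tau> \<in> \<Sigma>. I \<omega> \<tau>}"
    and Q: "\<And>\<omega> \<sigma>. \<omega> \<in> space M \<Longrightarrow> \<sigma> \<in> \<Sigma> \<Longrightarrow> I \<omega> \<sigma> \<Longrightarrow> Q' \<sigma> = Q \<omega>"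
  shows "measure M {\<omega> \<in> space M. Q \<omega> \<and> (\<exists>\<sigma>\<in>\<Sigma>. I \<omega> \<sigma>)}
    = (\<Sum>\<sigma>\<in>\<Sigma>. of_bool (Q' \<sigma>) / real (C \<sigma>) * measure M {\<omega> \<in> space M. I \<omega> \<sigma>})"
proof -
  interpret prob_space M by (rule M)
  let ?w = "\<lambda>\<sigma>. of_bool (Q' \<sigma>) / real (C \<sigma>)" and ?S = "{\<omega> \<in> space M. Q \<omega> \<and> (\<exists>\<sigma>\<in>\<Sigma>. I \<omega> \<sigma>)}"
  have pt: "indicator ?S \<omega> = (\<Sum>\<sigma>\<in>\<Sigma>. ?w \<sigma> * indicator {\<omega> \<in> space M. I \<omega> \<sigma>} \<omega>)" if \<omega>: "\<omega> \<in> space M" for \<omega>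
  proof -
    let ?K = "{\<sigma> \<in> \<Sigma>. I \<omega> \<sigma>}"
    have K: "finite ?K" using fin by simp
    have "(\<Sum>\<sigma>\<in>\<Sigma>. ?w \<sigma> * indicator {\<omega> \<in> space M. I \<omega> \<sigma>} \<omega>) = (\<Sum>\<sigma>\<in>?K. ?w \<sigma>)"
      using \<omega> fin by (intro sum.mono_neutral_cong_right) (auto simp: indicator_def)
    also have "\<dots> = (\<Sum>\<sigma>\<in>?K. of_bool (Q \<omega>) / real (card ?K))"
      using C[OF \<omega>] Q[OF \<omega>] by (intro sum.cong) auto
    also have "\<dots> = of_bool (Q \<omega> \<and> ?K \<noteq> {})" using K by auto
    also have "\<dots> = indicator ?S \<omega>" using \<omega> by (auto simp: indicator_def)
    finally show ?thesis by simp
  qed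
  have "?S = (\<Union>\<sigma>\<in>{\<sigma> \<in> \<Sigma>. Q' \<sigma>}. {\<omega> \<in> space M. I \<omega> \<sigma>})" using Q by blast
  then have S: "?S \<in> sets M" using fin meas by (auto intro!: sets.finite_UN)
  have "measure M ?S = (\<integral>\<omega>. indicator ?S \<omega> \<partial>M)" using S by simp
  also have "\<dots> = (\<integral>\<omega>. (\<Sum>\<sigma>\<in>\<Sigma>. ?w \<sigma> * indicator {\<omega> \<in> space M. I \<omega> \<sigma>} \<omega>) \<partial>M)"
    by (rule Bochner_Integration.integral_cong[OF refl pt])
  also have "\<dots> = (\<Sum>\<sigma>\<in>\<Sigma>. \<integral>\<omega>. ?w \<sigma> * indicator {\<omega> \<in> space M. I \<omega> \<sigma>} \<omega> \<partial>M)"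
    using meas by (intro Bochner_Integration.integral_sum integrable_mult_right integrable_real_indicator)
      (auto simp: emeasure_eq_measure)
  also have "\<dots> = (\<Sum>\<sigma>\<in>\<Sigma>. ?w \<sigma> * measure M {\<omega> \<in> space M. I \<omega> \<sigma>})"
    using meas by (intro sum.cong) auto
  finally show ?thesis .
qed

text \<open>Shows that the multiplicity needed in \<open>measure_weighted_classes\<close> can be
  read off \<open>\<sigma>\<close> alone, independently of the ball and of the configuration matched
  with it.\<close>

lemma rooted_iso_class_card:
  assumes "wf_lgraph H" "wf_lgraph B" "v \<in> verts H" "rooted_iso H v \<omega> B b \<sigma>"
  shows "card {\<tau> \<in> \<Sigma>. rooted_iso B b \<sigma> B b \<tau>} = card {\<tau> \<in> \<Sigma>. rooted_iso H v \<omega> B b \<tau>}"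
proof -
  have "rooted_iso B b \<sigma> B b \<tau> \<longleftrightarrow> rooted_iso H v \<omega> B b \<tau>" for \<tau>
    using rooted_iso_trans[OF assms(1,4), of B b \<tau>]
      rooted_iso_trans[OF assms(2) rooted_iso_sym[OF assms], of B b \<tau>] by blast
  then show ?thesis by simp
qed

lemma finite_spin_systemD:
  assumes "finite_spin_system G P"
  shows "wf_lgraph G" "finite (verts G)" "verts G \<noteq> {}" "spin_measure (verts G) P" "prob_space P"
    "\<And>Q. {\<omega> \<in> space P. Q \<omega>} \<in> sets P"
  using assms spin_measure_space[of "verts G" P] sets_spin_space_finite[of "verts G"]
  by (auto simp: finite_spin_system_def wf_lgraph_def)

text \<open>
  Only configurations on balls isomorphic to the ball of \<open>\<rho>\<close> are tested. Their limiting
  probabilities already sum to 1, so the remaining balls are negligible.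
\<close>

lemma BS_local_event:
  fixes Gn :: "nat \<Rightarrow> ('v, 'l) lgraph" and G :: "('w, 'l) lgraph"
  assumes fs: "\<And>n. finite_spin_system (Gn n) (Pn n)"
    and G: "wf_lgraph G" "locally_finite G" "\<rho> \<in> verts G" and P: "spin_measure (verts G) P"
    and BS: "BS_converges Gn Pn G P \<rho>"
    and Q: "\<And>n v \<omega> \<sigma>. v \<in> verts (Gn n) \<Longrightarrow>
      rooted_iso (gball (Gn n) R v) v \<omega> (gball G R \<rho>) \<rho> \<sigma> \<Longrightarrow> Q n v \<omega> = Q' \<sigma>"
    and Q': "\<And>\<omega> \<sigma>. rooted_iso (gball G R \<rho>) \<rho> \<omega> (gball G R \<rho>) \<rho> \<sigma> \<Longrightarrow> Q' \<omega> = Q' \<sigma>"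
  shows "(\<lambda>n. vertex_average (Gn n) (Pn n) (Q n)) \<longlonglongrightarrow> measure P {\<omega> \<in> space P. Q' \<omega>}"
proof -
  note sp = spin_measure_space[OF P]
  interpret prob_space P by (rule sp)
  define Bl where "Bl = gball G R \<rho>"
  define F where "F = gball_verts G R \<rho>"
  define \<Sigma> where "\<Sigma> = (F \<rightarrow>\<^sub>E {-1, 1::int})"
  let ?I = "\<lambda>n v \<omega> \<sigma>. rooted_iso (gball (Gn n) R v) v \<omega> Bl \<rho> \<sigma>"
  let ?IG = "\<lambda>\<omega> \<sigma>. rooted_iso Bl \<rho> \<omega> Bl \<rho> \<sigma>"
  define C where "C \<sigma> = card {\<tau> \<in> \<Sigma>. ?IG \<sigma> \<tau>}" for \<sigma>
  have wfB: "wf_lgraph Bl" unfolding Bl_def by (rule wf_gball[OF G(1,3)])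
  have VB: "verts Bl = F" by (simp add: Bl_def F_def)
  have F: "finite F" "F \<subseteq> verts G" "\<rho> \<in> F"
    using finite_gball_verts[OF G] gball_verts_subset[of G R \<rho>] gball_verts_centre[OF G(3)] by (auto simp: F_def)
  have fin: "finite \<Sigma>" unfolding \<Sigma>_def by (rule finite_spins[OF F(1)])
  have wfn: "wf_lgraph (gball (Gn n) R v)" if "v \<in> verts (Gn n)" for n v
    by (rule wf_gball[OF finite_spin_systemD(1)[OF fs] that])

  \<comment> \<open>The configuration \<open>\<sigma>\<close> is carried to a copy \<open>B\<close>
    of the ball on the naturals, where the hypothesis applies; composing isomorphisms brings the
    statement back.\<close>
  have conv: "(\<lambda>n. vertex_average (Gn n) (Pn n) (\<lambda>v \<omega>. ?I n v \<omega> \<sigma>)) \<longlonglongrightarrow> measure P {\<omega> \<in> space P. ?IG \<omega> \<sigma>}"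
    if \<sigma>: "\<sigma> \<in> \<Sigma>" for \<sigma>
  proof -
    obtain B :: "(nat, 'l) lgraph" and f where B: "wf_lgraph B" "finite (verts B)" and f: "graph_iso f Bl B"
      using ex_nat_model[OF wfB] VB F(1) by auto
    define \<tau> where "\<tau> y = \<sigma> (the_inv_into F f y)" for y
    have iso: "rooted_iso Bl \<rho> \<sigma> B (f \<rho>) \<tau>"
      unfolding rooted_iso_def using f graph_isoD(1)[OF f] VB
      by (intro exI[of _ f]) (auto simp: \<tau>_def the_inv_into_f_f)
    have osi: "rooted_iso B (f \<rho>) \<tau> Bl \<rho> \<sigma>"
      by (rule rooted_iso_sym[OF wfB B(1) _ iso]) (use VB F in simp)
    have \<tau>: "\<tau> \<in> verts B \<rightarrow> {-1, 1}"
    proof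
      fix y assume "y \<in> verts B"
      then obtain x where "x \<in> F" "y = f x" using graph_isoD(2)[OF f] VB by auto
      then have "\<tau> y = \<sigma> x" using graph_isoD(1)[OF f] VB by (simp add: \<tau>_def the_inv_into_f_f)
      then show "\<tau> y \<in> {-1, 1}" using \<sigma> \<open>x \<in> F\<close> unfolding \<Sigma>_def by auto
    qed
    have eqn: "rooted_iso (gball (Gn n) R v) v \<omega> B (f \<rho>) \<tau> = ?I n v \<omega> \<sigma>" if "v \<in> verts (Gn n)" for n v \<omega>
      using rooted_iso_trans[OF wfn[OF that] _ iso] rooted_iso_trans[OF wfn[OF that] _ osi] by blast
    have eqG: "rooted_iso (gball G R \<rho>) \<rho> \<omega> B (f \<rho>) \<tau> = ?IG \<omega> \<sigma>" for \<omega>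
      using rooted_iso_trans[OF wfB _ iso] rooted_iso_trans[OF wfB _ osi]
      unfolding Bl_def[symmetric] by blast
    have "f \<rho> \<in> verts B" using graph_isoD(2)[OF f] VB F by auto
    with BS B \<tau> have "(\<lambda>n. measure (uniform_count_measure (verts (Gn n)) \<Otimes>\<^sub>M Pn n)
               {(v, \<omega>). v \<in> verts (Gn n) \<and> \<omega> \<in> space (Pn n) \<and>
                        rooted_iso (gball (Gn n) R v) v \<omega> B (f \<rho>) \<tau>})
        \<longlonglongrightarrow> measure P {\<omega> \<in> space P. rooted_iso (gball G R \<rho>) \<rho> \<omega> B (f \<rho>) \<tau>}"
      unfolding BS_converges_def by blast
    moreover have "measure (uniform_count_measure (verts (Gn n)) \<Otimes>\<^sub>M Pn n)
               {(v, \<omega>). v \<in> verts (Gn n) \<and> \<omega> \<in> space (Pn n) \<and>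
                        rooted_iso (gball (Gn n) R v) v \<omega> B (f \<rho>) \<tau>}
        = vertex_average (Gn n) (Pn n) (\<lambda>v \<omega>. ?I n v \<omega> \<sigma>)" for n
      unfolding vertex_average_def
      by (subst measure_uniform_pair[OF finite_spin_systemD(2,3,5,6)[OF fs]])
        (simp add: eqn cong: sum.cong)
    ultimately show ?thesis by (simp add: eqG)
  qed

  have avg: "vertex_average (Gn n) (Pn n) (\<lambda>v \<omega>. q v \<omega> \<and> (\<exists>\<sigma>\<in>\<Sigma>. ?I n v \<omega> \<sigma>))
      = (\<Sum>\<sigma>\<in>\<Sigma>. of_bool (q' \<sigma>) / real (C \<sigma>) * vertex_average (Gn n) (Pn n) (\<lambda>v \<omega>. ?I n v \<omega> \<sigma>))"
    if q: "\<And>v \<omega> \<sigma>. v \<in> verts (Gn n) \<Longrightarrow> ?I n v \<omega> \<sigma> \<Longrightarrow> q v \<omega> = q' \<sigma>" for n q q'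
  proof -
    let ?m = "\<lambda>v \<sigma>. measure (Pn n) {\<omega> \<in> space (Pn n). ?I n v \<omega> \<sigma>}"
    have "measure (Pn n) {\<omega> \<in> space (Pn n). q v \<omega> \<and> (\<exists>\<sigma>\<in>\<Sigma>. ?I n v \<omega> \<sigma>)}
      = (\<Sum>\<sigma>\<in>\<Sigma>. of_bool (q' \<sigma>) / real (C \<sigma>) * ?m v \<sigma>)" if v: "v \<in> verts (Gn n)" for v
    proof (rule measure_weighted_classes[OF finite_spin_systemD(5)[OF fs] fin finite_spin_systemD(6)[OF fs]])
      fix \<omega> \<sigma> assume I: "?I n v \<omega> \<sigma>"
      have "v \<in> verts (gball (Gn n) R v)" using gball_verts_centre[OF v] by simp
      then show "C \<sigma> = card {\<tau> \<in> \<Sigma>. ?I n v \<omega> \<tau>}"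
        unfolding C_def by (rule rooted_iso_class_card[OF wfn[OF v] wfB _ I])
      show "q' \<sigma> = q v \<omega>" using q[OF v I] by simp
    qed
    then have "(\<Sum>v\<in>verts (Gn n). measure (Pn n) {\<omega> \<in> space (Pn n). q v \<omega> \<and> (\<exists>\<sigma>\<in>\<Sigma>. ?I n v \<omega> \<sigma>)})
      = (\<Sum>v\<in>verts (Gn n). \<Sum>\<sigma>\<in>\<Sigma>. of_bool (q' \<sigma>) / real (C \<sigma>) * ?m v \<sigma>)" by (rule sum.cong[OF refl])
    also have "\<dots> = (\<Sum>\<sigma>\<in>\<Sigma>. of_bool (q' \<sigma>) / real (C \<sigma>) * (\<Sum>v\<in>verts (Gn n). ?m v \<sigma>))"
      by (subst sum.swap) (simp add: sum_distrib_left)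
    finally show ?thesis unfolding vertex_average_def
      by (simp only: sum_divide_distrib[of _ \<Sigma>] times_divide_eq_right)
  qed
  have IG_cong: "?IG \<omega> \<sigma> \<longleftrightarrow> ?IG \<omega>' \<sigma>" if "\<forall>x\<in>F. \<omega> x = \<omega>' x" for \<omega> \<omega>' \<sigma>
    unfolding rooted_iso_def VB using that by auto
  have lim: "measure P {\<omega> \<in> space P. q \<omega>}
      = (\<Sum>\<sigma>\<in>\<Sigma>. of_bool (q \<sigma>) / real (C \<sigma>) * measure P {\<omega> \<in> space P. ?IG \<omega> \<sigma>})"
    if q: "\<And>\<omega> \<sigma>. ?IG \<omega> \<sigma> \<Longrightarrow> q \<omega> = q \<sigma>" for q
  proof -
    \<comment> \<open>In the limit each configuration is matched by its own restriction to the ball.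
      In the finite graphs a ball may have the wrong shape, so there the condition has to be carried
      along.\<close>
    have hit: "\<exists>\<sigma>\<in>\<Sigma>. ?IG \<omega> \<sigma>" if "\<omega> \<in> space P" for \<omega>
    proof
      show "restrict \<omega> F \<in> \<Sigma>" using that sp(1) F(2) by (auto simp: \<Sigma>_def PiE_iff subset_iff)
      show "?IG \<omega> (restrict \<omega> F)"
        unfolding rooted_iso_def VB by (intro exI[of _ "\<lambda>x. x"]) (simp add: graph_iso_id)
    qed
    have "cylinder_event (verts G) F {\<omega> \<in> space P. ?IG \<omega> \<sigma>}" for \<sigma>
      unfolding cylinder_event_def using IG_cong sp(1) by blast
    then have "{\<omega> \<in> space P. ?IG \<omega> \<sigma>} \<in> sets P" for \<sigma>
      using cylinder_event_sets[OF F(1,2)] sp(2) by simp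
    then have "measure P {\<omega> \<in> space P. q \<omega> \<and> (\<exists>\<sigma>\<in>\<Sigma>. ?IG \<omega> \<sigma>)}
      = (\<Sum>\<sigma>\<in>\<Sigma>. of_bool (q \<sigma>) / real (C \<sigma>) * measure P {\<omega> \<in> space P. ?IG \<omega> \<sigma>})"
    proof (rule measure_weighted_classes[OF sp(3) fin])
      fix \<omega> \<sigma> assume I: "?IG \<omega> \<sigma>"
      show "C \<sigma> = card {\<tau> \<in> \<Sigma>. ?IG \<omega> \<tau>}"
        unfolding C_def by (rule rooted_iso_class_card[OF wfB wfB _ I]) (use VB F(3) in simp)
      show "q \<sigma> = q \<omega>" using q[OF I] by simp
    qed
    also have "{\<omega> \<in> space P. q \<omega> \<and> (\<exists>\<sigma>\<in>\<Sigma>. ?IG \<omega> \<sigma>)} = {\<omega> \<in> space P. q \<omega>}" using hit by blast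
    finally show ?thesis .
  qed

  let ?hit = "\<lambda>n v \<omega>. \<exists>\<sigma>\<in>\<Sigma>. ?I n v \<omega> \<sigma>"
  have convergence: "(\<lambda>n. vertex_average (Gn n) (Pn n) (\<lambda>v \<omega>. q n v \<omega> \<and> ?hit n v \<omega>)) \<longlonglongrightarrow> measure P {\<omega> \<in> space P. q' \<omega>}"
    if q: "\<And>n v \<omega> \<sigma>. v \<in> verts (Gn n) \<Longrightarrow> ?I n v \<omega> \<sigma> \<Longrightarrow> q n v \<omega> = q' \<sigma>"
      and q': "\<And>\<omega> \<sigma>. ?IG \<omega> \<sigma> \<Longrightarrow> q' \<omega> = q' \<sigma>" for q q'
  proof -
    have "measure P {\<omega> \<in> space P. q' \<omega>}
        = (\<Sum>\<sigma>\<in>\<Sigma>. of_bool (q' \<sigma>) / real (C \<sigma>) * measure P {\<omega> \<in> space P. ?IG \<omega> \<sigma>})"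
      using q' by (rule lim)
    moreover have "vertex_average (Gn n) (Pn n) (\<lambda>v \<omega>. q n v \<omega> \<and> ?hit n v \<omega>)
        = (\<Sum>\<sigma>\<in>\<Sigma>. of_bool (q' \<sigma>) / real (C \<sigma>) * vertex_average (Gn n) (Pn n) (\<lambda>v \<omega>. ?I n v \<omega> \<sigma>))" for n
      using q by (rule avg)
    ultimately show ?thesis by (simp only:) (intro tendsto_sum tendsto_mult tendsto_const conv)
  qed
  have A: "(\<lambda>n. vertex_average (Gn n) (Pn n) (\<lambda>v \<omega>. Q n v \<omega> \<and> ?hit n v \<omega>)) \<longlonglongrightarrow> measure P {\<omega> \<in> space P. Q' \<omega>}"
    using Q Q' unfolding Bl_def[symmetric] by (rule convergence)
  \<comment> \<open>The trivial event shows that a random ball has the shape of the limiting ball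
    with probability tending to 1.\<close>
  have "(\<lambda>n. vertex_average (Gn n) (Pn n) (\<lambda>v \<omega>. True \<and> ?hit n v \<omega>)) \<longlonglongrightarrow> measure P {\<omega> \<in> space P. True}"
    by (rule convergence) simp_all
  then have hit: "(\<lambda>n. vertex_average (Gn n) (Pn n) (?hit n)) \<longlonglongrightarrow> 1" by (simp add: prob_space)
  have mono: "vertex_average (Gn n) (Pn n) q \<le> vertex_average (Gn n) (Pn n) q'"
    if "\<And>v \<omega>. q v \<omega> \<Longrightarrow> q' v \<omega>" for n q q'
  proof -
    interpret Pn: prob_space "Pn n" by (rule finite_spin_systemD(5)[OF fs])
    show ?thesis unfolding vertex_average_def using that
      by (intro divide_right_mono sum_mono Pn.finite_measure_mono finite_spin_systemD(6)[OF fs]) auto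
  qed
  have union: "vertex_average (Gn n) (Pn n) (\<lambda>v \<omega>. q v \<omega> \<or> \<not> q' v \<omega>)
      \<le> vertex_average (Gn n) (Pn n) q + (1 - vertex_average (Gn n) (Pn n) q')" for n q q'
  proof -
    interpret Pn: prob_space "Pn n" by (rule finite_spin_systemD(5)[OF fs])
    note meas = finite_spin_systemD(6)[OF fs]
    have "measure (Pn n) {\<omega> \<in> space (Pn n). q v \<omega> \<or> \<not> q' v \<omega>}
      \<le> measure (Pn n) {\<omega> \<in> space (Pn n). q v \<omega>} + (1 - measure (Pn n) {\<omega> \<in> space (Pn n). q' v \<omega>})" for v
    proof -
      have "measure (Pn n) {\<omega> \<in> space (Pn n). q v \<omega> \<or> \<not> q' v \<omega>}
        \<le> measure (Pn n) {\<omega> \<in> space (Pn n). q v \<omega>} + measure (Pn n) {\<omega> \<in> space (Pn n). \<not> q' v \<omega>}"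
        using measure_Un_le[OF meas meas, of n "q v" "\<lambda>\<omega>. \<not> q' v \<omega>"]
        by (simp add: Collect_disj_eq[symmetric] conj_disj_distribL)
      then show ?thesis using Pn.prob_neg[OF meas, of "q' v"] by simp
    qed
    then have "(\<Sum>v\<in>verts (Gn n). measure (Pn n) {\<omega> \<in> space (Pn n). q v \<omega> \<or> \<not> q' v \<omega>})
      \<le> (\<Sum>v\<in>verts (Gn n). measure (Pn n) {\<omega> \<in> space (Pn n). q v \<omega>} + (1 - measure (Pn n) {\<omega> \<in> space (Pn n). q' v \<omega>}))"
      by (intro sum_mono) auto
    moreover have "card (verts (Gn n)) > 0" using finite_spin_systemD(2,3)[OF fs[of n]] by (simp add: card_gt_0_iff)
    ultimately show ?thesis unfolding vertex_average_def
      by (simp add: sum.distrib sum_subtractf divide_simps)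
  qed
  \<comment> \<open>Dropping the condition on the shape changes the average by at most the
    probability of a wrong shape, which vanishes.\<close>
  show ?thesis
  proof (rule tendsto_sandwich[OF _ _ A])
    show "\<forall>\<^sub>F n in sequentially. vertex_average (Gn n) (Pn n) (\<lambda>v \<omega>. Q n v \<omega> \<and> ?hit n v \<omega>) \<le> vertex_average (Gn n) (Pn n) (Q n)"
      by (intro always_eventually allI mono) auto
    show "\<forall>\<^sub>F n in sequentially. vertex_average (Gn n) (Pn n) (Q n)
      \<le> vertex_average (Gn n) (Pn n) (\<lambda>v \<omega>. Q n v \<omega> \<and> ?hit n v \<omega>) + (1 - vertex_average (Gn n) (Pn n) (?hit n))"
      by (intro always_eventually allI order_trans[OF mono union]) auto
    show "(\<lambda>n. vertex_average (Gn n) (Pn n) (\<lambda>v \<omega>. Q n v \<omega> \<and> ?hit n v \<omega>) + (1 - vertex_average (Gn n) (Pn n) (?hit n)))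
      \<longlonglongrightarrow> measure P {\<omega> \<in> space P. Q' \<omega>}"
      using tendsto_add[OF A tendsto_diff[OF tendsto_const hit, of 1]] by simp
  qed
qed

section \<open>Clue of the majority on an expander\<close>

text \<open>Each preimage under \<open>X\<close> is the preimage, under restriction to
  \<open>U\<close>, of its own image, and every set of configurations on the finite set
  \<open>U\<close> is measurable.\<close>

lemma spin_algebra_measurable:
  assumes P: "spin_measure V P" and U: "finite U" "U \<subseteq> V"
    and X: "\<And>\<omega> \<omega>'. \<omega> \<in> space P \<Longrightarrow> \<omega>' \<in> space P \<Longrightarrow> \<forall>x\<in>U. \<omega> x = \<omega>' x \<Longrightarrow> X \<omega> = X \<omega>'"
  shows "(X :: _ \<Rightarrow> real) \<in> borel_measurable (spin_algebra P U)"
proof (rule measurableI)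
  fix S :: "real set" assume "S \<in> sets borel"
  let ?r = "\<lambda>\<omega>. restrict \<omega> U" and ?X = "X -` S \<inter> space P"
  have r: "?r \<in> space P \<rightarrow> space (spin_space U)"
    using U(2) spin_measure_space(1)[OF P] by (auto simp: PiE_iff subset_iff)
  have "?X = ?r -` (?r ` ?X) \<inter> space P"
  proof (intro equalityI subsetI)
    fix \<omega> assume "\<omega> \<in> ?r -` (?r ` ?X) \<inter> space P"
    then obtain \<omega>' where \<omega>': "\<omega>' \<in> ?X" "?r \<omega> = ?r \<omega>'" "\<omega> \<in> space P" by auto
    have "\<forall>x\<in>U. \<omega> x = \<omega>' x" using \<omega>'(2) by (metis restrict_apply')
    then show "\<omega> \<in> ?X" using X[of \<omega> \<omega>'] \<omega>' by auto
  qed auto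
  moreover have "?r ` ?X \<in> sets (spin_space U)"
    using r unfolding sets_spin_space_finite[OF U(1)] by auto
  ultimately show "X -` S \<inter> space (spin_algebra P U) \<in> sets (spin_algebra P U)"
    unfolding spin_algebra_def sets_vimage_algebra2[OF r] by auto
qed simp

lemma finite_spin_measurable:
  assumes "finite V" "spin_measure V P" shows "(g :: _ \<Rightarrow> real) \<in> borel_measurable P"
proof (rule measurableI)
  show "g -` A \<inter> space P \<in> sets P" for A
    using spin_measure_space[OF assms(2)] sets_spin_space_finite[OF assms(1)] by auto
qed simp

lemma finite_spin_integrable:
  assumes "finite V" "spin_measure V P" shows "integrable P (g :: _ \<Rightarrow> real)"
proof -
  interpret prob_space P using assms by (simp add: spin_measure_def)
  have "finite (space P)" using spin_measure_space(1)[OF assms(2)] finite_spins[OF assms(1)] by simp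
  then have "\<And>\<omega>. \<omega> \<in> space P \<Longrightarrow> norm (g \<omega>) \<le> (\<Sum>\<omega>'\<in>space P. norm (g \<omega>'))"
    by (intro member_le_sum) auto
  then show ?thesis
    by (intro integrable_const_bound AE_I2 finite_spin_measurable[OF assms])
qed

text \<open>
  The conditional expectation is the best approximation in \<open>L\<^sup>2\<close>, so it is at least as close
  to \<open>f\<close> as the sign of \<open>X\<close>, which is at squared distance \<open>4 P (f \<noteq> X)\<close>.
\<close>

lemma clue_lower_bound:
  assumes V: "finite V" and P: "spin_measure V P" and U: "U \<subseteq> V"
    and f: "\<And>\<omega>. \<omega> \<in> space P \<Longrightarrow> f \<omega> \<in> {-1, 1 :: real}"
    and X: "\<And>\<omega> \<omega>'. \<omega> \<in> space P \<Longrightarrow> \<omega>' \<in> space P \<Longrightarrow> \<forall>x\<in>U. \<omega> x = \<omega>' x \<Longrightarrow> X \<omega> = X \<omega>'"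
    and var: "prob_space.variance P f > 0"
  shows "clue P f U \<ge> 1 - 4 * measure P {\<omega> \<in> space P. X \<omega> \<noteq> (f \<omega> = 1)} / prob_space.variance P f"
proof -
  note sp = spin_measure_space[OF P]
  interpret prob_space P by (rule sp)
  have finU: "finite U" using U V finite_subset by auto
  have setsP: "sets P = Pow (space P)" using sp sets_spin_space_finite[OF V] by simp
  let ?F = "spin_algebra P U"
  have "subalgebra P ?F"
    unfolding subalgebra_def using sets.space_closed[of ?F] setsP by (simp add: spin_algebra_def)
  then interpret finite_measure_subalgebra P ?F by unfold_locales
  note int [simp] = finite_spin_integrable[OF V P] and meas [simp] = finite_spin_measurable[OF V P]
  define x where "x \<omega> = (if X \<omega> then 1 else -1 :: real)" for \<omega>
  define Y where "Y = real_cond_exp P ?F f"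
  have YF: "Y \<in> borel_measurable ?F" unfolding Y_def by simp
  have xF: "x \<in> borel_measurable ?F"
    by (rule spin_algebra_measurable[OF P finU U]) (auto simp: x_def dest: X)
  have proj: "(\<integral>\<omega>. g \<omega> * Y \<omega> \<partial>P) = (\<integral>\<omega>. g \<omega> * f \<omega> \<partial>P)" if "g \<in> borel_measurable ?F" for g
    unfolding Y_def by (rule real_cond_exp_intg(2)[OF int that meas])
  have EY: "expectation Y = expectation f" using proj[of "\<lambda>_. 1"] by simp
  have YY: "expectation (\<lambda>\<omega>. Y \<omega> * Y \<omega>) = expectation (\<lambda>\<omega>. Y \<omega> * f \<omega>)" by (rule proj[OF YF])
  have xY: "expectation (\<lambda>\<omega>. x \<omega> * Y \<omega>) = expectation (\<lambda>\<omega>. x \<omega> * f \<omega>)" by (rule proj[OF xF])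
  \<comment> \<open>Expanding the square bounds the second moment of \<open>Y\<close> from below;
    the mixed term becomes one of \<open>x\<close> and \<open>f\<close> because \<open>Y\<close> is
    the projection of \<open>f\<close>.\<close>
  have "0 \<le> expectation (\<lambda>\<omega>. (Y \<omega> - x \<omega>)\<^sup>2)" by (intro Bochner_Integration.integral_nonneg) simp
  also have "expectation (\<lambda>\<omega>. (Y \<omega> - x \<omega>)\<^sup>2)
      = expectation (\<lambda>\<omega>. Y \<omega> * Y \<omega> + x \<omega> * x \<omega> - 2 * (x \<omega> * Y \<omega>))"
    by (rule Bochner_Integration.integral_cong) (auto simp: power2_eq_square algebra_simps)
  also have "\<dots> = expectation (\<lambda>\<omega>. Y \<omega> * Y \<omega>) + expectation (\<lambda>\<omega>. x \<omega> * x \<omega>) - 2 * expectation (\<lambda>\<omega>. x \<omega> * Y \<omega>)"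
    by simp
  finally have 1: "0 \<le> expectation (\<lambda>\<omega>. Y \<omega> * Y \<omega>) + expectation (\<lambda>\<omega>. x \<omega> * x \<omega>) - 2 * expectation (\<lambda>\<omega>. x \<omega> * f \<omega>)"
    using xY by simp
  let ?S = "{\<omega> \<in> space P. X \<omega> \<noteq> (f \<omega> = 1)}"
  have S: "?S \<in> sets P" using setsP by auto
  \<comment> \<open>Two signs differ by 0 or 2, so the squared difference of \<open>f\<close> and
    \<open>x\<close> is 4 exactly where they disagree.\<close>
  have "4 * measure P ?S = expectation (\<lambda>\<omega>. 4 * indicator ?S \<omega>)" using S by simp
  also have "\<dots> = expectation (\<lambda>\<omega>. f \<omega> * f \<omega> + x \<omega> * x \<omega> - 2 * (x \<omega> * f \<omega>))"
  proof (rule Bochner_Integration.integral_cong[OF refl])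
    fix \<omega> assume "\<omega> \<in> space P"
    then have "f \<omega> = -1 \<or> f \<omega> = 1" using f by blast
    then show "4 * indicator ?S \<omega> = f \<omega> * f \<omega> + x \<omega> * x \<omega> - 2 * (x \<omega> * f \<omega>)"
      using \<open>\<omega> \<in> space P\<close> by (auto simp: x_def indicator_def)
  qed
  also have "\<dots> = expectation (\<lambda>\<omega>. f \<omega> * f \<omega>) + expectation (\<lambda>\<omega>. x \<omega> * x \<omega>) - 2 * expectation (\<lambda>\<omega>. x \<omega> * f \<omega>)"
    by simp
  finally have 2: "4 * measure P ?S = \<dots>" .
  have "variance Y = expectation (\<lambda>\<omega>. Y \<omega> * Y \<omega>) - (expectation f)\<^sup>2"
    by (subst variance_eq) (simp_all add: EY power2_eq_square)
  moreover have "variance f = expectation (\<lambda>\<omega>. f \<omega> * f \<omega>) - (expectation f)\<^sup>2"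
    by (subst variance_eq) (simp_all add: power2_eq_square)
  ultimately have "variance Y \<ge> variance f - 4 * measure P ?S" using 1 2 by simp
  then have "variance Y / variance f \<ge> (variance f - 4 * measure P ?S) / variance f"
    using var by (intro divide_right_mono) auto
  then show ?thesis using var by (simp add: clue_def Y_def diff_divide_distrib)
qed

lemma variance_sign:
  assumes V: "finite V" and P: "spin_measure V P"
    and f: "\<And>\<omega>. \<omega> \<in> space P \<Longrightarrow> f \<omega> \<in> {-1, 1 :: real}"
  defines "q \<equiv> measure P {\<omega> \<in> space P. f \<omega> = 1}"
  shows "prob_space.variance P f = 4 * (q * (1 - q))"
proof -
  note sp = spin_measure_space[OF P]
  interpret prob_space P by (rule sp)
  let ?S = "{\<omega> \<in> space P. f \<omega> = 1}"
  have S: "?S \<in> sets P" using sp sets_spin_space_finite[OF V] by auto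
  note int [simp] = finite_spin_integrable[OF V P]
  have "expectation f = expectation (\<lambda>\<omega>. 2 * indicator ?S \<omega> - 1)"
    using f by (intro Bochner_Integration.integral_cong) (auto simp: indicator_def)
  also have "\<dots> = 2 * q - 1" using S by (simp add: q_def prob_space)
  finally have E: "expectation f = 2 * q - 1" .
  have "expectation (\<lambda>\<omega>. (f \<omega>)\<^sup>2) = expectation (\<lambda>\<omega>. 1)"
    using f by (intro Bochner_Integration.integral_cong) (force simp: power2_eq_square)+
  then show ?thesis by (subst variance_eq) (simp_all add: E prob_space power2_eq_square algebra_simps)
qed

text \<open>Expansion applies to the smaller of \<open>W\<close> and its complement, which share
  their edge boundary. Each boundary edge has an endpoint in the inner vertex boundary of
  \<open>W\<close>, and at most \<open>D\<close> edges meet at any vertex.\<close>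

lemma expander_minority:
  assumes wf: "wf_lgraph G" and fin: "finite (verts G)" and "h > 0"
    and deg: "\<And>v. v \<in> verts G \<Longrightarrow> finite (incident_edges G v) \<and> card (incident_edges G v) \<le> D"
    and exp: "\<And>W. W \<noteq> {} \<Longrightarrow> W \<subseteq> verts G \<Longrightarrow> real (card W) \<le> real (card (verts G)) / 2 \<Longrightarrow>
      real (card (edge_boundary G W)) / real (card W) > h"
    and W: "W \<subseteq> verts G"
  shows "h * real (min (card W) (card (verts G - W)))
    \<le> real D * real (card {v \<in> W. \<exists>w. {v, w} \<in> edges G \<and> w \<notin> W})"
proof -
  let ?B = "{v \<in> W. \<exists>w. {v, w} \<in> edges G \<and> w \<notin> W}" and ?V = "verts G"
  have finW: "finite W" "finite (?V - W)" using fin W finite_subset by auto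
  have card: "card W + card (?V - W) = card ?V"
    using card_Diff_subset[OF finW(1) W] card_mono[OF fin W] by simp
  have exp': "h * real (card X) \<le> real (card (edge_boundary G X))"
    if "X \<subseteq> ?V" "2 * card X \<le> card ?V" for X
  proof (cases "X = {}")
    case False
    then have "card X > 0" using that(1) fin finite_subset by (auto simp: card_gt_0_iff)
    moreover have "real (card X) \<le> real (card ?V) / 2" using that(2) by linarith
    ultimately show ?thesis using exp[OF False that(1)] by (simp add: field_simps)
  qed simp
  have sym: "edge_boundary G (?V - W) = edge_boundary G W"
    unfolding edge_boundary_def using W by (auto simp: insert_commute double_diff)
  have "edge_boundary G W \<subseteq> (\<Union>v\<in>?B. incident_edges G v)"
    unfolding edge_boundary_def incident_edges_def by auto
  then have "card (edge_boundary G W) \<le> card (\<Union>v\<in>?B. incident_edges G v)"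
    using deg W finW by (intro card_mono) auto
  also have "\<dots> \<le> (\<Sum>v\<in>?B. card (incident_edges G v))" using finW by (intro card_UN_le) simp
  also have "\<dots> \<le> (\<Sum>v\<in>?B. D)" using deg W by (intro sum_mono) auto
  finally have B: "card (edge_boundary G W) \<le> D * card ?B" by (simp add: mult.commute)
  have "h * real (min (card W) (card (?V - W))) \<le> real (card (edge_boundary G W))"
  proof (cases "card W \<le> card (?V - W)")
    case True
    then show ?thesis using exp'[OF W] card by (simp add: min_def)
  next
    case False
    then show ?thesis using exp'[of "?V - W"] card sym by (simp add: min_def)
  qed
  also have "\<dots> \<le> real (D * card ?B)" using B by (simp only: of_nat_le_iff)
  finally show ?thesis by simp
qed

lemma vertex_average_integral:
  assumes "finite_spin_system G P"
  shows "vertex_average G P Q = (\<integral>\<omega>. real (card {v \<in> verts G. Q v \<omega>}) \<partial>P) / card (verts G)"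
proof -
  note fs = finite_spin_systemD[OF assms]
  interpret prob_space P by (rule fs)
  have "(\<integral>\<omega>. real (card {v \<in> verts G. Q v \<omega>}) \<partial>P) = (\<integral>\<omega>. (\<Sum>v\<in>verts G. indicator {\<omega> \<in> space P. Q v \<omega>} \<omega>) \<partial>P)"
    using fs(2) by (intro Bochner_Integration.integral_cong) (auto simp: indicator_def sum.If_cases Int_def)
  also have "\<dots> = (\<Sum>v\<in>verts G. measure P {\<omega> \<in> space P. Q v \<omega>})"
    using fs(6) by (subst Bochner_Integration.integral_sum) (auto intro: finite_spin_integrable[OF fs(2,4)])
  finally show ?thesis by (simp add: vertex_average_def)
qed

text \<open>Integrates a counting inequality valid for each configuration; this is how expansion, a
  statement about fixed vertex sets, enters the averages.\<close>

lemma vertex_average_mono: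
  assumes "finite_spin_system G P"
    and "\<And>\<omega>. \<omega> \<in> space P \<Longrightarrow> a * real (card {v \<in> verts G. Q v \<omega>}) \<le> b * real (card {v \<in> verts G. Q' v \<omega>})"
  shows "a * vertex_average G P Q \<le> b * vertex_average G P Q'"
proof -
  note fs = finite_spin_systemD[OF assms(1)]
  note int = finite_spin_integrable[OF fs(2,4)]
  have "(\<integral>\<omega>. a * real (card {v \<in> verts G. Q v \<omega>}) \<partial>P) \<le> (\<integral>\<omega>. b * real (card {v \<in> verts G. Q' v \<omega>}) \<partial>P)"
    using assms(2) by (intro integral_mono int)
  then show ?thesis unfolding vertex_average_integral[OF assms(1)]
    using int by (simp add: divide_right_mono)
qed

text \<open>A tie gives -1. Only the number of positive verdicts enters, so equivariance of
  \<open>Q\<close> under automorphisms makes the majority invariant.\<close>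

definition majority :: "('v, 'l) lgraph \<Rightarrow> ('v \<Rightarrow> ('v \<Rightarrow> int) \<Rightarrow> bool) \<Rightarrow> ('v \<Rightarrow> int) \<Rightarrow> real" where
  "majority G Q \<omega> = (if 2 * card {v \<in> verts G. Q v \<omega>} > card (verts G) then 1 else -1)"

lemma majority_values: "majority G Q \<omega> \<in> {-1, 1}"
  by (simp add: majority_def)

text \<open>Identifies the number of vertices contradicting the majority with the minimum that
  \<open>expander_minority\<close> bounds.\<close>

lemma card_against_majority:
  assumes "finite (verts G)"
  shows "card {v \<in> verts G. Q v \<omega> \<noteq> (majority G Q \<omega> = 1)}
    = min (card {v \<in> verts G. Q v \<omega>}) (card (verts G - {v \<in> verts G. Q v \<omega>}))"
proof -
  let ?W = "{v \<in> verts G. Q v \<omega>}"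
  have "card ?W + card (verts G - ?W) = card (verts G)"
    using card_mono[OF assms, of ?W] assms by (subst card_Diff_subset) auto
  moreover have "{v \<in> verts G. Q v \<omega> \<noteq> (majority G Q \<omega> = 1)} = (if 2 * card ?W > card (verts G) then verts G - ?W else ?W)"
    by (auto simp: majority_def)
  ultimately show ?thesis by auto
qed

text \<open>Let \<open>\<delta>\<close> be the average probability that a vertex contradicts the
  majority. Expansion gives \<open>\<delta> \<le> s / 8\<close>, so the majority is positive with
  probability within \<open>s / 4\<close> of \<open>p\<close> and has variance at least
  \<open>3 * s\<close>. The loss \<open>4 * \<delta> / variance\<close> in the averaged bound of
  \<open>clue_lower_bound\<close> is then at most 1/6.\<close>

lemma majority_clue:
  assumes fs: "finite_spin_system G P" and h: "h > 0"
    and deg: "\<And>v. v \<in> verts G \<Longrightarrow> finite (incident_edges G v) \<and> card (incident_edges G v) \<le> D"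
    and exp: "\<And>W. W \<noteq> {} \<Longrightarrow> W \<subseteq> verts G \<Longrightarrow> real (card W) \<le> real (card (verts G)) / 2 \<Longrightarrow>
      real (card (edge_boundary G W)) / real (card W) > h"
    and U: "\<And>v. v \<in> verts G \<Longrightarrow> U v \<subseteq> verts G"
    and Q: "\<And>v \<omega> \<omega>'. v \<in> verts G \<Longrightarrow> \<forall>x\<in>U v. \<omega> x = \<omega>' x \<Longrightarrow> Q v \<omega> = Q v \<omega>'"
    and p: "0 < p" "p < 1" and s: "s = p * (1 - p)"
    and m: "\<bar>vertex_average G P Q - p\<bar> \<le> s / 8"
    and b: "D / h * vertex_average G P (\<lambda>v \<omega>. Q v \<omega> \<and> (\<exists>w. {v, w} \<in> edges G \<and> \<not> Q w \<omega>)) \<le> s / 8"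
  shows "(\<Sum>v\<in>verts G. clue P (majority G Q) (U v)) / card (verts G) \<ge> 5 / 6"
proof -
  note fsD = finite_spin_systemD[OF fs]
  interpret prob_space P by (rule fsD)
  let ?f = "majority G Q" and ?V = "verts G"
  let ?bd = "\<lambda>v \<omega>. Q v \<omega> \<and> (\<exists>w. {v, w} \<in> edges G \<and> \<not> Q w \<omega>)"
  have N: "real (card ?V) > 0" using fsD(2,3) by (simp add: card_gt_0_iff)
  define q where "q = measure P {\<omega> \<in> space P. ?f \<omega> = 1}"
  define \<delta> where "\<delta> = vertex_average G P (\<lambda>v \<omega>. Q v \<omega> \<noteq> (?f \<omega> = 1))"
  have "h * \<delta> \<le> D * vertex_average G P ?bd"
    unfolding \<delta>_def
  proof (rule vertex_average_mono[OF fs])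
    fix \<omega>
    let ?W = "{v \<in> ?V. Q v \<omega>}"
    have "{v \<in> ?W. \<exists>w. {v, w} \<in> edges G \<and> w \<notin> ?W} = {v \<in> ?V. ?bd v \<omega>}"
      using wf_edgeD(2)[OF fsD(1)] by blast
    then show "h * real (card {v \<in> ?V. Q v \<omega> \<noteq> (?f \<omega> = 1)}) \<le> D * real (card {v \<in> ?V. ?bd v \<omega>})"
      using expander_minority[OF fsD(1,2) h deg exp, of ?W] unfolding card_against_majority[OF fsD(2)] by auto
  qed
  then have "\<delta> \<le> D / h * vertex_average G P ?bd" using h by (simp add: field_simps)
  also note b
  finally have \<delta>: "\<delta> \<le> s / 8" .
  have "\<bar>q - vertex_average G P Q\<bar> \<le> \<delta>"
  proof -
    have "\<bar>q - measure P {\<omega> \<in> space P. Q v \<omega>}\<bar> \<le> measure P {\<omega> \<in> space P. Q v \<omega> \<noteq> (?f \<omega> = 1)}" for v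
    proof -
      have "q \<le> measure P ({\<omega> \<in> space P. Q v \<omega>} \<union> {\<omega> \<in> space P. Q v \<omega> \<noteq> (?f \<omega> = 1)})"
        unfolding q_def by (intro finite_measure_mono sets.Un fsD(6)) auto
      also have "\<dots> \<le> measure P {\<omega> \<in> space P. Q v \<omega>} + measure P {\<omega> \<in> space P. Q v \<omega> \<noteq> (?f \<omega> = 1)}"
        by (intro measure_Un_le fsD(6))
      finally have 1: "q \<le> \<dots>" .
      have "measure P {\<omega> \<in> space P. Q v \<omega>} \<le> measure P ({\<omega> \<in> space P. ?f \<omega> = 1} \<union> {\<omega> \<in> space P. Q v \<omega> \<noteq> (?f \<omega> = 1)})"
        by (intro finite_measure_mono sets.Un fsD(6)) auto
      also have "\<dots> \<le> q + measure P {\<omega> \<in> space P. Q v \<omega> \<noteq> (?f \<omega> = 1)}"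
        unfolding q_def by (intro measure_Un_le fsD(6))
      finally show ?thesis using 1 by simp
    qed
    then have "\<bar>\<Sum>v\<in>?V. q - measure P {\<omega> \<in> space P. Q v \<omega>}\<bar>
        \<le> (\<Sum>v\<in>?V. measure P {\<omega> \<in> space P. Q v \<omega> \<noteq> (?f \<omega> = 1)})"
      by (intro order_trans[OF sum_abs] sum_mono)
    then have "\<bar>\<Sum>v\<in>?V. q - measure P {\<omega> \<in> space P. Q v \<omega>}\<bar> / card ?V \<le> \<delta>"
      unfolding \<delta>_def vertex_average_def by (rule divide_right_mono) simp
    moreover have "q - vertex_average G P Q = (\<Sum>v\<in>?V. q - measure P {\<omega> \<in> space P. Q v \<omega>}) / card ?V"
      using N by (simp add: vertex_average_def sum_subtractf diff_divide_distrib)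
    ultimately show ?thesis by simp
  qed
  then have qp: "\<bar>q - p\<bar> \<le> s / 4" using m \<delta> by linarith
  have q: "0 \<le> q" "q \<le> 1" unfolding q_def by auto
  \<comment> \<open>The function x(1 - x) is 1-Lipschitz on the unit interval, so an error of
    \<open>s / 4\<close> in \<open>q\<close> costs at most a quarter of \<open>s\<close>.\<close>
  have "p * (1 - p) - q * (1 - q) = (p - q) * (1 - p - q)" by (simp add: algebra_simps)
  also have "\<dots> \<le> \<bar>p - q\<bar> * \<bar>1 - p - q\<bar>" by (simp add: abs_mult[symmetric])
  also have "\<dots> \<le> \<bar>p - q\<bar> * 1" using p q by (intro mult_left_mono) auto
  finally have qq: "q * (1 - q) \<ge> 3 / 4 * s" using qp
    unfolding s[symmetric] abs_minus_commute[of p q] by simp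
  have s0: "s > 0" using p s by simp
  have var: "variance ?f = 4 * (q * (1 - q))"
    unfolding q_def using majority_values by (intro variance_sign[OF fsD(2,4)]) auto
  then have var3: "variance ?f \<ge> 3 * s" using qq by simp
  then have var0: "variance ?f > 0" using s0 by simp
  have "(\<Sum>v\<in>?V. 1 - 4 * measure P {\<omega> \<in> space P. Q v \<omega> \<noteq> (?f \<omega> = 1)} / variance ?f)
      \<le> (\<Sum>v\<in>?V. clue P ?f (U v))"
    using majority_values Q U var0 by (intro sum_mono clue_lower_bound[OF fsD(2,4)]) auto
  then have "(\<Sum>v\<in>?V. 1 - 4 * measure P {\<omega> \<in> space P. Q v \<omega> \<noteq> (?f \<omega> = 1)} / variance ?f) / card ?V
      \<le> (\<Sum>v\<in>?V. clue P ?f (U v)) / card ?V"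
    by (intro divide_right_mono) auto
  moreover have "(\<Sum>v\<in>?V. 1 - 4 * measure P {\<omega> \<in> space P. Q v \<omega> \<noteq> (?f \<omega> = 1)} / variance ?f) / card ?V
      = 1 - 4 * \<delta> / variance ?f"
    using N unfolding \<delta>_def vertex_average_def
    by (simp add: sum_subtractf sum_divide_distrib[symmetric] sum_distrib_left[symmetric] diff_divide_distrib)
  moreover have "4 * \<delta> / variance ?f \<le> 1 / 6"
  proof -
    have "4 * \<delta> \<le> variance ?f / 6" using \<delta> var3 by linarith
    then show ?thesis using var0 by (simp add: divide_le_eq)
  qed
  ultimately show ?thesis by linarith
qed

section \<open>Reconstruction on connected limits\<close>

lemma expander_sequence_degree:
  assumes "expander_sequence Gn"
  obtains D where "\<And>n v. v \<in> verts (Gn n) \<Longrightarrow>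
    finite (incident_edges (Gn n) v) \<and> card (incident_edges (Gn n) v) \<le> D"
proof -
  have "bounded_degrees Gn" using assms by (simp only: expander_sequence_def)
  then show thesis unfolding bounded_degrees_def using that by blast
qed

lemma expander_sequence_expansion:
  assumes "expander_sequence Gn"
  obtains h where "h > 0" "\<And>n W. W \<noteq> {} \<Longrightarrow> W \<subseteq> verts (Gn n) \<Longrightarrow>
    real (card W) \<le> real (card (verts (Gn n))) / 2 \<Longrightarrow>
    real (card (edge_boundary (Gn n) W)) / real (card W) > h"
proof -
  have "\<exists>h>0. \<forall>n W. W \<noteq> {} \<and> W \<subseteq> verts (Gn n) \<and> real (card W) \<le> real (card (verts (Gn n))) / 2 \<longrightarrow>
      real (card (edge_boundary (Gn n) W)) / real (card W) > h"
    using assms by (simp only: expander_sequence_def)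
  then show thesis by (elim exE conjE) (rule that, assumption, iprover)
qed

text \<open>The ball around a uniform vertex has bounded size, so it covers a given vertex with
  probability of order one over the number of vertices; its expected clue is the given average. For
  a deterministic set, some ball has at least the average clue.\<close>

lemma reconstruction_from_balls:
  fixes Gn :: "nat \<Rightarrow> ('v, 'l) lgraph"
  assumes fs: "\<And>n. finite_spin_system (Gn n) (Pn n)" and exp: "expander_sequence Gn"
    and avg: "\<forall>\<^sub>F n in sequentially. (\<Sum>v\<in>verts (Gn n). clue (Pn n) (majority (Gn n) (Q n)) (gball_verts (Gn n) R v))
      / card (verts (Gn n)) \<ge> 5 / 6"
    and inv: "\<And>n \<gamma> v \<omega>. \<gamma> \<in> Aut (Gn n) \<Longrightarrow> v \<in> verts (Gn n) \<Longrightarrow>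
      Q n v (spin_pull (verts (Gn n)) \<gamma> \<omega>) = Q n (\<gamma> v) \<omega>"
  shows "random_sparse_reconstruction Gn Pn" "sparse_reconstruction Gn Pn (\<lambda>n. Aut (Gn n))"
proof -
  note fsD = finite_spin_systemD[OF fs]
  obtain D where deg: "\<And>n v. v \<in> verts (Gn n) \<Longrightarrow> finite (incident_edges (Gn n) v) \<and> card (incident_edges (Gn n) v) \<le> D"
    by (rule expander_sequence_degree[OF exp]) (rule that, blast)
  have lim: "filterlim (\<lambda>n. card (verts (Gn n))) at_top sequentially"
    using exp by (simp add: expander_sequence_def)
  define K where "K = real ((D + 1) ^ R)"
  have ball: "real (card (gball_verts (Gn n) R v)) \<le> K" if "v \<in> verts (Gn n)" for n v
    using card_gball_verts_le[OF fsD(1) that deg] unfolding K_def by (simp only: of_nat_le_iff)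
  have N: "card (verts (Gn n)) > 0" for n using fsD(2,3)[of n] by (simp add: card_gt_0_iff)
  have "filterlim (\<lambda>n. real (card (verts (Gn n)))) at_top sequentially"
    using lim by (rule filterlim_compose[OF filterlim_real_sequentially])
  then have K0: "(\<lambda>n. K / real (card (verts (Gn n)))) \<longlonglongrightarrow> 0"
    by (intro real_tendsto_divide_at_top[OF tendsto_const])
  let ?f = "\<lambda>n. majority (Gn n) (Q n)" and ?B = "\<lambda>n. gball_verts (Gn n) R"

  define U where "U n = map_pmf (?B n) (pmf_of_set (verts (Gn n)))" for n
  have "(\<lambda>n. MAX j\<in>verts (Gn n). measure_pmf.prob (U n) {W. j \<in> W}) \<longlonglongrightarrow> 0"
  proof (rule tendsto_sandwich[OF _ _ tendsto_const K0])
    have pr: "measure_pmf.prob (U n) {W. j \<in> W} \<le> K / real (card (verts (Gn n)))" if j: "j \<in> verts (Gn n)" for n j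
    proof -
      have "measure_pmf.prob (U n) {W. j \<in> W} = card (verts (Gn n) \<inter> {v. j \<in> ?B n v}) / card (verts (Gn n))"
        unfolding U_def using fsD(2,3)[of n] by (simp add: measure_map_pmf measure_pmf_of_set vimage_def)
      \<comment> \<open>By symmetry of the distance, the centres whose ball covers \<open>j\<close>
        lie in the ball around \<open>j\<close>.\<close>
      also have "card (verts (Gn n) \<inter> {v. j \<in> ?B n v}) \<le> card (?B n j)"
        using fsD(2)[of n] finite_subset[OF gball_verts_subset] by (intro card_mono) (auto intro: gball_verts_sym)
      then have "card (verts (Gn n) \<inter> {v. j \<in> ?B n v}) / card (verts (Gn n)) \<le> K / card (verts (Gn n))"
        using ball[OF j] by (intro divide_right_mono) linarith+
      finally show ?thesis .
    qed
    show "\<forall>\<^sub>F n in sequentially. 0 \<le> (MAX j\<in>verts (Gn n). measure_pmf.prob (U n) {W. j \<in> W})"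
      using fsD(2,3) by (intro always_eventually allI) (auto simp: Max_ge_iff)
    show "\<forall>\<^sub>F n in sequentially. (MAX j\<in>verts (Gn n). measure_pmf.prob (U n) {W. j \<in> W}) \<le> K / real (card (verts (Gn n)))"
      using fsD(2,3) pr by (intro always_eventually allI) auto
  qed
  moreover have "set_pmf (U n) \<subseteq> Pow (verts (Gn n))" for n
    unfolding U_def using fsD(2,3)[of n] gball_verts_subset[of "Gn n" R] by (auto simp: set_pmf_of_set)
  moreover have "\<forall>\<^sub>F n in sequentially. measure_pmf.expectation (U n) (clue (Pn n) (?f n)) > 1 / 2"
    using avg
  proof eventually_elim
    case (elim n)
    then show ?case unfolding U_def
      using integral_pmf_of_set[OF fsD(3,2)[of n], of "\<lambda>v. clue (Pn n) (?f n) (?B n v)"] by simp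
  qed
  moreover have "?f n \<in> space (Pn n) \<rightarrow> {-1, 1}" for n using majority_values by auto
  ultimately show "random_sparse_reconstruction Gn Pn"
    unfolding random_sparse_reconstruction_def
    by (intro exI[of _ ?f] exI[of _ U] exI[of _ "1 / 2 :: real"]) simp

  have "\<exists>v\<in>verts (Gn n). clue (Pn n) (?f n) (?B n v) \<ge>
      (\<Sum>v\<in>verts (Gn n). clue (Pn n) (?f n) (?B n v)) / card (verts (Gn n))" for n
  proof (rule ccontr)
    let ?a = "(\<Sum>v\<in>verts (Gn n). clue (Pn n) (?f n) (?B n v)) / card (verts (Gn n))"
    assume "\<not> ?thesis"
    then have "(\<Sum>v\<in>verts (Gn n). clue (Pn n) (?f n) (?B n v)) < (\<Sum>v\<in>verts (Gn n). ?a)"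
      using fsD(2,3)[of n] by (intro sum_strict_mono) auto
    then show False using N[of n] by simp
  qed
  then obtain v where v: "\<And>n. v n \<in> verts (Gn n)" "\<And>n. clue (Pn n) (?f n) (?B n (v n)) \<ge>
      (\<Sum>v\<in>verts (Gn n). clue (Pn n) (?f n) (?B n v)) / card (verts (Gn n))" by metis
  have "\<forall>\<^sub>F n in sequentially. ereal (1 / 2) \<le> ereal (clue (Pn n) (?f n) (?B n (v n)))"
    using avg
  proof eventually_elim
    case (elim n)
    then have "1 / 2 \<le> clue (Pn n) (?f n) (?B n (v n))" using v(2)[of n] by linarith
    then show ?case by simp
  qed
  then have "ereal (1 / 2) \<le> liminf (\<lambda>n. ereal (clue (Pn n) (?f n) (?B n (v n))))"
    by (rule Liminf_bounded)
  then have liminf: "liminf (\<lambda>n. ereal (clue (Pn n) (?f n) (?B n (v n)))) > 0"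
    by (rule less_le_trans[rotated]) simp
  have small: "(\<lambda>n. real (card (?B n (v n))) / real (card (verts (Gn n)))) \<longlonglongrightarrow> 0"
    using ball[OF v(1)]
    by (intro tendsto_sandwich[OF _ _ tendsto_const K0] always_eventually allI divide_right_mono) auto
  have "invariant_fun (verts (Gn n)) (Aut (Gn n)) (?f n)" for n
    unfolding invariant_fun_def
  proof (intro ballI)
    fix \<gamma> and \<omega> :: "'v \<Rightarrow> int" assume \<gamma>: "\<gamma> \<in> Aut (Gn n)"
    let ?V = "verts (Gn n)"
    have bij: "bij_betw \<gamma> ?V ?V" using \<gamma> by (simp add: Aut_def graph_iso_def)
    \<comment> \<open>The automorphism carries the positive vertices of the pulled back
      configuration onto those of \<open>\<omega>\<close>, so the two counts agree.\<close>
    have "bij_betw \<gamma> {v \<in> ?V. Q n v (spin_pull ?V \<gamma> \<omega>)} {v \<in> ?V. Q n v \<omega>}"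
    proof (rule bij_betw_subset[OF bij, THEN bij_betw_cong[THEN iffD1, rotated]])
      show "\<gamma> ` {v \<in> ?V. Q n v (spin_pull ?V \<gamma> \<omega>)} = {v \<in> ?V. Q n v \<omega>}"
      proof (intro equalityI subsetI)
        fix x assume "x \<in> {v \<in> ?V. Q n v \<omega>}"
        moreover from this obtain y where "y \<in> ?V" "x = \<gamma> y" using bij unfolding bij_betw_def by blast
        ultimately show "x \<in> \<gamma> ` {v \<in> ?V. Q n v (spin_pull ?V \<gamma> \<omega>)}"
          using inv[OF \<gamma>, of y \<omega>] by simp
      qed (use inv[OF \<gamma>] bij in \<open>auto simp: bij_betw_def\<close>)
    qed auto
    then have "card {v \<in> ?V. Q n v (spin_pull ?V \<gamma> \<omega>)} = card {v \<in> ?V. Q n v \<omega>}"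
      by (rule bij_betw_same_card)
    then show "?f n (spin_pull ?V \<gamma> \<omega>) = ?f n \<omega>" by (simp add: majority_def)
  qed
  then show "sparse_reconstruction Gn Pn (\<lambda>n. Aut (Gn n))"
    unfolding sparse_reconstruction_def
    by (intro exI[of _ ?f] exI[of _ "\<lambda>n. ?B n (v n)"] conjI allI gball_verts_subset small liminf)
qed

section \<open>Equivariance of the detector and the connected case\<close>

lemma AutD:
  assumes "\<gamma> \<in> Aut G"
  shows "graph_iso \<gamma> G G" "bij_betw \<gamma> (verts G) (verts G)" "\<gamma> \<in> verts G \<rightarrow> verts G"
  using assms by (auto simp: Aut_def graph_iso_def bij_betw_def)

lemma Aut_inverse:
  assumes wf: "wf_lgraph G" and \<gamma>: "\<gamma> \<in> Aut G"
  obtains \<gamma>' where "\<gamma>' \<in> Aut G" "\<And>x. x \<in> verts G \<Longrightarrow> \<gamma>' (\<gamma> x) = x" "\<And>x. x \<in> verts G \<Longrightarrow> \<gamma> (\<gamma>' x) = x"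
proof
  let ?V = "verts G"
  let ?i = "the_inv_into ?V \<gamma>"
  note iso = AutD[OF \<gamma>]
  have i: "graph_iso ?i G G" by (rule graph_iso_inv[OF wf wf iso(1)])
  have "graph_iso (restrict ?i ?V) G G" by (rule graph_iso_cong[OF wf i]) simp
  then show "restrict ?i ?V \<in> Aut G" by (simp add: Aut_def)
  show "restrict ?i ?V (\<gamma> x) = x" if "x \<in> ?V" for x
    using that iso(2,3) by (auto simp: bij_betw_def the_inv_into_f_f)
  show "\<gamma> (restrict ?i ?V x) = x" if "x \<in> ?V" for x
    using that iso(2) by (auto simp: bij_betw_def f_the_inv_into_f)
qed

lemma rooted_iso_Aut:
  assumes wf: "wf_lgraph H" and \<gamma>: "\<gamma> \<in> Aut H" and v: "v \<in> verts H"
  shows "rooted_iso (gball H R v) v (spin_pull (verts H) \<gamma> \<omega>) (gball H R (\<gamma> v)) (\<gamma> v) \<omega>"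
  unfolding rooted_iso_def
  using graph_iso_gball[OF wf wf AutD(1)[OF \<gamma>] v] gball_verts_subset[of H R v]
  by (intro exI[of _ \<gamma>]) (auto simp: spin_pull_def)

text \<open>Used twice: in the limit graph it moves the detector from the root to any other vertex,
  and in the finite graphs it makes the majority invariant.\<close>

lemma detect_Aut:
  assumes "wf_lgraph G" "\<rho> \<in> verts G" "F \<subseteq> gball_verts G R \<rho>"
    and H: "wf_lgraph H" "\<gamma> \<in> Aut H" "v \<in> verts H"
  shows "detect G \<rho> R F T H v (spin_pull (verts H) \<gamma> \<omega>) \<longleftrightarrow> detect G \<rho> R F T H (\<gamma> v) \<omega>"
  using AutD(3)[OF H(2)] H(3)
  by (intro detect_cong[OF assms(1-3)] rooted_iso_Aut H) auto

text \<open>Invariance of \<open>A\<close> is asked up to null sets because the event found on a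
  component is a level set of a density. Connectedness enters twice: finitely many sites lie in some
  ball around the root, and automorphisms of large balls agree on a smaller ball with automorphisms
  of \<open>G\<close>.\<close>

lemma connected_reconstruction:
  fixes Gn :: "nat \<Rightarrow> ('v, 'l) lgraph" and G :: "('w, 'l) lgraph"
  assumes fs: "\<And>n. finite_spin_system (Gn n) (Pn n)" and exp: "expander_sequence Gn"
    and wf: "wf_lgraph G" and lf: "locally_finite G" and \<rho>: "\<rho> \<in> verts G"
    and trans: "transitive_graph G" and conn: "component G \<rho> = verts G"
    and P: "spin_measure (verts G) P" and inv: "invariant_measure (verts G) (Aut G) P"
    and BS: "BS_converges Gn Pn G P \<rho>"
    and A: "A \<in> sets P" "0 < measure P A" "measure P A < 1"
    and A_inv: "\<And>\<gamma>. \<gamma> \<in> Aut G \<Longrightarrow> measure P (sym_diff A (spin_pull (verts G) \<gamma> -` A \<inter> space P)) = 0"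
  shows "random_sparse_reconstruction Gn Pn" "sparse_reconstruction Gn Pn (\<lambda>n. Aut (Gn n))"
proof -
  note fsD = finite_spin_systemD[OF fs]
  note sp = spin_measure_space[OF P]
  interpret prob_space P by (rule sp)
  let ?V = "verts G" and ?N = "{w. {\<rho>, w} \<in> edges G}"
  obtain D where deg: "\<And>n v. v \<in> verts (Gn n) \<Longrightarrow> finite (incident_edges (Gn n) v) \<and> card (incident_edges (Gn n) v) \<le> D"
    by (rule expander_sequence_degree[OF exp]) (rule that, blast)
  obtain h :: real where h: "h > 0" "\<And>n W. W \<noteq> {} \<Longrightarrow> W \<subseteq> verts (Gn n) \<Longrightarrow>
      real (card W) \<le> real (card (verts (Gn n))) / 2 \<Longrightarrow> real (card (edge_boundary (Gn n) W)) / real (card W) > h"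
    by (rule expander_sequence_expansion[OF exp]) (rule that, assumption, iprover)
  have finN: "finite ?N" using lf \<rho> by (intro card_adjacent_le) (simp add: locally_finite_def)
  define p where "p = measure P A"
  define s where "s = p * (1 - p)"
  \<comment> \<open>If each vertex of the limit detects \<open>A\<close> with error
    \<open>\<epsilon>\<close>, then \<open>k * \<epsilon>\<close> bounds \<open>D / h\<close> times
    the probability of \<open>detect_boundary\<close> at the root: one error for the root and one
    for each neighbour. The choice of \<open>\<epsilon>\<close> makes both \<open>\<epsilon>\<close>
    and \<open>k * \<epsilon>\<close> at most \<open>s / 16\<close>; \<open>1 + k\<close> also
    avoids division by zero.\<close>
  define k where "k = D / h * (card ?N + 1)"
  define \<epsilon> where "\<epsilon> = s / (16 * (1 + k))"
  have s0: "s > 0" using A by (simp add: s_def p_def)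
  have k0: "k \<ge> 0" using h by (simp add: k_def)
  have \<epsilon>0: "\<epsilon> > 0" using s0 k0 by (simp add: \<epsilon>_def)
  have "(1 + k) * \<epsilon> = s / 16" using k0 by (simp add: \<epsilon>_def field_simps)
  then have "\<epsilon> + k * \<epsilon> = s / 16" by (simp add: algebra_simps)
  moreover have "k * \<epsilon> \<ge> 0" using k0 \<epsilon>0 by simp
  ultimately have \<epsilon>: "\<epsilon> \<le> s / 16" "k * \<epsilon> \<le> s / 16" using \<epsilon>0 by linarith+

  obtain F0 S where F0: "finite F0" "F0 \<subseteq> ?V" "cylinder_event ?V F0 S" "measure P (sym_diff A S) < \<epsilon>"
    using cylinder_approximation[OF P A(1) \<epsilon>0] by blast
  have "\<exists>r. F0 \<subseteq> gball_verts G r \<rho>" using F0(1,2)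
  proof (induction F0 rule: finite_induct)
    case (insert x F0)
    then obtain r where r: "F0 \<subseteq> gball_verts G r \<rho>" by auto
    obtain r' where "x \<in> gball_verts G r' \<rho>" using insert(4) conn by (auto simp: component_def)
    then show ?case using r gball_verts_mono[of r "max r r'" G \<rho>] gball_verts_mono[of r' "max r r'" G \<rho>]
      by (intro exI[of _ "max r r'"]) auto
  qed auto
  then obtain r where r: "F0 \<subseteq> gball_verts G r \<rho>" by blast
  define F where "F = gball_verts G r \<rho>"
  have F: "finite F" "F \<subseteq> ?V"
    unfolding F_def by (rule finite_gball_verts[OF wf lf \<rho>], rule gball_verts_subset)
  \<comment> \<open>The approximating event \<open>S\<close> may lack symmetry; the Bayes rule on
    the ball containing its sites is at least as accurate and is invariant under the stabiliser of
    the root.\<close>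
  define T where "T = bayes_set P A F"
  define B where "B = {\<omega> \<in> space P. restrict \<omega> F \<in> T}"
  have "cylinder_event ?V F S" using F0(3) r unfolding F_def by (rule cylinder_event_mono)
  then have B: "measure P (sym_diff A B) < \<epsilon>"
    using le_less_trans[OF bayes_set_optimal[OF P F A(1)] F0(4)] unfolding B_def T_def by blast
  have B_sets: "B \<in> sets P"
    using cylinder_event_sets[OF F cylinder_event_restrict[of ?V F T]] sp by (simp add: B_def)
  obtain R where R: "R \<ge> r" "\<And>\<phi>. graph_iso \<phi> (gball G R \<rho>) (gball G R \<rho>) \<Longrightarrow> \<phi> \<rho> = \<rho> \<Longrightarrow>
    \<exists>\<gamma>\<in>Aut G. \<gamma> \<rho> = \<rho> \<and> (\<forall>x\<in>F. \<gamma> x = \<phi> x)"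
    using ball_automorphisms_extend[OF wf lf \<rho> conn, of r] unfolding F_def by blast
  have FR: "F \<subseteq> gball_verts G R \<rho>" unfolding F_def by (rule gball_verts_mono[OF R(1)])
  let ?det = "\<lambda>v \<omega>. detect G \<rho> R F T G v \<omega>" and ?bd = "\<lambda>v \<omega>. detect_boundary G \<rho> R F T G v \<omega>"

  \<comment> \<open>At the root the detector must not accept more than \<open>T\<close>: every
    isomorphism \<open>\<phi>\<close> that it may use agrees on \<open>F\<close> with an
    automorphism fixing the root, and its inverse \<open>\<gamma>'\<close> preserves
    \<open>T\<close> and undoes \<open>\<phi>\<close>.\<close>
  have det_root: "?det \<rho> \<omega> \<longleftrightarrow> restrict \<omega> F \<in> T" for \<omega>
  proof
    assume "restrict \<omega> F \<in> T"
    moreover have "restrict \<omega> F = (\<lambda>x\<in>F. \<omega> x)" by simp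
    ultimately show "?det \<rho> \<omega>"
      unfolding detect_def using graph_iso_id by (intro exI[of _ "\<lambda>x. x"]) simp
  next
    assume "?det \<rho> \<omega>"
    then obtain \<phi> where \<phi>: "graph_iso \<phi> (gball G R \<rho>) (gball G R \<rho>)" "\<phi> \<rho> = \<rho>" "(\<lambda>x\<in>F. \<omega> (\<phi> x)) \<in> T"
      by (auto simp: detect_def)
    obtain \<gamma> where \<gamma>: "\<gamma> \<in> Aut G" "\<gamma> \<rho> = \<rho>" "\<forall>x\<in>F. \<gamma> x = \<phi> x" using R(2)[OF \<phi>(1,2)] by blast
    obtain \<gamma>' where \<gamma>': "\<gamma>' \<in> Aut G" "\<And>x. x \<in> ?V \<Longrightarrow> \<gamma>' (\<gamma> x) = x" "\<And>x. x \<in> ?V \<Longrightarrow> \<gamma> (\<gamma>' x) = x"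
      using Aut_inverse[OF wf \<gamma>(1)] by blast
    have "\<gamma>' \<rho> = \<rho>" using \<gamma>'(2)[OF \<rho>] \<gamma>(2) by simp
    then have \<gamma>'F: "\<gamma>' ` F = F"
      using gball_verts_iso[OF wf wf AutD(1)[OF \<gamma>'(1)] \<rho>, of r] by (simp add: F_def)
    let ?\<sigma> = "\<lambda>x\<in>F. \<omega> (\<phi> x)"
    have "(\<lambda>x\<in>F. ?\<sigma> (\<gamma>' x)) \<in> T"
      using inv \<gamma>'(1) unfolding T_def invariant_measure_def
      by (intro bayes_set_invariant[OF P F A(1) AutD(3)[OF \<gamma>'(1)] \<gamma>'F _
            A_inv[OF \<gamma>'(1)] \<phi>(3)[unfolded T_def]]) blast
    moreover have "?\<sigma> (\<gamma>' x) = \<omega> x" if x: "x \<in> F" for x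
    proof -
      have "\<gamma>' x \<in> F" using \<gamma>'F x by blast
      moreover from this have "\<phi> (\<gamma>' x) = x" using \<gamma>(3) \<gamma>'(3)[of x] F(2) x by auto
      ultimately show ?thesis by simp
    qed
    then have "(\<lambda>x\<in>F. ?\<sigma> (\<gamma>' x)) = restrict \<omega> F" by (auto simp: fun_eq_iff)
    ultimately show "restrict \<omega> F \<in> T" by simp
  qed

  \<comment> \<open>An automorphism taking the root to \<open>w\<close> preserves \<open>P\<close>
    and, up to a null set, \<open>A\<close>, so every vertex approximates the same event with the
    same error.\<close>
  have det: "{\<omega> \<in> space P. ?det w \<omega>} \<in> sets P" "measure P (sym_diff A {\<omega> \<in> space P. ?det w \<omega>}) < \<epsilon>"
    if w: "w \<in> ?V" for w
  proof -
    obtain \<gamma> where \<gamma>: "\<gamma> \<in> Aut G" "\<gamma> \<rho> = w" using trans \<rho> w unfolding transitive_graph_def by blast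
    let ?p = "\<lambda>X. spin_pull ?V \<gamma> -` X \<inter> space P"
    have "distr P (spin_space ?V) (spin_pull ?V \<gamma>) = P" using inv \<gamma>(1) by (simp add: invariant_measure_def)
    note meas = measurable_spin_pull_measure[OF P AutD(3)[OF \<gamma>(1)]]
      and pull = measure_spin_pull[OF P AutD(3)[OF \<gamma>(1)] this]
    have psets: "?p X \<in> sets P" if "X \<in> sets P" for X using measurable_sets[OF meas] that sp(2) by simp
    have sp_pull: "spin_pull ?V \<gamma> \<omega> \<in> space P" if "\<omega> \<in> space P" for \<omega>
      using measurable_space[OF meas that] sp(1) by simp
    have "?det w \<omega> \<longleftrightarrow> spin_pull ?V \<gamma> \<omega> \<in> B" if "\<omega> \<in> space P" for \<omega>
      using detect_Aut[OF wf \<rho> FR wf \<gamma>(1) \<rho>, of T \<omega>] \<gamma>(2) det_root sp_pull[OF that] by (simp add: B_def)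
    then have eq: "{\<omega> \<in> space P. ?det w \<omega>} = ?p B" by blast
    show "{\<omega> \<in> space P. ?det w \<omega>} \<in> sets P" unfolding eq by (rule psets[OF B_sets])
    have dA: "sym_diff A (?p A) \<in> sets P" using A(1) psets[OF A(1)] by (intro sets.Un sets.Diff)
    have dB: "sym_diff A B \<in> sets P" using A(1) B_sets by (intro sets.Un sets.Diff)
    have "measure P (sym_diff A (?p B)) \<le> measure P (sym_diff A (?p A) \<union> ?p (sym_diff A B))"
      using sets.sets_into_space[OF A(1)] by (intro finite_measure_mono sets.Un[OF dA psets[OF dB]]) blast
    also have "\<dots> \<le> measure P (sym_diff A (?p A)) + measure P (?p (sym_diff A B))"
      by (rule measure_Un_le[OF dA psets[OF dB]])
    also have "\<dots> = measure P (sym_diff A B)" unfolding A_inv[OF \<gamma>(1)] pull[OF dB] by simp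
    finally show "measure P (sym_diff A {\<omega> \<in> space P. ?det w \<omega>}) < \<epsilon>" unfolding eq using B by (rule le_less_trans)
  qed

  have root: "\<bar>measure P {\<omega> \<in> space P. ?det \<rho> \<omega>} - p\<bar> < \<epsilon>"
  proof -
    let ?E = "{\<omega> \<in> space P. ?det \<rho> \<omega>}"
    have "measure P X \<le> measure P Y + measure P (sym_diff A ?E)"
      if "X \<in> sets P" "Y \<in> sets P" "X \<subseteq> Y \<union> sym_diff A ?E" for X Y
    proof -
      have "measure P X \<le> measure P (Y \<union> sym_diff A ?E)"
        using that A(1) det(1)[OF \<rho>] by (intro finite_measure_mono) auto
      also have "\<dots> \<le> measure P Y + measure P (sym_diff A ?E)"
        using that A(1) det(1)[OF \<rho>] by (intro measure_Un_le) auto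
      finally show ?thesis .
    qed
    then have "measure P A \<le> measure P ?E + measure P (sym_diff A ?E)"
      "measure P ?E \<le> measure P A + measure P (sym_diff A ?E)"
      using A(1) det(1)[OF \<rho>] by blast+
    then show ?thesis using det(2)[OF \<rho>] unfolding p_def abs_less_iff by linarith
  qed
  have NV: "w \<in> ?V" if "w \<in> ?N" for w using that wf_edgeD(2)[OF wf] by auto
  \<comment> \<open>If the root detects and a neighbour does not, one of the two is wrong about
    \<open>A\<close>; a union bound over the root and its neighbours follows.\<close>
  have bd: "measure P {\<omega> \<in> space P. ?bd \<rho> \<omega>} \<le> (card ?N + 1) * \<epsilon>"
  proof -
    let ?E = "\<lambda>w. sym_diff A {\<omega> \<in> space P. ?det w \<omega>}"
    have E: "?E w \<in> sets P" if "w \<in> ?V" for w using A(1) det(1)[OF that] by auto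
    then have UN: "(\<Union>w\<in>?N. ?E w) \<in> sets P" using finN NV by (intro sets.finite_UN) auto
    have "measure P {\<omega> \<in> space P. ?bd \<rho> \<omega>} \<le> measure P (?E \<rho> \<union> (\<Union>w\<in>?N. ?E w))"
      by (rule finite_measure_mono[OF _ sets.Un[OF E[OF \<rho>] UN]]) (auto simp: detect_boundary_def)
    also have "\<dots> \<le> measure P (?E \<rho>) + measure P (\<Union>w\<in>?N. ?E w)"
      using E[OF \<rho>] UN by (rule measure_Un_le)
    also have "measure P (\<Union>w\<in>?N. ?E w) \<le> (\<Sum>w\<in>?N. measure P (?E w))"
      using finN E NV by (intro measure_UNION_le) auto
    also have "\<dots> \<le> (\<Sum>w\<in>?N. \<epsilon>)" using det(2) NV by (intro sum_mono less_imp_le) auto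
    finally show ?thesis using det(2)[OF \<rho>] by (simp add: algebra_simps)
  qed

  define Q where "Q n = detect G \<rho> R F T (Gn n)" for n
  have lim1: "(\<lambda>n. vertex_average (Gn n) (Pn n) (Q n)) \<longlonglongrightarrow> measure P {\<omega> \<in> space P. ?det \<rho> \<omega>}"
    unfolding Q_def
    by (rule BS_local_event[OF fs wf lf \<rho> P BS, where R = R])
      (erule detect_cong[OF wf \<rho> FR fsD(1) wf _ \<rho>, rotated], assumption,
       rule detect_cong[OF wf \<rho> FR wf wf \<rho> \<rho>], assumption)
  have lim2: "(\<lambda>n. vertex_average (Gn n) (Pn n) (detect_boundary G \<rho> R F T (Gn n))) \<longlonglongrightarrow> measure P {\<omega> \<in> space P. ?bd \<rho> \<omega>}"
    by (rule BS_local_event[OF fs wf lf \<rho> P BS, where R = "1 + R"])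
      (erule detect_boundary_cong[OF wf \<rho> FR fsD(1) wf _ \<rho>, rotated], assumption,
       rule detect_boundary_cong[OF wf \<rho> FR wf wf \<rho> \<rho>], assumption)
  \<comment> \<open>A distance \<open>s / 16\<close> to the limit plus the error
    \<open>\<epsilon> \<le> s / 16\<close> of the limit itself gives the tolerance
    \<open>s / 8\<close> of \<open>majority_clue\<close>.\<close>
  have ev1: "\<forall>\<^sub>F n in sequentially. dist (vertex_average (Gn n) (Pn n) (Q n)) (measure P {\<omega> \<in> space P. ?det \<rho> \<omega>}) < s / 16"
    using s0 by (intro tendstoD[OF lim1]) simp
  have "D / h * measure P {\<omega> \<in> space P. ?bd \<rho> \<omega>} \<le> D / h * ((card ?N + 1) * \<epsilon>)"
    using bd h by (intro mult_left_mono) auto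
  also have "\<dots> = k * \<epsilon>" by (simp add: k_def)
  finally have "D / h * measure P {\<omega> \<in> space P. ?bd \<rho> \<omega>} < s / 8" using \<epsilon>(2) s0 by linarith
  then have ev2: "\<forall>\<^sub>F n in sequentially. D / h * vertex_average (Gn n) (Pn n) (detect_boundary G \<rho> R F T (Gn n)) < s / 8"
    by (rule order_tendstoD(2)[OF tendsto_mult[OF tendsto_const lim2]])
  have avg: "\<forall>\<^sub>F n in sequentially. (\<Sum>v\<in>verts (Gn n). clue (Pn n) (majority (Gn n) (Q n)) (gball_verts (Gn n) R v))
      / card (verts (Gn n)) \<ge> 5 / 6"
    using ev1 ev2
  proof eventually_elim
    case (elim n)
    have bd_eq: "detect_boundary G \<rho> R F T (Gn n) = (\<lambda>v \<omega>. Q n v \<omega> \<and> (\<exists>w. {v, w} \<in> edges (Gn n) \<and> \<not> Q n w \<omega>))"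
      by (auto simp: fun_eq_iff detect_boundary_def Q_def)
    show ?case
    proof (rule majority_clue[OF fs h(1) deg h(2) gball_verts_subset])
      show "0 < p" "p < 1" using A by (auto simp: p_def)
      show "\<bar>vertex_average (Gn n) (Pn n) (Q n) - p\<bar> \<le> s / 8"
        using elim(1) root \<epsilon>(1) unfolding dist_real_def by linarith
      show "D / h * vertex_average (Gn n) (Pn n) (\<lambda>v \<omega>. Q n v \<omega> \<and> (\<exists>w. {v, w} \<in> edges (Gn n) \<and> \<not> Q n w \<omega>)) \<le> s / 8"
        using elim(2) unfolding bd_eq by simp
      fix v and \<omega> \<omega>' :: "'v \<Rightarrow> int"
      assume "v \<in> verts (Gn n)" "\<forall>x\<in>gball_verts (Gn n) R v. \<omega> x = \<omega>' x"
      moreover from this have "rooted_iso (gball (Gn n) R v) v \<omega> (gball (Gn n) R v) v \<omega>'"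
        unfolding rooted_iso_def by (intro exI[of _ "\<lambda>x. x"]) (simp add: graph_iso_id)
      ultimately show "Q n v \<omega> = Q n v \<omega>'"
        unfolding Q_def using detect_cong[OF wf \<rho> FR fsD(1) fsD(1)] by blast
    qed (simp_all add: s_def)
  qed
  have Q_inv: "Q n v (spin_pull (verts (Gn n)) \<gamma> \<omega>) = Q n (\<gamma> v) \<omega>"
    if "\<gamma> \<in> Aut (Gn n)" "v \<in> verts (Gn n)" for n \<gamma> v \<omega>
    unfolding Q_def using that by (intro detect_Aut[OF wf \<rho> FR fsD(1)])
  show "random_sparse_reconstruction Gn Pn" "sparse_reconstruction Gn Pn (\<lambda>n. Aut (Gn n))"
    by (rule reconstruction_from_balls[OF fs exp avg Q_inv]; assumption)+
qed

section \<open>Components\<close>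

lemma component_subset: "component G v \<subseteq> verts G"
  unfolding component_def using gball_verts_subset by (rule UN_least)

lemma component_centre: "v \<in> verts G \<Longrightarrow> v \<in> component G v"
  unfolding component_def by (auto intro: gball_verts_centre)

lemma gball_verts_component: "gball_verts G R v \<subseteq> component G v"
  unfolding component_def by (rule UN_upper) simp

lemma component_eq:
  assumes "v \<in> verts G" "w \<in> component G v" shows "component G w = component G v"
proof -
  have sub: "component G w \<subseteq> component G v" if w: "w \<in> component G v" for v w
  proof
    fix x assume "x \<in> component G w"
    then obtain R where "x \<in> gball_verts G R w" by (auto simp: component_def)
    moreover obtain k where "w \<in> gball_verts G k v" using w by (auto simp: component_def)
    ultimately show "x \<in> component G v"
      using gball_verts_trans[of w G k v R] gball_verts_component[of G "k + R" v] by auto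
  qed
  moreover have "v \<in> component G w"
    using assms gball_verts_sym[OF assms(1)] by (auto simp: component_def)
  ultimately show ?thesis using assms(2) by blast
qed

lemma component_edge:
  assumes "wf_lgraph G" "{x, y} \<in> edges G" "x \<in> component G v" shows "y \<in> component G v"
proof -
  obtain k where "x \<in> gball_verts G k v" using assms(3) by (auto simp: component_def)
  then have "gball_verts G 1 x \<subseteq> gball_verts G (k + 1) v" by (rule gball_verts_trans)
  then show ?thesis using gball_verts_adj[OF assms(1,2)] gball_verts_component[of G "k + 1" v] by auto
qed

context
  fixes G :: "('w, 'l) lgraph" and v :: 'w and C Gc
  assumes wf: "wf_lgraph G" and v: "v \<in> verts G"
  defines "C \<equiv> component G v" and "Gc \<equiv> induced G C"
begin

lemma wf_component: "wf_lgraph Gc"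
  unfolding Gc_def using component_centre[OF v] by (intro wf_induced[OF wf]) (auto simp: C_def)

lemma gball_component:
  assumes "w \<in> C" shows "gball Gc R w = gball G R w"
  unfolding Gc_def using assms component_subset[of G v, folded C_def] component_eq[OF v, of w] gball_verts_component[of G R w]
  by (intro gball_of_induced[OF wf]) (auto simp: C_def)

lemma component_component: "component Gc v = verts Gc"
proof -
  have "gball_verts Gc R v = gball_verts G R v" for R
    using gball_component[of v R] component_centre[OF v] by (metis C_def verts_gball)
  then show ?thesis by (simp add: component_def C_def Gc_def)
qed

lemma locally_finite_component: "locally_finite G \<Longrightarrow> locally_finite Gc"
proof -
  have "incident_edges Gc x \<subseteq> incident_edges G x" for x by (auto simp: incident_edges_def Gc_def)
  then show "locally_finite G \<Longrightarrow> locally_finite Gc"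
    using component_subset[of G v, folded C_def] finite_subset unfolding locally_finite_def Gc_def by fastforce
qed

text \<open>An automorphism of \<open>G\<close> taking \<open>x\<close> to \<open>y\<close> maps the
  component of \<open>x\<close> onto that of \<open>y\<close>; both are \<open>C\<close>, so it
  restricts to an automorphism of the component.\<close>

lemma transitive_component:
  assumes "transitive_graph G" shows "transitive_graph Gc"
  unfolding transitive_graph_def
proof (intro ballI)
  fix x y assume xy: "x \<in> verts Gc" "y \<in> verts Gc"
  then have V: "x \<in> verts G" "y \<in> verts G" using component_subset[of G v, folded C_def] by (auto simp: Gc_def)
  obtain \<gamma> where \<gamma>: "\<gamma> \<in> Aut G" "\<gamma> x = y" using assms V unfolding transitive_graph_def by blast
  have iso: "graph_iso \<gamma> G G" using \<gamma>(1) by (simp add: Aut_def)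
  have "\<gamma> ` component G x = component G y"
    using gball_verts_iso[OF wf wf iso V(1)] \<gamma>(2) by (simp add: component_def image_UN)
  then have "\<gamma> ` C = C"
    using xy component_eq[OF v, of x] component_eq[OF v, of y] by (simp add: Gc_def C_def)
  then have "graph_iso \<gamma> Gc Gc" using graph_iso_induced[OF iso component_subset[of G v, folded C_def]] by (simp add: Gc_def)
  then have "graph_iso (restrict \<gamma> C) Gc Gc"
    by (rule graph_iso_cong[OF wf_component]) (simp add: Gc_def)
  then have "restrict \<gamma> C \<in> Aut Gc" by (simp add: Aut_def Gc_def)
  then show "\<exists>\<gamma>\<in>Aut Gc. \<gamma> x = y" using \<gamma>(2) xy by (intro bexI[of _ "restrict \<gamma> C"]) (auto simp: Gc_def)
qed

text \<open>Moves one component and fixes the rest of the graph pointwise; this freedom to act on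
  components separately is what yields independence.\<close>

definition extend :: "('w \<Rightarrow> 'w) \<Rightarrow> 'w \<Rightarrow> 'w" where
  "extend \<gamma> = (\<lambda>x\<in>verts G. if x \<in> C then \<gamma> x else x)"

text \<open>No edge joins \<open>C\<close> to its complement, so an automorphism of the component
  and the identity outside fit together.\<close>

lemma extend_Aut:
  assumes "\<gamma> \<in> Aut Gc" shows "extend \<gamma> \<in> Aut G"
proof -
  have iso: "graph_iso \<gamma> Gc Gc" using assms by (simp add: Aut_def)
  note isoD = graph_isoD[OF iso]
  have \<gamma>C: "\<gamma> x \<in> C" if "x \<in> C" for x using isoD(2) that by (auto simp: Gc_def)
  have \<gamma>C': "\<exists>y\<in>C. x = \<gamma> y" if "x \<in> C" for x using isoD(2) that by (auto simp: Gc_def)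
  have in_C: "x \<in> verts G" if "x \<in> C" for x using that component_subset[of G v, folded C_def] by auto
  have edge_C: "x \<in> C \<longleftrightarrow> y \<in> C" if "{x, y} \<in> edges G" for x y
    using component_edge[OF wf, of x y v] component_edge[OF wf, of y x v] that
    by (auto simp: C_def insert_commute)
  have "inj_on (extend \<gamma>) (verts G)"
    using isoD(1) \<gamma>C by (auto simp: inj_on_def extend_def Gc_def)
  moreover have "extend \<gamma> ` verts G = verts G"
  proof (intro equalityI subsetI)
    fix x assume x: "x \<in> verts G"
    show "x \<in> extend \<gamma> ` verts G"
    proof (cases "x \<in> C")
      case True
      then obtain y where "y \<in> C" "x = \<gamma> y" using \<gamma>C' by blast
      then show ?thesis using in_C by (intro image_eqI[of _ _ y]) (auto simp: extend_def)
    qed (use x in \<open>auto simp: extend_def intro!: image_eqI[of _ _ x]\<close>)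
  qed (auto simp: extend_def in_C \<gamma>C)
  moreover have "{extend \<gamma> x, extend \<gamma> y} \<in> edges G \<longleftrightarrow> {x, y} \<in> edges G"
    if xy: "x \<in> verts G" "y \<in> verts G" for x y
  proof (cases "x \<in> C \<longleftrightarrow> y \<in> C")
    case True
    show ?thesis
    proof (cases "x \<in> C")
      case True
      then show ?thesis using xy \<open>x \<in> C \<longleftrightarrow> y \<in> C\<close> isoD(3)[of x y] \<gamma>C[of x] \<gamma>C[of y]
        by (simp add: extend_def Gc_def)
    qed (use xy \<open>x \<in> C \<longleftrightarrow> y \<in> C\<close> in \<open>simp add: extend_def\<close>)
  next
    case False
    then have "extend \<gamma> x \<in> C \<longleftrightarrow> extend \<gamma> y \<notin> C" using xy \<gamma>C by (auto simp: extend_def)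
    then show ?thesis using edge_C[of x y] edge_C[of "extend \<gamma> x" "extend \<gamma> y"] False by blast
  qed
  moreover have "elabel G (extend \<gamma> ` e) = elabel G e" if e: "e \<in> edges G" for e
  proof -
    obtain x y where xy: "e = {x, y}" "x \<in> verts G" "y \<in> verts G" using wf e by (rule wf_edge_cases)
    show ?thesis
    proof (cases "x \<in> C")
      case True
      then have "y \<in> C" using edge_C xy e by blast
      then show ?thesis using isoD(4)[of e] True xy e by (simp add: extend_def Gc_def)
    next
      case False
      then have "y \<notin> C" using edge_C xy e by blast
      then show ?thesis using False xy by (simp add: extend_def)
    qed
  qed
  ultimately have "graph_iso (extend \<gamma>) G G" by (auto simp: graph_iso_def bij_betw_def)
  then show ?thesis by (simp add: Aut_def extend_def)
qed

lemma spin_pull_extend: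
  assumes "\<gamma> \<in> Aut Gc"
  shows "restrict (spin_pull (verts G) (extend \<gamma>) \<omega>) C = spin_pull C \<gamma> (restrict \<omega> C)"
proof -
  have "\<gamma> x \<in> C" if "x \<in> C" for x
    using assms that by (auto simp: Aut_def graph_iso_def bij_betw_def Gc_def)
  then show ?thesis using component_subset[of G v, folded C_def] by (auto simp: fun_eq_iff spin_pull_def extend_def)
qed

lemma spin_pull_extend_outside:
  "x \<in> verts G - C \<Longrightarrow> spin_pull (verts G) (extend \<gamma>) \<omega> x = \<omega> x"
  by (simp add: spin_pull_def extend_def)

end

section \<open>Disconnected limits\<close>

lemma emeasure_density_indicator:
  assumes "A \<in> sets M" "X \<in> sets M"
  shows "emeasure (density M (indicator A)) X = emeasure M (A \<inter> X)"
proof -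
  have "emeasure (density M (indicator A)) X = (\<integral>\<^sup>+ \<omega>. indicator A \<omega> * indicator X \<omega> \<partial>M)"
    using assms by (intro emeasure_density) auto
  also have "\<dots> = (\<integral>\<^sup>+ \<omega>. indicator (A \<inter> X) \<omega> \<partial>M)"
    by (intro nn_integral_cong) (auto simp: indicator_def)
  also have "\<dots> = emeasure M (A \<inter> X)" using assms by (intro nn_integral_indicator) auto
  finally show ?thesis .
qed

text \<open>The set is where the density of \<open>N\<close> with respect to \<open>M\<close>
  exceeds \<open>t\<close>. The strict inequality on its subsets of positive measure determines it
  up to null sets, which later makes it almost invariant.\<close>

lemma strict_Hahn_set:
  assumes M: "finite_measure M" and N: "finite_measure N" and sets: "sets N = sets M"
    and ac: "absolutely_continuous M N"
  obtains Y where "Y \<in> sets M"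
    "\<And>E. E \<in> sets M \<Longrightarrow> E \<subseteq> Y \<Longrightarrow> measure M E > 0 \<Longrightarrow> measure N E > t * measure M E"
    "\<And>E. E \<in> sets M \<Longrightarrow> E \<inter> Y = {} \<Longrightarrow> measure N E \<le> t * measure M E"
proof -
  interpret M: finite_measure M by (rule M)
  interpret N: finite_measure N by (rule N)
  obtain D where D: "D \<in> borel_measurable M" "AE x in M. RN_deriv M N x = ennreal (D x)" "\<And>x. 0 \<le> D x"
    using M.real_RN_deriv[OF N ac sets] by metis
  have "N = density M (RN_deriv M N)" using M.density_RN_deriv[OF ac sets] by simp
  also have "\<dots> = density M (\<lambda>x. ennreal (D x))" using D by (intro density_cong) auto
  finally have Nd: "N = density M (\<lambda>x. ennreal (D x))" .
  have nn: "AE x in M. 0 \<le> D x" using D(3) by simp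
  have "integrable N (\<lambda>x. 1 :: real)" by simp
  then have intD: "integrable M D"
    unfolding Nd using integrable_density[OF _ D(1) nn, of "\<lambda>_. 1 :: real"] by simp
  let ?g = "\<lambda>E x. (D x - t) * indicator E x"
  have int: "integrable M (?g E)" and diff: "(\<integral>x. ?g E x \<partial>M) = measure N E - t * measure M E"
    if E: "E \<in> sets M" for E
  proof -
    have iD: "integrable M (\<lambda>x. D x * indicator E x)" using integrable_real_mult_indicator[OF E intD] .
    have iE: "integrable M (\<lambda>x. t * indicator E x)"
      using E by (intro integrable_mult_right integrable_real_indicator) (auto simp: M.emeasure_eq_measure)
    have eq: "?g E = (\<lambda>x. D x * indicator E x - t * indicator E x)" by (auto simp: algebra_simps)
    show "integrable M (?g E)" unfolding eq using iD iE by simp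
    have "measure N E = (\<integral>x. indicator E x \<partial>N)" using E sets by simp
    also have "\<dots> = (\<integral>x. D x * indicator E x \<partial>M)"
      unfolding Nd using E by (subst integral_density[OF _ D(1) nn]) auto
    finally show "(\<integral>x. ?g E x \<partial>M) = measure N E - t * measure M E"
      unfolding eq using iD iE E by simp
  qed
  show ?thesis
  proof
    let ?Y = "{x \<in> space M. D x > t}"
    show "?Y \<in> sets M" using D(1) by simp
    show "measure N E \<le> t * measure M E" if E: "E \<in> sets M" "E \<inter> ?Y = {}" for E
    proof -
      have "(\<integral>x. ?g E x \<partial>M) \<le> (\<integral>x. 0 \<partial>M)"
        using E sets.sets_into_space[OF E(1)] int[OF E(1)]
        by (intro integral_mono) (auto simp: indicator_def not_less)
      then show ?thesis using diff[OF E(1)] by simp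
    qed
    show "measure N E > t * measure M E" if E: "E \<in> sets M" "E \<subseteq> ?Y" "measure M E > 0" for E
    proof -
      have pos: "0 \<le> ?g E x" for x using E(2) by (auto simp: indicator_def)
      have "\<not> (AE x in M. ?g E x = 0)"
      proof
        assume "AE x in M. ?g E x = 0"
        then have "AE x in M. x \<notin> E" by eventually_elim (use E(2) in \<open>auto simp: indicator_def split: if_splits\<close>)
        then have "measure M E = 0" using E(1) by (simp add: AE_iff_measurable[OF _ refl] M.emeasure_eq_measure sets.sets_into_space[THEN Int_absorb1, OF E(1)] Int_def[symmetric])
        then show False using E(3) by simp
      qed
      then have "(\<integral>x. ?g E x \<partial>M) \<noteq> 0"
        using integral_nonneg_eq_0_iff_AE[OF int[OF E(1)]] pos by auto
      moreover have "(\<integral>x. ?g E x \<partial>M) \<ge> 0" using pos by (rule Bochner_Integration.integral_nonneg)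
      ultimately show ?thesis using diff[OF E(1)] by simp
    qed
  qed
qed

section \<open>Marginals on components and independence\<close>

definition marginal :: "('v \<Rightarrow> int) measure \<Rightarrow> 'v set \<Rightarrow> ('v \<Rightarrow> int) measure" where
  "marginal P C = distr P (spin_space C) (\<lambda>\<omega>. restrict \<omega> C)"

lemma measurable_restrict_spin:
  assumes "spin_measure V P" "C \<subseteq> V" shows "(\<lambda>\<omega>. restrict \<omega> C) \<in> P \<rightarrow>\<^sub>M spin_space C"
  using measurable_spin_restrict[OF assms(2)] spin_measure_space(2)[OF assms(1)] measurable_cong_sets by blast

lemma marginal_spin_measure:
  assumes "spin_measure V P" "C \<subseteq> V" shows "spin_measure C (marginal P C)"
  unfolding spin_measure_def marginal_def
  using prob_space.prob_space_distr[OF spin_measure_space(3)[OF assms(1)] measurable_restrict_spin[OF assms]] by simp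

lemma measure_marginal:
  assumes "spin_measure V P" "C \<subseteq> V" "E \<in> sets (spin_space C)"
  shows "measure (marginal P C) E = measure P ((\<lambda>\<omega>. restrict \<omega> C) -` E \<inter> space P)"
  unfolding marginal_def using measurable_restrict_spin[OF assms(1,2)] assms(3) by (rule measure_distr)

context
  fixes G :: "('w, 'l) lgraph" and P and v :: 'w and C Gc
  assumes wf: "wf_lgraph G" and v: "v \<in> verts G"
    and P: "spin_measure (verts G) P" and inv: "invariant_measure (verts G) (Aut G) P"
  defines "C \<equiv> component G v" and "Gc \<equiv> induced G C"
begin

lemma extend_measurable:
  assumes "\<gamma> \<in> Aut Gc"
  shows "spin_pull (verts G) (extend G v \<gamma>) \<in> P \<rightarrow>\<^sub>M spin_space (verts G)"
    "\<And>X. X \<in> sets P \<Longrightarrow> measure P (spin_pull (verts G) (extend G v \<gamma>) -` X \<inter> space P) = measure P X"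
proof -
  have A: "extend G v \<gamma> \<in> Aut G" using extend_Aut[OF wf v] assms by (simp add: C_def Gc_def)
  show "spin_pull (verts G) (extend G v \<gamma>) \<in> P \<rightarrow>\<^sub>M spin_space (verts G)"
    by (rule measurable_spin_pull_measure[OF P AutD(3)[OF A]])
  show "measure P (spin_pull (verts G) (extend G v \<gamma>) -` X \<inter> space P) = measure P X" if "X \<in> sets P" for X
    using inv A that by (intro measure_spin_pull[OF P AutD(3)[OF A]]) (auto simp: invariant_measure_def)
qed

lemma restrict_extend:
  "\<gamma> \<in> Aut Gc \<Longrightarrow> restrict (spin_pull (verts G) (extend G v \<gamma>) \<omega>) C = spin_pull C \<gamma> (restrict \<omega> C)"
  unfolding C_def Gc_def by (rule spin_pull_extend[OF wf v])

text \<open>Restriction to \<open>C\<close> intertwines an automorphism of the component with its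
  extension to \<open>G\<close>, under which \<open>P\<close> is invariant.\<close>

lemma marginal_invariant: "invariant_measure (verts Gc) (Aut Gc) (marginal P C)"
  unfolding invariant_measure_def
proof
  fix \<gamma> assume \<gamma>: "\<gamma> \<in> Aut Gc"
  have VC: "verts Gc = C" by (simp add: Gc_def)
  have r: "(\<lambda>\<omega>. restrict \<omega> C) \<in> P \<rightarrow>\<^sub>M spin_space C" by (rule measurable_restrict_spin[OF P component_subset[of G v, folded C_def]])
  have p: "spin_pull C \<gamma> \<in> spin_space C \<rightarrow>\<^sub>M spin_space C"
    using AutD(3)[OF \<gamma>] VC by (intro measurable_spin_pull) simp
  have "distr (marginal P C) (spin_space C) (spin_pull C \<gamma>)
      = distr P (spin_space C) (spin_pull C \<gamma> \<circ> (\<lambda>\<omega>. restrict \<omega> C))"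
    unfolding marginal_def by (rule distr_distr[OF p r])
  also have "spin_pull C \<gamma> \<circ> (\<lambda>\<omega>. restrict \<omega> C) = (\<lambda>\<omega>. restrict \<omega> C) \<circ> spin_pull (verts G) (extend G v \<gamma>)"
    using restrict_extend[OF \<gamma>] by (auto simp: fun_eq_iff)
  also have "distr P (spin_space C) \<dots>
      = distr (distr P (spin_space (verts G)) (spin_pull (verts G) (extend G v \<gamma>))) (spin_space C) (\<lambda>\<omega>. restrict \<omega> C)"
    by (rule distr_distr[OF measurable_spin_restrict[OF component_subset[of G v, folded C_def]] extend_measurable(1)[OF \<gamma>], symmetric])
  also have "distr P (spin_space (verts G)) (spin_pull (verts G) (extend G v \<gamma>)) = P"
    using inv extend_Aut[OF wf v, of \<gamma>] \<gamma> unfolding invariant_measure_def C_def Gc_def by blast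
  also have "distr P (spin_space C) (\<lambda>\<omega>. restrict \<omega> C) = marginal P C" by (simp only: marginal_def)
  finally show "distr (marginal P C) (spin_space (verts Gc)) (spin_pull (verts Gc) \<gamma>) = marginal P C"
    unfolding VC .
qed

text \<open>
  The density on \<open>C\<close> of the measure \<open>E \<mapsto> P (H \<inter> E)\<close> is invariant almost surely, so it is
  constant when the marginal on \<open>C\<close> is ergodic; \<open>Y\<close> is the set where it exceeds its mean.
\<close>

lemma component_independent:
  assumes erg: "\<And>Y. Y \<in> sets (spin_space C) \<Longrightarrow>
      (\<And>\<gamma>. \<gamma> \<in> Aut Gc \<Longrightarrow> measure (marginal P C) (sym_diff Y (spin_pull C \<gamma> -` Y \<inter> space (marginal P C))) = 0) \<Longrightarrow>
      measure (marginal P C) Y = 0 \<or> measure (marginal P C) Y = 1"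
    and H: "H \<in> sets P"
    and H_inv: "\<And>\<gamma>. \<gamma> \<in> Aut Gc \<Longrightarrow> spin_pull (verts G) (extend G v \<gamma>) -` H \<inter> space P = H"
    and E: "E \<in> sets (spin_space C)"
  shows "measure P (H \<inter> (\<lambda>\<omega>. restrict \<omega> C) -` E) = measure P H * measure (marginal P C) E"
proof -
  note sp = spin_measure_space[OF P]
  interpret P: prob_space P by (rule sp)
  let ?\<nu> = "marginal P C" and ?r = "\<lambda>\<omega>. restrict \<omega> C"
  note \<nu> = spin_measure_space[OF marginal_spin_measure[OF P component_subset[of G v, folded C_def]]]
  interpret \<nu>: prob_space ?\<nu> by (rule \<nu>(3))
  note r = measurable_restrict_spin[OF P component_subset[of G v, folded C_def]]
  note \<nu>_eq = measure_marginal[OF P component_subset[of G v, folded C_def]]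
  have rsets: "?r -` E \<inter> space P \<in> sets P" if "E \<in> sets (spin_space C)" for E
    by (rule measurable_sets[OF r that])
  have Hsub: "H \<subseteq> space P" by (rule sets.sets_into_space[OF H])
  have HE: "H \<inter> ?r -` E \<in> sets P" if "E \<in> sets (spin_space C)" for E
  proof -
    have "H \<inter> ?r -` E = H \<inter> (?r -` E \<inter> space P)" using Hsub by blast
    then show ?thesis using H rsets[OF that] by simp
  qed
  \<comment> \<open>The law of the spins on \<open>C\<close> restricted to the event
    \<open>H\<close>; the claim is that it equals \<open>P(H)\<close> times the marginal.\<close>
  define \<kappa> where "\<kappa> = distr (density P (indicator H)) (spin_space C) ?r"
  have r': "?r \<in> density P (indicator H) \<rightarrow>\<^sub>M spin_space C" using r by simp
  have \<kappa>_em: "emeasure \<kappa> E = emeasure P (H \<inter> ?r -` E)" if "E \<in> sets (spin_space C)" for E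
  proof -
    have "emeasure \<kappa> E = emeasure (density P (indicator H)) (?r -` E \<inter> space P)"
      unfolding \<kappa>_def by (subst emeasure_distr[OF r' that]) simp
    also have "\<dots> = emeasure P (H \<inter> (?r -` E \<inter> space P))"
      by (rule emeasure_density_indicator[OF H rsets[OF that]])
    also have "H \<inter> (?r -` E \<inter> space P) = H \<inter> ?r -` E" using Hsub by blast
    finally show ?thesis .
  qed
  have \<kappa>: "measure \<kappa> E = measure P (H \<inter> ?r -` E)" if "E \<in> sets (spin_space C)" for E
    unfolding measure_def \<kappa>_em[OF that] ..
  have sets_\<kappa>: "sets \<kappa> = sets ?\<nu>" by (simp add: \<kappa>_def \<nu>(2))
  have le: "measure \<kappa> E \<le> measure ?\<nu> E" if "E \<in> sets (spin_space C)" for E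
    unfolding \<kappa>[OF that] \<nu>_eq[OF that] using Hsub rsets[OF that] by (intro P.finite_measure_mono) auto
  have fin: "finite_measure \<kappa>"
  proof
    have "space \<kappa> \<in> sets (spin_space C)" using sets_\<kappa> \<nu>(2) sets.top by blast
    then show "emeasure \<kappa> (space \<kappa>) \<noteq> \<infinity>" by (simp add: \<kappa>_em P.emeasure_eq_measure)
  qed
  interpret \<kappa>: finite_measure \<kappa> by (rule fin)
  have ac: "absolutely_continuous ?\<nu> \<kappa>"
    unfolding absolutely_continuous_def
  proof
    fix E assume "E \<in> null_sets ?\<nu>"
    then have E: "E \<in> sets (spin_space C)" "measure ?\<nu> E = 0"
      using \<nu>(2) by (auto simp: null_sets_def measure_def)
    then have "measure \<kappa> E = 0" using le[OF E(1)] by (simp add: measure_le_0_iff)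
    then show "E \<in> null_sets \<kappa>" using E sets_\<kappa> \<nu>(2) by (auto simp: null_sets_def \<kappa>.emeasure_eq_measure)
  qed
  define t where "t = measure P H"
  obtain Y where Y: "Y \<in> sets ?\<nu>"
    "\<And>E. E \<in> sets ?\<nu> \<Longrightarrow> E \<subseteq> Y \<Longrightarrow> measure ?\<nu> E > 0 \<Longrightarrow> measure \<kappa> E > t * measure ?\<nu> E"
    "\<And>E. E \<in> sets ?\<nu> \<Longrightarrow> E \<inter> Y = {} \<Longrightarrow> measure \<kappa> E \<le> t * measure ?\<nu> E"
    using strict_Hahn_set[OF \<nu>.finite_measure_axioms fin sets_\<kappa> ac] by blast
  have top: "space ?\<nu> \<in> sets (spin_space C)" using \<nu>(2) sets.top by blast
  have \<kappa>_top: "measure \<kappa> (space ?\<nu>) = t"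
  proof -
    have "H \<inter> ?r -` space ?\<nu> = H" using measurable_space[OF r] Hsub \<nu>(1) by auto
    then show ?thesis using \<kappa>[OF top] by (simp add: t_def)
  qed
  have Y01: "measure ?\<nu> Y = 0 \<or> measure ?\<nu> Y = 1"
  proof (rule erg)
    show YC: "Y \<in> sets (spin_space C)" using Y(1) \<nu>(2) by simp
    fix \<gamma> assume \<gamma>: "\<gamma> \<in> Aut Gc"
    let ?p = "spin_pull C \<gamma>" and ?q = "spin_pull (verts G) (extend G v \<gamma>)"
    let ?pY = "?p -` Y \<inter> space ?\<nu>"
    have p: "?p \<in> ?\<nu> \<rightarrow>\<^sub>M spin_space C"
      using AutD(3)[OF \<gamma>] \<nu>(2) measurable_spin_pull[of \<gamma> C] measurable_cong_sets
      by (metis Gc_def induced_simps(1))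
    have pY: "?pY \<in> sets (spin_space C)" using measurable_sets[OF p YC] \<nu>(2) by simp
    have qr: "?q -` (?r -` E) \<inter> space P = ?r -` (?p -` E \<inter> space ?\<nu>) \<inter> space P" for E
      using restrict_extend[OF \<gamma>] measurable_space[OF r] \<nu>(1) by auto
    have "measure ?\<nu> ?pY = measure P (?q -` (?r -` Y \<inter> space P) \<inter> space P)"
    proof -
      have "?q \<omega> \<in> space P" if "\<omega> \<in> space P" for \<omega>
        using measurable_space[OF extend_measurable(1)[OF \<gamma>] that] sp(1) by simp
      then have "?q -` (?r -` Y \<inter> space P) \<inter> space P = ?r -` ?pY \<inter> space P"
        unfolding qr[of Y, symmetric] by blast
      then show ?thesis unfolding \<nu>_eq[OF pY] by simp
    qed
    also have "\<dots> = measure ?\<nu> Y"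
      unfolding \<nu>_eq[OF YC] by (rule extend_measurable(2)[OF \<gamma> rsets[OF YC]])
    finally have \<nu>Y: "measure ?\<nu> ?pY = measure ?\<nu> Y" .
    have "measure \<kappa> ?pY = measure P (?q -` (H \<inter> ?r -` Y) \<inter> space P)"
    proof -
      have "?q -` (H \<inter> ?r -` Y) \<inter> space P = H \<inter> ?r -` ?pY"
        using qr[of Y] H_inv[OF \<gamma>] Hsub by blast
      then show ?thesis unfolding \<kappa>[OF pY] by simp
    qed
    also have "\<dots> = measure \<kappa> Y"
      unfolding \<kappa>[OF YC] by (rule extend_measurable(2)[OF \<gamma> HE[OF YC]])
    finally have \<kappa>Y: "measure \<kappa> ?pY = measure \<kappa> Y" .
    have s: "Y - ?pY \<in> sets ?\<nu>" "?pY - Y \<in> sets ?\<nu>" "Y \<in> sets ?\<nu>" "?pY \<in> sets ?\<nu>"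
      using YC pY \<nu>(2) by auto
    have \<nu>d: "measure ?\<nu> (Y - ?pY) = measure ?\<nu> (?pY - Y)"
      using \<nu>.finite_measure_Diff'[OF s(3,4)] \<nu>.finite_measure_Diff'[OF s(4,3)] \<nu>Y by (simp add: Int_commute)
    have \<kappa>d: "measure \<kappa> (Y - ?pY) = measure \<kappa> (?pY - Y)"
      using \<kappa>.finite_measure_Diff'[of Y ?pY] \<kappa>.finite_measure_Diff'[of ?pY Y] s sets_\<kappa> \<kappa>Y
      by (simp add: Int_commute)
    \<comment> \<open>The two halves of the symmetric difference have equal mass under both
      measures. If it were positive under the marginal, the ratio would exceed \<open>t\<close> on
      \<open>Y - ?pY\<close> but not on \<open>?pY - Y\<close>.\<close>
    have "measure \<kappa> (?pY - Y) \<le> t * measure ?\<nu> (?pY - Y)" by (intro Y(3) s(2)) auto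
    then have "\<not> measure ?\<nu> (Y - ?pY) > 0" using Y(2)[OF s(1)] \<nu>d \<kappa>d by auto
    then have z: "measure ?\<nu> (Y - ?pY) = 0" using measure_nonneg[of ?\<nu> "Y - ?pY"] by linarith
    have "measure ?\<nu> (sym_diff Y ?pY) \<le> measure ?\<nu> (Y - ?pY) + measure ?\<nu> (?pY - Y)"
      using s by (intro measure_Un_le)
    then show "measure ?\<nu> (sym_diff Y ?pY) = 0" using z \<nu>d by (simp add: measure_le_0_iff)
  qed
  \<comment> \<open>If \<open>Y\<close> had full measure, \<open>\<kappa>\<close> would give it more
    than its total mass \<open>t\<close>.\<close>
  have Y0: "measure ?\<nu> Y = 0"
  proof (rule ccontr)
    assume "measure ?\<nu> Y \<noteq> 0"
    then have "measure \<kappa> Y > t" using Y01 Y(2)[OF Y(1)] by simp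
    moreover have "measure \<kappa> Y \<le> measure \<kappa> (space ?\<nu>)"
      using sets.sets_into_space[OF Y(1)] top sets_\<kappa> \<nu>(2) by (intro \<kappa>.finite_measure_mono) auto
    ultimately show False using \<kappa>_top by simp
  qed
  have upper: "measure \<kappa> E \<le> t * measure ?\<nu> E" if E: "E \<in> sets ?\<nu>" for E
  proof -
    have "measure \<kappa> E \<le> measure \<kappa> ((E - Y) \<union> Y)"
      using E Y(1) sets_\<kappa> by (intro \<kappa>.finite_measure_mono) auto
    also have "\<dots> \<le> measure \<kappa> (E - Y) + measure \<kappa> Y" using E Y(1) sets_\<kappa> by (intro measure_Un_le) auto
    also have "measure \<kappa> Y = 0" using le[of Y] Y(1) \<nu>(2) Y0 by (simp add: measure_le_0_iff)
    also have "measure \<kappa> (E - Y) \<le> t * measure ?\<nu> (E - Y)" using E Y(1) by (intro Y(3)) auto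
    also have "\<dots> \<le> t * measure ?\<nu> E"
      using E Y(1) by (intro mult_left_mono \<nu>.finite_measure_mono) (auto simp: t_def)
    finally show ?thesis by simp
  qed
  have E': "E \<in> sets ?\<nu>" using E \<nu>(2) by simp
  \<comment> \<open>The total masses of \<open>\<kappa>\<close> and of \<open>t\<close> times the
    marginal agree, so the upper bound for the complement is a lower bound for
    \<open>E\<close>.\<close>
  have "measure \<kappa> (space ?\<nu> - E) = t - measure \<kappa> E"
    using \<kappa>.finite_measure_Diff[of "space ?\<nu>" E] E' top sets_\<kappa> \<nu>(2) sets.sets_into_space[OF E'] \<kappa>_top by simp
  moreover have "measure ?\<nu> (space ?\<nu> - E) = 1 - measure ?\<nu> E" by (rule \<nu>.prob_compl[OF E'])
  moreover have "measure \<kappa> (space ?\<nu> - E) \<le> t * measure ?\<nu> (space ?\<nu> - E)" using E' by (intro upper) auto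
  ultimately have "t - measure \<kappa> E \<le> t * (1 - measure ?\<nu> E)" by (simp only:)
  then have "t * measure ?\<nu> E \<le> measure \<kappa> E" by (simp add: right_diff_distrib)
  then have "measure \<kappa> E = t * measure ?\<nu> E" using upper[OF E'] by simp
  then show ?thesis unfolding \<kappa>[OF E] t_def .
qed

end

text \<open>Induction on the sites of a cylinder: those lying in one component are split off
  together, and \<open>component_independent\<close> contributes the same factor with and without
  \<open>A\<close>. The invariant event is thus independent of all cylinders.\<close>

lemma ergodic_of_components:
  fixes G :: "('w, 'l) lgraph"
  assumes wf: "wf_lgraph G" and P: "spin_measure (verts G) P"
    and inv: "invariant_measure (verts G) (Aut G) P"
    and erg: "\<And>v Y. v \<in> verts G \<Longrightarrow> Y \<in> sets (spin_space (component G v)) \<Longrightarrow>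
      (\<And>\<gamma>. \<gamma> \<in> Aut (induced G (component G v)) \<Longrightarrow>
        measure (marginal P (component G v))
          (sym_diff Y (spin_pull (component G v) \<gamma> -` Y \<inter> space (marginal P (component G v)))) = 0) \<Longrightarrow>
      measure (marginal P (component G v)) Y = 0 \<or> measure (marginal P (component G v)) Y = 1"
  shows "ergodic (verts G) (Aut G) P"
  unfolding ergodic_def
proof (intro allI impI)
  fix A assume A_inv: "invariant_event (verts G) (Aut G) A"
  let ?V = "verts G"
  note sp = spin_measure_space[OF P]
  interpret prob_space P by (rule sp)
  have A: "A \<in> sets P" using A_inv sp(2) by (simp add: invariant_event_def)
  define cyl where "cyl J S = {\<omega> \<in> space P. \<forall>j\<in>J. \<omega> j \<in> S j}" for J :: "'w set" and S
  have cyl_event: "cylinder_event ?V J (cyl J S)" for J S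
    unfolding cylinder_event_def cyl_def sp(1) by auto
  have cyl_sets: "cyl J S \<in> sets P" if "finite J" "J \<subseteq> ?V" for J S
    using cylinder_event_sets[OF that cyl_event] sp(2) by simp
  have indep: "measure P (A \<inter> cyl J S) = measure P A * measure P (cyl J S)"
    if "finite J" "J \<subseteq> ?V" for J S
    using that
  proof (induction J rule: finite_psubset_induct)
    case (psubset J)
    show ?case
    proof (cases "J = {}")
      case True
      have "cyl {} S = space P" by (simp add: cyl_def)
      then show ?thesis using True sets.sets_into_space[OF A] by (simp add: prob_space Int_absorb2)
    next
      case False
      then obtain j where j: "j \<in> J" by blast
      define C where "C = component G j"
      have jV: "j \<in> ?V" using j psubset.prems by blast
      have CV: "C \<subseteq> ?V" unfolding C_def by (rule component_subset)
      have jC: "j \<in> C" unfolding C_def by (rule component_centre[OF jV])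
      let ?r = "\<lambda>\<omega>. restrict \<omega> C"
      define E where "E = {\<tau> \<in> C \<rightarrow>\<^sub>E {-1, 1::int}. \<forall>i\<in>J \<inter> C. \<tau> i \<in> S i}"
      have "cylinder_event C (J \<inter> C) E" unfolding cylinder_event_def E_def by auto
      then have E: "E \<in> sets (spin_space C)" using psubset.hyps by (intro cylinder_event_sets) auto
      have J2: "finite (J - C)" "J - C \<subseteq> ?V" "J - C \<subset> J" using psubset j jC by auto
      have "restrict \<omega> C \<in> C \<rightarrow>\<^sub>E {-1, 1}" if "\<omega> \<in> space P" for \<omega>
        using that CV sp(1) by (auto simp: PiE_iff subset_iff)
      then have cyl_split: "cyl J S = cyl (J - C) S \<inter> ?r -` E"
        unfolding cyl_def E_def by auto
      have pull_space: "spin_pull ?V (extend G j \<gamma>) \<omega> \<in> space P"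
        if "\<gamma> \<in> Aut (induced G C)" "\<omega> \<in> space P" for \<gamma> \<omega>
        using measurable_space[OF extend_measurable(1)[OF wf jV P inv] that(2)] that(1) sp(1) by (simp add: C_def)
      have pull_cyl: "spin_pull ?V (extend G j \<gamma>) -` cyl (J - C) S \<inter> space P = cyl (J - C) S"
        if \<gamma>: "\<gamma> \<in> Aut (induced G C)" for \<gamma>
      proof -
        have "spin_pull ?V (extend G j \<gamma>) \<omega> x = \<omega> x" if "x \<in> J - C" for \<omega> x
          using that J2(2) unfolding C_def by (intro spin_pull_extend_outside[OF wf jV]) auto
        then show ?thesis using pull_space[OF \<gamma>] by (auto simp: cyl_def)
      qed
      have pull_A: "spin_pull ?V (extend G j \<gamma>) -` A \<inter> space P = A" if \<gamma>: "\<gamma> \<in> Aut (induced G C)" for \<gamma>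
      proof -
        have "extend G j \<gamma> \<in> Aut G" using \<gamma> unfolding C_def by (rule extend_Aut[OF wf jV])
        then have "{\<omega> \<in> space P. spin_pull ?V (extend G j \<gamma>) \<omega> \<in> A} = A"
          using A_inv sp(1) unfolding invariant_event_def by simp
        then show ?thesis by blast
      qed
      \<comment> \<open>Used for the cylinder on the remaining sites and for its intersection with
        \<open>A\<close>; automorphisms moving only \<open>C\<close> change neither.\<close>
      note ci = component_independent[OF wf jV P inv erg[OF jV], folded C_def, OF _ _ _ _ E]
      have 1: "measure P (cyl (J - C) S \<inter> ?r -` E) = measure P (cyl (J - C) S) * measure (marginal P C) E"
        using ci[of "cyl (J - C) S"] cyl_sets[OF J2(1,2)] pull_cyl by blast
      have 2: "measure P (A \<inter> cyl (J - C) S \<inter> ?r -` E) = measure P (A \<inter> cyl (J - C) S) * measure (marginal P C) E"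
        using ci[of "A \<inter> cyl (J - C) S"] cyl_sets[OF J2(1,2)] A pull_cyl pull_A by blast
      have "measure P (A \<inter> cyl J S) = measure P (A \<inter> cyl (J - C) S) * measure (marginal P C) E"
        using 2 cyl_split by (simp add: Int_assoc)
      also have "measure P (A \<inter> cyl (J - C) S) = measure P A * measure P (cyl (J - C) S)"
        by (rule psubset.IH[OF J2(3,2)])
      finally show ?thesis using 1 cyl_split by simp
    qed
  qed
  \<comment> \<open>Independence of cylinders says that these two finite measures agree on a
    generating family; evaluating both at \<open>A\<close> gives
    \<open>P(A) = P(A)^2\<close>.\<close>
  have "density P (indicator A) = density P (\<lambda>_. ennreal (measure P A))"
  proof (rule measure_eqI_PiM_infinite)
    show "sets (density P (indicator A)) = sets (\<Pi>\<^sub>M v\<in>?V. count_space {-1, 1})"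
      "sets (density P (\<lambda>_. ennreal (measure P A))) = sets (\<Pi>\<^sub>M v\<in>?V. count_space {-1, 1})"
      using sp(2) by (simp_all add: spin_space_def)
    show "finite_measure (density P (indicator A))"
      using A by (intro finite_measureI) (simp add: emeasure_density_indicator emeasure_eq_measure)
    fix S :: "'w \<Rightarrow> int set" and J assume J: "finite J" "J \<subseteq> ?V"
    have "prod_emb ?V (\<lambda>v. count_space {-1, 1}) J (Pi\<^sub>E J S) = cyl J S"
      using J(2) sp(1) by (auto simp: prod_emb_def cyl_def PiE_iff extensional_def)
    moreover have "emeasure (density P (indicator A)) (cyl J S) = emeasure (density P (\<lambda>_. ennreal (measure P A))) (cyl J S)"
      using A cyl_sets[OF J] indep[OF J]
      by (simp add: emeasure_density_indicator emeasure_density_const emeasure_eq_measure ennreal_mult)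
    ultimately show "emeasure (density P (indicator A)) (prod_emb ?V (\<lambda>v. count_space {-1, 1}) J (Pi\<^sub>E J S))
        = emeasure (density P (\<lambda>_. ennreal (measure P A))) (prod_emb ?V (\<lambda>v. count_space {-1, 1}) J (Pi\<^sub>E J S))"
      by simp
  qed
  then have "emeasure (density P (indicator A)) A = emeasure (density P (\<lambda>_. ennreal (measure P A))) A" by simp
  then have "measure P A = measure P A * measure P A"
    using A by (simp add: emeasure_density_indicator emeasure_density_const emeasure_eq_measure ennreal_mult[symmetric])
  then show "measure P A = 0 \<or> measure P A = 1" by simp
qed

lemma rooted_iso_event:
  assumes "wf_lgraph G" "locally_finite G" "v \<in> verts G" "spin_measure (verts G) P"
  shows "{\<omega> \<in> space P. rooted_iso (gball G R v) v \<omega> B b \<tau>} \<in> sets P"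
proof -
  let ?S = "{\<omega> \<in> space P. rooted_iso (gball G R v) v \<omega> B b \<tau>}"
  have "rooted_iso (gball G R v) v \<omega> B b \<tau> \<longleftrightarrow> rooted_iso (gball G R v) v \<omega>' B b \<tau>"
    if "\<forall>x\<in>gball_verts G R v. \<omega> x = \<omega>' x" for \<omega> \<omega>'
    unfolding rooted_iso_def using that by auto
  then have "cylinder_event (verts G) (gball_verts G R v) ?S"
    unfolding cylinder_event_def using spin_measure_space(1)[OF assms(4)] by blast
  then show ?thesis
    using cylinder_event_sets[OF finite_gball_verts[OF assms(1-3)] gball_verts_subset]
      spin_measure_space(2)[OF assms(4)] by simp
qed

text \<open>The ball of \<open>v\<close> lies in its component, and by transitivity and invariance
  its labelled law is that of the ball of \<open>\<rho>\<close>. Any component, not only that of the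
  root, is therefore a limit of the same sequence.\<close>

lemma BS_converges_component:
  fixes Gn :: "nat \<Rightarrow> ('v, 'l) lgraph" and G :: "('w, 'l) lgraph"
  assumes wf: "wf_lgraph G" and lf: "locally_finite G" and \<rho>: "\<rho> \<in> verts G" and v: "v \<in> verts G"
    and trans: "transitive_graph G"
    and P: "spin_measure (verts G) P" and inv: "invariant_measure (verts G) (Aut G) P"
    and BS: "BS_converges Gn Pn G P \<rho>"
  defines "C \<equiv> component G v"
  shows "BS_converges Gn Pn (induced G C) (marginal P C) v"
proof -
  note sp = spin_measure_space[OF P]
  let ?V = "verts G"
  have CV: "C \<subseteq> ?V" unfolding C_def by (rule component_subset)
  have vC: "v \<in> C" unfolding C_def by (rule component_centre[OF v])
  have spC: "spin_measure (verts (induced G C)) (marginal P C)"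
    using marginal_spin_measure[OF P CV] by simp
  note \<nu> = spin_measure_space[OF marginal_spin_measure[OF P CV]]
  have ball: "gball (induced G C) R v = gball G R v" for R
    using gball_component[OF wf v, folded C_def, OF vC] .
  have "measure (marginal P C) {\<omega> \<in> space (marginal P C). rooted_iso (gball (induced G C) R v) v \<omega> B b \<tau>}
      = measure P {\<omega> \<in> space P. rooted_iso (gball G R \<rho>) \<rho> \<omega> B b \<tau>}"
    for R and B :: "(nat, 'l) lgraph" and b \<tau>
  proof -
    let ?S = "{\<omega> \<in> space (marginal P C). rooted_iso (gball (induced G C) R v) v \<omega> B b \<tau>}"
    let ?SG = "\<lambda>v. {\<omega> \<in> space P. rooted_iso (gball G R v) v \<omega> B b \<tau>}"
    have "?S \<in> sets (marginal P C)"
      using wf_component[OF wf v] locally_finite_component[OF wf v lf] vC spC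
      unfolding C_def by (intro rooted_iso_event) auto
    then have "measure (marginal P C) ?S = measure P ((\<lambda>\<omega>. restrict \<omega> C) -` ?S \<inter> space P)"
      using \<nu>(2) by (intro measure_marginal[OF P CV]) simp
    also have "(\<lambda>\<omega>. restrict \<omega> C) -` ?S \<inter> space P = ?SG v"
    proof -
      have "rooted_iso (gball G R v) v (restrict \<omega> C) B b \<tau> \<longleftrightarrow> rooted_iso (gball G R v) v \<omega> B b \<tau>" for \<omega>
      proof -
        have "\<forall>x\<in>verts (gball G R v). restrict \<omega> C x = \<omega> x"
          using gball_verts_component[of G R v] by (auto simp: C_def)
        then show ?thesis unfolding rooted_iso_def by simp
      qed
      then show ?thesis using measurable_space[OF measurable_restrict_spin[OF P CV]] \<nu>(1) by (auto simp: ball)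
    qed
    also have "measure P (?SG v) = measure P (?SG \<rho>)"
    proof -
      obtain \<gamma> where \<gamma>: "\<gamma> \<in> Aut G" "\<gamma> \<rho> = v" using trans \<rho> v unfolding transitive_graph_def by blast
      note meas = measurable_spin_pull_measure[OF P AutD(3)[OF \<gamma>(1)]]
      have iso: "rooted_iso (gball G R \<rho>) \<rho> (spin_pull ?V \<gamma> \<omega>) (gball G R v) v \<omega>" for \<omega>
        using rooted_iso_Aut[OF wf \<gamma>(1) \<rho>] \<gamma>(2) by simp
      have osi: "rooted_iso (gball G R v) v \<omega> (gball G R \<rho>) \<rho> (spin_pull ?V \<gamma> \<omega>)" for \<omega>
        by (rule rooted_iso_sym[OF wf_gball[OF wf \<rho>] wf_gball[OF wf v] _ iso]) (simp add: gball_verts_centre[OF \<rho>])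
      have "rooted_iso (gball G R v) v \<omega> B b \<tau> \<longleftrightarrow> rooted_iso (gball G R \<rho>) \<rho> (spin_pull ?V \<gamma> \<omega>) B b \<tau>" for \<omega>
        using rooted_iso_trans[OF wf_gball[OF wf \<rho>] iso[of \<omega>], of B b \<tau>]
          rooted_iso_trans[OF wf_gball[OF wf v] osi[of \<omega>], of B b \<tau>] by blast
      then have "?SG v = spin_pull ?V \<gamma> -` ?SG \<rho> \<inter> space P"
        using measurable_space[OF meas] sp(1) by auto
      moreover have "measure P (spin_pull ?V \<gamma> -` ?SG \<rho> \<inter> space P) = measure P (?SG \<rho>)"
        using inv \<gamma>(1) rooted_iso_event[OF wf lf \<rho> P]
        by (intro measure_spin_pull[OF P AutD(3)[OF \<gamma>(1)]]) (auto simp: invariant_measure_def)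
      ultimately show ?thesis by simp
    qed
    finally show ?thesis .
  qed
  then show ?thesis using BS unfolding BS_converges_def by simp
qed

theorem proposition1p5:
  fixes Gn :: "nat \<Rightarrow> ('v, 'l) lgraph" and Pn :: "nat \<Rightarrow> ('v \<Rightarrow> int) measure"
    and G :: "('w, 'l) lgraph" and P :: "('w \<Rightarrow> int) measure" and \<rho> :: 'w
  assumes "\<And>n. finite_spin_system (Gn n) (Pn n)"
    and "expander_sequence Gn"
    and "limit_spin_system G P"
    and "\<rho> \<in> verts G"
    and "BS_converges Gn Pn G P \<rho>"
    and "\<not> ergodic (verts G) (Aut G) P"
  shows "random_sparse_reconstruction Gn Pn \<and>
    ((\<forall>n. transitive_graph (Gn n) \<and> invariant_measure (verts (Gn n)) (Aut (Gn n)) (Pn n)) \<longrightarrow>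
      sparse_reconstruction Gn Pn (\<lambda>n. Aut (Gn n)))"
proof -
  have G: "wf_lgraph G" "locally_finite G" "transitive_graph G" "spin_measure (verts G) P"
    "invariant_measure (verts G) (Aut G) P"
    using assms(3) by (simp_all add: limit_spin_system_def)
  \<comment> \<open>The component that carries the nontrivial event need not contain
    \<open>\<rho>\<close>; it will serve as a connected limit rooted at its own vertex
    \<open>v\<close>.\<close>
  have "\<exists>v A. v \<in> verts G \<and> A \<in> sets (spin_space (component G v)) \<and>
      (\<forall>\<gamma>\<in>Aut (induced G (component G v)). measure (marginal P (component G v))
          (sym_diff A (spin_pull (component G v) \<gamma> -` A \<inter> space (marginal P (component G v)))) = 0) \<and>
      measure (marginal P (component G v)) A \<noteq> 0 \<and> measure (marginal P (component G v)) A \<noteq> 1"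
    using ergodic_of_components[OF G(1,4,5)] assms(6) by meson
  then obtain v A where v: "v \<in> verts G" and A: "A \<in> sets (spin_space (component G v))"
      "\<And>\<gamma>. \<gamma> \<in> Aut (induced G (component G v)) \<Longrightarrow> measure (marginal P (component G v))
          (sym_diff A (spin_pull (component G v) \<gamma> -` A \<inter> space (marginal P (component G v)))) = 0"
      "measure (marginal P (component G v)) A \<noteq> 0" "measure (marginal P (component G v)) A \<noteq> 1"
    by blast
  define C where "C = component G v"
  define Gc where "Gc = induced G C"
  define \<nu> where "\<nu> = marginal P C"
  have VC: "verts Gc = C" by (simp add: Gc_def)
  have \<nu>: "spin_measure C \<nu>"
    unfolding \<nu>_def C_def by (rule marginal_spin_measure[OF G(4) component_subset])
  interpret \<nu>: prob_space \<nu> by (rule spin_measure_space(3)[OF \<nu>])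
  have vC: "v \<in> verts Gc" unfolding VC C_def by (rule component_centre[OF v])
  have Gc: "wf_lgraph Gc" "locally_finite Gc" "transitive_graph Gc" "component Gc v = verts Gc"
    unfolding Gc_def C_def
    by (rule wf_component[OF G(1) v] locally_finite_component[OF G(1) v G(2)]
        transitive_component[OF G(1) v G(3)] component_component[OF G(1) v])+
  have \<nu>': "spin_measure (verts Gc) \<nu>" using \<nu> by (simp add: VC)
  have inv: "invariant_measure (verts Gc) (Aut Gc) \<nu>"
    unfolding Gc_def C_def \<nu>_def by (rule marginal_invariant[OF G(1) v G(4,5)])
  have BS: "BS_converges Gn Pn Gc \<nu> v"
    unfolding Gc_def C_def \<nu>_def
    by (rule BS_converges_component[OF G(1,2) assms(4) v G(3,4,5) assms(5)])
  have A': "A \<in> sets \<nu>" using A(1) spin_measure_space(2)[OF \<nu>] by (simp add: C_def)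
  have "measure \<nu> A \<noteq> 0" "measure \<nu> A \<noteq> 1" using A(3,4) by (simp_all add: \<nu>_def C_def)
  then have A01: "0 < measure \<nu> A" "measure \<nu> A < 1"
    using measure_nonneg[of \<nu> A] \<nu>.prob_le_1[of A] by linarith+
  have A_inv: "measure \<nu> (sym_diff A (spin_pull (verts Gc) \<gamma> -` A \<inter> space \<nu>)) = 0"
    if "\<gamma> \<in> Aut Gc" for \<gamma>
    using A(2)[of \<gamma>] that unfolding VC unfolding \<nu>_def Gc_def C_def .
  note reconstruction = connected_reconstruction[OF assms(1,2) Gc(1,2) vC Gc(3,4) \<nu>' inv BS A' A01 A_inv]
  show ?thesis using reconstruction by simp
qed

end
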